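(* Let $\mathcal{G}$ be a closed class of graphs, let $L_n$ be the number of vertices of the largest connected component of a uniformly random graph from $\mathcal{G}$ with $n$ vertices, and let $M_n=n-L_n$. Then for each fixed $k\ge0$, $$\mathbf{P}(M_n=k)\to p_k=p\cdot g_k\frac{\rho^k}{k!},$$ where $p=\lim_n c_n/g_n$ is the limiting probability that a random graph in $\mathcal{G}$ is connected. As $k\to\infty$, either $p_k\sim c\,k^{-5/2}$ or $p_k\sim c\,k^{-7/2}$ (for a constant $c>0$), according as the subexponential term in the estimate of $g_k$ is $k^{-5/2}$ or $k^{-7/2}$. Moreover $\sum_kp_k=1$, and $\mathbb{E}[M_n]\to\tau$ in case (1) and $\mathbb{E}[M_n]\to R$ in case (2). In case (1) the variance of the limit law does not exist, and in case (2) the variance of $M_n$ tends to $R+2C_4$.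
   Context: Graphs are labelled. A class $\mathcal{G}$ (closed under isomorphism) is closed if a graph is in $\mathcal{G}$ iff its connected components, blocks and 3-connected components all are; its 3-connected members' generating function $T(x,z)$ satisfies: for fixed $x$ a unique dominant singularity $r(x)$ with an expansion $\sum_{n\ge n_0}T_n(x)(1-z/r(x))^{n/\kappa}$, $r,T_n$ analytic. $g_n,c_n$ are the numbers of graphs and connected graphs in $\mathcal{G}$ on $\{1,\dots,n\}$ (with $g_0=1$); $B(x),C(x),G(x)=e^{C(x)}$ are the exponential generating functions of 2-connected, connected and all graphs, with $xC'(x)=x\exp(B'(xC'(x)))$; $R$ is the radius of convergence of $B$. Case (1): $RB''(R)>1$, $\tau\in(0,R)$ solves $\tau B''(\tau)=1$ and $\rho=\tau e^{-B'(\tau)}$. Case (2): $RB''(R)<1$, $\rho=Re^{-B'(R)}$, and $C(x)=C_0+C_2X^2+C_4X^4+C_5X^5+O(X^6)$ with $X=\sqrt{1-x/\rho}$. In both cases $\rho$ is the radius of convergence of $C$. *)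

theory Defs
  imports "HOL-Probability.Probability" "HOL-Complex_Analysis.Complex_Analysis"
    "HOL-Library.Landau_Symbols"
begin

section \<open>Labelled simple graphs\<close>

type_synonym graph = "nat set \<times> nat set set"

abbreviation verts :: "graph \<Rightarrow> nat set" where "verts \<equiv> fst"

abbreviation edges :: "graph \<Rightarrow> nat set set" where "edges \<equiv> snd"

definition is_graph :: "graph \<Rightarrow> bool" where
  "is_graph g \<longleftrightarrow> finite (verts g) \<and> (\<forall>e\<in>edges g. e \<subseteq> verts g \<and> card e = 2)"

definition graph_iso :: "graph \<Rightarrow> graph \<Rightarrow> bool" where
  "graph_iso g h \<longleftrightarrow> (\<exists>f. bij_betw f (verts g) (verts h) \<and> edges h = (\<lambda>e. f ` e) ` edges g)"

definition subgraph_of :: "graph \<Rightarrow> graph \<Rightarrow> bool" where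
  "subgraph_of h g \<longleftrightarrow> is_graph h \<and> verts h \<subseteq> verts g \<and> edges h \<subseteq> edges g"

definition induced :: "graph \<Rightarrow> nat set \<Rightarrow> graph" where
  "induced g W = (verts g \<inter> W, {e \<in> edges g. e \<subseteq> W})"

definition reach :: "graph \<Rightarrow> (nat \<times> nat) set" where
  "reach g = {(u, v). {u, v} \<in> edges g}\<^sup>*"

text \<open>The graph without vertices is not connected, so that it has no connected component.\<close>

definition connected_graph :: "graph \<Rightarrow> bool" where
  "connected_graph g \<longleftrightarrow> is_graph g \<and> verts g \<noteq> {} \<and> (\<forall>u\<in>verts g. \<forall>v\<in>verts g. (u, v) \<in> reach g)"

text \<open>A single edge counts as 2-connected (so that \<open>B(x)\<close> starts with \<open>x\<^sup>2/2\<close>), a single vertex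
  does not; 3-connected graphs have at least four vertices.\<close>

definition two_connected :: "graph \<Rightarrow> bool" where
  "two_connected g \<longleftrightarrow> is_graph g \<and> 2 \<le> card (verts g) \<and>
     (\<forall>S\<subseteq>verts g. card S < 2 \<longrightarrow> connected_graph (induced g (verts g - S)))"

definition three_connected :: "graph \<Rightarrow> bool" where
  "three_connected g \<longleftrightarrow> is_graph g \<and> 4 \<le> card (verts g) \<and>
     (\<forall>S\<subseteq>verts g. card S < 3 \<longrightarrow> connected_graph (induced g (verts g - S)))"

definition components_of :: "graph \<Rightarrow> graph set" where
  "components_of g = (\<lambda>v. induced g {u. (v, u) \<in> reach g}) ` verts g"

definition blocks_of :: "graph \<Rightarrow> graph set" where
  "blocks_of g = {b. subgraph_of b g \<and> two_connected b \<and>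
     (\<forall>h. subgraph_of h g \<and> two_connected h \<and> subgraph_of b h \<longrightarrow> h = b)}"

text \<open>\<open>split_part g h\<close>: the graph \<open>h\<close> is one of the two parts obtained by splitting \<open>g\<close> at a
  separation pair \<open>{u, v}\<close>, the virtual edge \<open>{u, v}\<close> being added to each part.  Splitting a block
  until no separation pair is left ends with triangles and with 3-connected graphs (Tutte, Hopcroft
  and Tarjan); the latter do not depend on the choices made.  Virtual edges parallel to an edge
  are identified with it, which only suppresses the multiple edges (bonds) of the decomposition.\<close>

definition split_part :: "graph \<Rightarrow> graph \<Rightarrow> bool" where
  "split_part g h \<longleftrightarrow> (\<exists>A B u v. A \<union> B = verts g \<and> A \<inter> B = {u, v} \<and> u \<noteq> v \<and>
     A - B \<noteq> {} \<and> B - A \<noteq> {} \<and> (\<forall>e\<in>edges g. e \<subseteq> A \<or> e \<subseteq> B) \<and>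
     h = (A, insert {u, v} {e \<in> edges g. e \<subseteq> A}))"

definition three_components_of :: "graph \<Rightarrow> graph set" where
  "three_components_of g = {h. three_connected h \<and> (\<exists>b\<in>blocks_of g. split_part\<^sup>*\<^sup>* b h)}"

text \<open>Membership is equivalent to membership of all connected components, to that of all blocks, and
  to that of all 3-connected components.  In particular a graph without 3-connected
  components (a series-parallel graph) belongs to every closed class, and a closed class is
  determined by its 3-connected members.\<close>

definition closed_class :: "graph set \<Rightarrow> bool" where
  "closed_class \<G> \<longleftrightarrow>
     (\<forall>g\<in>\<G>. is_graph g) \<and>
     (\<forall>g h. g \<in> \<G> \<and> is_graph h \<and> graph_iso g h \<longrightarrow> h \<in> \<G>) \<and>
     (\<forall>g. is_graph g \<longrightarrow>
        (g \<in> \<G> \<longleftrightarrow> components_of g \<subseteq> \<G>) \<and>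
        (g \<in> \<G> \<longleftrightarrow> blocks_of g \<subseteq> \<G>) \<and>
        (g \<in> \<G> \<longleftrightarrow> three_components_of g \<subseteq> \<G>))"


section \<open>Counting sequences and generating functions\<close>

definition graphs_on :: "graph set \<Rightarrow> nat \<Rightarrow> graph set" where
  "graphs_on \<G> n = {g \<in> \<G>. verts g = {1..n}}"

definition num_graphs :: "graph set \<Rightarrow> nat \<Rightarrow> nat" where
  "num_graphs \<G> n = card (graphs_on \<G> n)"

definition num_connected :: "graph set \<Rightarrow> nat \<Rightarrow> nat" where
  "num_connected \<G> n = card {g \<in> graphs_on \<G> n. connected_graph g}"

definition num_two_connected :: "graph set \<Rightarrow> nat \<Rightarrow> nat" where
  "num_two_connected \<G> n = card {g \<in> graphs_on \<G> n. two_connected g}"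

definition num_three_connected :: "graph set \<Rightarrow> nat \<Rightarrow> nat \<Rightarrow> nat" where
  "num_three_connected \<G> n m =
     card {g \<in> graphs_on \<G> n. three_connected g \<and> card (edges g) = m}"

definition egf :: "(nat \<Rightarrow> nat) \<Rightarrow> 'a::field_char_0 fps" where
  "egf a = Abs_fps (\<lambda>n. of_nat (a n) / fact n)"

definition G_gf :: "graph set \<Rightarrow> 'a::field_char_0 fps" where
  "G_gf \<G> = egf (num_graphs \<G>)"

definition C_gf :: "graph set \<Rightarrow> 'a::field_char_0 fps" where
  "C_gf \<G> = egf (num_connected \<G>)"

definition B_gf :: "graph set \<Rightarrow> 'a::field_char_0 fps" where
  "B_gf \<G> = egf (num_two_connected \<G>)"

text \<open>\<open>T(x,z) = \<Sum>\<^sub>n\<^sub>,\<^sub>m t\<^sub>n\<^sub>,\<^sub>m x\<^sup>n/n! z\<^sup>m\<close> as a power series in \<open>z\<close> for fixed \<open>x\<close>.  A connected graph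
  with \<open>m > 0\<close> edges has at most \<open>m + 1 \<le> 2 m\<close> vertices, so the inner sum contains all nonzero terms.\<close>

definition T_gf :: "graph set \<Rightarrow> complex \<Rightarrow> complex fps" where
  "T_gf \<G> x = Abs_fps (\<lambda>m. \<Sum>n\<le>2*m. of_nat (num_three_connected \<G> n m) * x ^ n / fact n)"


section \<open>Singular expansions\<close>

definition dented_disk :: "real \<Rightarrow> real \<Rightarrow> real \<Rightarrow> complex set" where
  "dented_disk r s \<phi> =
     {z. norm z < s \<and> z \<noteq> of_real r \<and> \<phi> < \<bar>Arg (z - of_real r)\<bar>}"

text \<open>\<open>F\<close> is the analytic continuation of the power series \<open>f\<close> to the dented disk \<open>D\<close> at \<open>r\<close>.\<close>

definition dented_continuation ::
    "complex fps \<Rightarrow> real \<Rightarrow> complex set \<Rightarrow> (complex \<Rightarrow> complex) \<Rightarrow> bool" where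
  "dented_continuation f r D F \<longleftrightarrow>
     0 < r \<and> (\<exists>s \<phi>. r < s \<and> 0 < \<phi> \<and> \<phi> < pi / 2 \<and> D = dented_disk r s \<phi>) \<and>
     F holomorphic_on D \<and> (\<forall>z\<in>D. norm z < r \<longrightarrow> F z = eval_fps f z)"

text \<open>For each fixed \<open>x > 0\<close> the point \<open>r(x)\<close> is the unique dominant singularity of \<open>T(x,\<cdot>)\<close>, with an
  expansion \<open>\<Sum>\<^sub>n\<^sub>\<ge>\<^sub>n\<^sub>0 T\<^sub>n(x) (1 - z/r(x))\<^bsup>n/\<kappa>\<^esup>\<close> to every order, where \<open>n\<^sub>0\<close> may be negative.
  Analyticity in \<open>x\<close> is analyticity in a complex neighbourhood of the positive half-line.\<close>

definition T_singular :: "graph set \<Rightarrow> bool" where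
  "T_singular \<G> \<longleftrightarrow> (\<exists>r (T :: int \<Rightarrow> complex \<Rightarrow> complex) (n0 :: int) (\<kappa> :: nat).
     0 < \<kappa> \<and> r analytic_on complex_of_real ` {0<..} \<and>
     (\<forall>n\<ge>n0. T n analytic_on complex_of_real ` {0<..}) \<and>
     (\<forall>x>0. \<exists>rx D F. r (of_real x) = of_real rx \<and>
        fps_conv_radius (T_gf \<G> (of_real x)) = ereal rx \<and>
        dented_continuation (T_gf \<G> (of_real x)) rx D F \<and>
        (\<forall>N\<ge>n0. (\<lambda>z. F z - (\<Sum>n\<in>{n0..<N}.
              T n (of_real x) * (1 - z / of_real rx) powr (of_int n / of_nat \<kappa>)))
           \<in> O[at (of_real rx) within D](\<lambda>z. (1 - z / of_real rx) powr (of_int N / of_nat \<kappa>)))))"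

text \<open>\<open>R B''(R)\<close>, where \<open>R\<close> is the radius of convergence of \<open>B\<close>; the value may be infinite.\<close>

definition RB2 :: "graph set \<Rightarrow> real \<Rightarrow> ennreal" where
  "RB2 \<G> R = ennreal R * (\<Sum>n. ennreal (fps_nth (fps_deriv (fps_deriv (B_gf \<G>))) n * R ^ n))"

definition case_one :: "graph set \<Rightarrow> real \<Rightarrow> real \<Rightarrow> real \<Rightarrow> bool" where
  "case_one \<G> R \<tau> \<rho> \<longleftrightarrow>
     RB2 \<G> R > 1 \<and> 0 < \<tau> \<and> \<tau> < R \<and>
     \<tau> * eval_fps (fps_deriv (fps_deriv (B_gf \<G>))) \<tau> = 1 \<and>
     \<rho> = \<tau> * exp (- eval_fps (fps_deriv (B_gf \<G>)) \<tau>)"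

text \<open>\<open>C\<^sub>5 \<noteq> 0\<close>, as \<open>C\<^sub>5 X\<^sup>5\<close> is the leading singular term of the expansion.\<close>

definition case_two ::
    "graph set \<Rightarrow> real \<Rightarrow> real \<Rightarrow> real \<Rightarrow> real \<Rightarrow> real \<Rightarrow> real \<Rightarrow> bool" where
  "case_two \<G> R \<rho> C0 C2 C4 C5 \<longleftrightarrow>
     RB2 \<G> R < 1 \<and>
     \<rho> = R * exp (- eval_fps (fps_deriv (B_gf \<G>)) R) \<and>
     C5 \<noteq> 0 \<and>
     (\<exists>D F. dented_continuation (C_gf \<G>) \<rho> D F \<and>
        (let X = (\<lambda>z. csqrt (1 - z / of_real \<rho>)) in
          (\<lambda>z. F z - (of_real C0 + of_real C2 * X z ^ 2 + of_real C4 * X z ^ 4 + of_real C5 * X z ^ 5))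
            \<in> O[at (of_real \<rho>) within D](\<lambda>z. X z ^ 6)))"


section \<open>Random graphs and the largest component\<close>

definition random_graph :: "graph set \<Rightarrow> nat \<Rightarrow> graph pmf" where
  "random_graph \<G> n = pmf_of_set (graphs_on \<G> n)"

definition largest_component :: "graph \<Rightarrow> nat" where
  "largest_component g = Max ((\<lambda>h. card (verts h)) ` components_of g)"

definition missed :: "graph \<Rightarrow> nat" where
  "missed g = card (verts g) - largest_component g"

definition subexp_estimate :: "(nat \<Rightarrow> nat) \<Rightarrow> real \<Rightarrow> real \<Rightarrow> bool" where
  "subexp_estimate a \<rho> \<alpha> \<longleftrightarrow> (\<exists>b>0. (\<lambda>n. real (a n)) \<sim>[at_top]
     (\<lambda>n. b * real n powr (- \<alpha>) * (1 / \<rho>) ^ n * fact n))"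

end

theory Submission
  imports Defs "HOL-Real_Asymp.Real_Asymp"
begin

text \<open>
  Write \<open>a\<^sub>n = c\<^sub>n \<rho>\<^sup>n / n!\<close> and \<open>\<gamma>\<^sub>n = g\<^sub>n \<rho>\<^sup>n / n!\<close>.  For \<open>2 k < n\<close> a graph with \<open>M\<^sub>n = k\<close> is a graph on
  \<open>k\<close> vertices together with a connected graph on the other ones, so
  \<open>P(M\<^sub>n = k) = \<gamma>\<^sub>k a\<^bsub>n-k\<^esub> / \<gamma>\<^sub>n\<close>; if \<open>2 M\<^sub>n \<ge> n\<close>, some union of components has between
  \<open>n/3\<close> and \<open>2n/3\<close> vertices, and such graphs are negligible.  Hence everything follows from
  \<open>a\<^sub>n \<sim> b n\<^bsup>-\<alpha>\<^esup>\<close> with \<open>\<alpha> > 2\<close>: then \<open>\<gamma>\<^sub>n / a\<^sub>n\<close> tends to \<open>\<Sum>\<gamma>\<^sub>k\<close>, and since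
  \<open>n \<gamma>\<^sub>n = \<Sum> k a\<^sub>k \<gamma>\<^bsub>n-k\<^esub>\<close>, the limit law has mean \<open>\<Sum> k a\<^sub>k\<close> and, for \<open>\<alpha> > 3\<close>, variance \<open>\<Sum> k\<^sup>2 a\<^sub>k\<close>.

  The mean is the value \<open>u(\<rho>)\<close> of \<open>u = x C'(x)\<close>, which is \<open>\<tau>\<close> or \<open>R\<close> because
  \<open>\<psi>(v) = v exp(-B'(v))\<close> is strictly increasing up to this point.  In case (1) Lagrange inversion writes
  \<open>n\<^sup>2 a\<^sub>n\<close> as an integral over the circle of radius \<open>\<tau>\<close>, where \<open>\<tau> B''(\<tau>) = 1\<close> makes \<open>\<tau>\<close> a
  saddle point, and Laplace's method gives \<open>\<alpha> = 5/2\<close>.  In case (2) the remainder of the expansion of \<open>C\<close> is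
  \<open>O(|\<rho> - z|\<^sup>3)\<close>, so by Cauchy's estimate its fifth derivative is \<open>O(|\<rho> - z|\<^bsup>-2\<^esup>)\<close>; the integral of
  \<open>|\<rho> - z|\<^bsup>-2\<^esup>\<close> over a circle is explicit and bounds the coefficients of the remainder by
  \<open>O(n\<^bsup>-4\<^esup>)\<close>, whence \<open>\<alpha> = 7/2\<close>.
\<close>

text \<open>The window from n/3 to 2n/3 comes from a smallest union of components with at least n/3
  vertices. Such graphs are negligible because both parts have linear size: the product of their
  weights is O(n^(-2\<alpha>)), and neither the choice of the size nor the moment considered makes
  up for the lost factor n^(-\<alpha>). This needs an upper bound for \<open>gam\<close> of the
  right order before its asymptotics are known; it holds since the weight (n+1)^(-\<alpha>) is, up
  to a constant, stable under convolution, hence under exponentials of power series.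

  In case (2) R lies on the boundary of convergence, so monotonicity of \<psi> is derived from
  differences of powers and not from derivatives. An exponent of -2 is the Poisson kernel, whose
  mean over the circle of radius \<rho>(1 - 1/n) is O(n); undoing five derivatives divides by about
  n^5, and O(n^(-4)) is just smaller than the n^(-7/2) of C5 X^5. Since X^2 = 1 - x/\<rho>, putting
  x = \<rho>(1 - \<epsilon>) makes C4 the coefficient of \<epsilon>^2, so n(n-1) \<open>a n\<close>
  sums to 2 C4; adding the mean R gives the variance.\<close>

section \<open>Unions of connected components\<close>

text \<open>Formulated through edges instead of paths, so that passing to complements and
  differences is elementary set theory. The empty set is allowed.\<close>

definition union_of_components :: "graph \<Rightarrow> nat set \<Rightarrow> bool" where
  "union_of_components g W \<longleftrightarrow> W \<subseteq> verts g \<and> (\<forall>e\<in>edges g. e \<subseteq> W \<or> e \<inter> W = {})"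

definition component :: "graph \<Rightarrow> nat \<Rightarrow> nat set" where
  "component g v = {u. (v, u) \<in> reach g}"

lemma is_graph_induced: "is_graph g \<Longrightarrow> is_graph (induced g W)"
  by (auto simp: is_graph_def induced_def)

lemma verts_induced: "W \<subseteq> verts g \<Longrightarrow> verts (induced g W) = W"
  by (auto simp: induced_def)

lemma induced_induced: "K \<subseteq> W \<Longrightarrow> induced (induced g W) K = induced g K"
  by (auto simp: induced_def)

lemma induced_verts: "is_graph g \<Longrightarrow> induced g (verts g) = g"
  by (cases g) (auto simp: induced_def is_graph_def)

lemma edge_ends: "is_graph g \<Longrightarrow> {u, v} \<in> edges g \<Longrightarrow> u \<in> verts g \<and> v \<in> verts g"
  by (auto simp: is_graph_def)

lemma edgeE:
  assumes "is_graph g" "e \<in> edges g"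
  obtains u v where "e = {u, v}" "u \<noteq> v"
  using assms unfolding is_graph_def by (metis card_2_iff)

lemma reach_refl: "(v, v) \<in> reach g"
  by (simp add: reach_def)

lemma reach_trans: "(u, v) \<in> reach g \<Longrightarrow> (v, w) \<in> reach g \<Longrightarrow> (u, w) \<in> reach g"
  unfolding reach_def by (rule rtrancl_trans)

lemma reach_edge: "{u, v} \<in> edges g \<Longrightarrow> (u, v) \<in> reach g"
  unfolding reach_def by (rule r_into_rtrancl) simp

lemma reach_sym: "(u, v) \<in> reach g \<Longrightarrow> (v, u) \<in> reach g"
proof -
  have "sym {(u, v). {u, v} \<in> edges g}"
    by (auto simp: sym_def insert_commute)
  then have "sym (reach g)"
    unfolding reach_def by (rule sym_rtrancl)
  then show "(u, v) \<in> reach g \<Longrightarrow> (v, u) \<in> reach g"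
    by (auto simp: sym_def)
qed

lemma reach_mono: "edges h \<subseteq> edges g \<Longrightarrow> reach h \<subseteq> reach g"
  unfolding reach_def by (rule rtrancl_mono) auto

text \<open>A walk that starts in \<open>W\<close> only uses edges meeting \<open>W\<close>, hence
  edges inside \<open>W\<close>, so it survives in the induced graph.\<close>

lemma reach_union_of_components:
  assumes "union_of_components g W" "(u, v) \<in> reach g" "u \<in> W"
  shows "v \<in> W \<and> (u, v) \<in> reach (induced g W)"
  using assms(2) unfolding reach_def
proof (induction rule: rtrancl_induct)
  case base
  then show ?case using assms(3) by simp
next
  case (step y z)
  then have "{y, z} \<in> edges (induced g W)"
    using assms(1) by (auto simp: union_of_components_def induced_def)
  with step show ?case
    by (auto simp: induced_def intro: rtrancl_into_rtrancl)
qed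

lemma component_induced:
  assumes "union_of_components g W" "u \<in> W"
  shows "component (induced g W) u = component g u" "component g u \<subseteq> W"
proof -
  have "reach (induced g W) \<subseteq> reach g"
    by (rule reach_mono) (auto simp: induced_def)
  then show "component (induced g W) u = component g u" "component g u \<subseteq> W"
    using reach_union_of_components[OF assms(1) _ assms(2)] by (auto simp: component_def)
qed

lemma union_of_components_component:
  assumes "is_graph g" "v \<in> verts g"
  shows "union_of_components g (component g v)"
proof -
  have "component g v \<subseteq> verts g"
  proof
    fix u assume "u \<in> component g v"
    then have "(v, u) \<in> {(u, v). {u, v} \<in> edges g}\<^sup>*"
      by (simp add: component_def reach_def)
    then show "u \<in> verts g"
      by (induction rule: rtrancl_induct) (use assms edge_ends in auto)
  qed
  moreover have "e \<subseteq> component g v \<or> e \<inter> component g v = {}" if "e \<in> edges g" for e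
  proof -
    obtain a b where e: "e = {a, b}" by (rule edgeE[OF assms(1) \<open>e \<in> edges g\<close>])
    have "(a, b) \<in> reach g" "(b, a) \<in> reach g"
      using that e by (auto intro: reach_edge simp: insert_commute)
    then show ?thesis
      unfolding e component_def using reach_trans by blast
  qed
  ultimately show ?thesis
    by (auto simp: union_of_components_def)
qed

lemma union_of_components_Diff:
  "is_graph g \<Longrightarrow> union_of_components g W \<Longrightarrow> union_of_components g (verts g - W)"
  by (auto simp: union_of_components_def is_graph_def)

lemma union_of_components_Diff2:
  "union_of_components g W \<Longrightarrow> union_of_components g K \<Longrightarrow> union_of_components g (W - K)"
  unfolding union_of_components_def by fast

lemma component_self: "v \<in> component g v"
  by (simp add: component_def reach_refl)

lemma components_of_eq: "components_of g = (\<lambda>v. induced g (component g v)) ` verts g"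
  by (simp add: components_of_def component_def)

text \<open>Components of vertices in a union \<open>U\<close> of components stay in
  \<open>U\<close> and do not change when the graph is restricted to \<open>U\<close>; this is
  applied to \<open>W\<close> and to its complement.\<close>

lemma components_of_Un:
  assumes "is_graph g" "union_of_components g W"
  shows "components_of g = components_of (induced g W) \<union> components_of (induced g (verts g - W))"
proof -
  have W: "W \<subseteq> verts g" using assms by (simp add: union_of_components_def)
  have *: "components_of (induced g U) = (\<lambda>v. induced g (component g v)) ` U"
    if "union_of_components g U" for U
  proof -
    have "U \<subseteq> verts g" using that by (simp add: union_of_components_def)
    then show ?thesis
      using component_induced[OF that]
      by (auto simp: components_of_eq verts_induced induced_induced intro!: image_cong)
  qed
  show ?thesis
    unfolding *[OF assms(2)] *[OF union_of_components_Diff[OF assms]] image_Un[symmetric]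
    using W by (simp add: components_of_eq Un_absorb1)
qed

text \<open>Membership is decided by the components, and these are shared out between the two
  induced graphs. The cases where \<open>W\<close> is empty or everything are included, because the
  graph without vertices has no component and is thus a member.\<close>

lemma closed_class_split:
  assumes "closed_class \<G>" "is_graph g" "union_of_components g W"
  shows "g \<in> \<G> \<longleftrightarrow> induced g W \<in> \<G> \<and> induced g (verts g - W) \<in> \<G>"
  using assms(1) is_graph_induced[OF assms(2)] components_of_Un[OF assms(2,3)] assms(2)
  unfolding closed_class_def by (metis Un_subset_iff)

lemma connected_component:
  assumes "is_graph g" "v \<in> verts g"
  shows "connected_graph (induced g (component g v))"
proof -
  note W = union_of_components_component[OF assms]
  have sub: "component g v \<subseteq> verts g" using W by (simp add: union_of_components_def)
  have "(a, b) \<in> reach (induced g (component g v))"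
    if "a \<in> component g v" "b \<in> component g v" for a b
    using reach_union_of_components[OF W _ that(1)] that
    by (metis component_def mem_Collect_eq reach_sym reach_trans)
  then show ?thesis
    using component_self[of v g]
    by (auto simp: connected_graph_def is_graph_induced assms verts_induced sub)
qed

lemma connected_union_is_component:
  assumes "union_of_components g W" "connected_graph (induced g W)" "v \<in> W"
  shows "W = component g v"
proof -
  have "verts (induced g W) = W"
    using assms(1) by (simp add: union_of_components_def verts_induced)
  then have "W \<subseteq> component (induced g W) v"
    using assms(2,3) by (auto simp: connected_graph_def component_def)
  then show ?thesis using component_induced[OF assms(1,3)] by auto
qed

section \<open>Relabelling\<close>

definition relabel :: "(nat \<Rightarrow> nat) \<Rightarrow> graph \<Rightarrow> graph" where
  "relabel f g = (f ` verts g, (\<lambda>e. f ` e) ` edges g)"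

lemma is_graph_relabel:
  assumes "is_graph g" "inj_on f (verts g)"
  shows "is_graph (relabel f g)"
  using assms unfolding is_graph_def relabel_def
  by (auto simp: card_image inj_on_subset)

lemma graph_iso_relabel: "inj_on f (verts g) \<Longrightarrow> graph_iso g (relabel f g)"
  unfolding graph_iso_def relabel_def by (auto intro!: exI[of _ f] simp: bij_betw_def)

lemma relabel_relabel:
  assumes "is_graph g" "\<And>x. x \<in> verts g \<Longrightarrow> f' (f x) = x"
  shows "relabel f' (relabel f g) = g"
proof -
  have "(\<lambda>x. f' (f x)) ` e = e" if "e \<subseteq> verts g" for e
    using assms(2) that by force
  then have "f' ` f ` verts g = verts g" "\<And>e. e \<in> edges g \<Longrightarrow> f' ` f ` e = e"
    using assms(1) by (auto simp: is_graph_def image_image)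
  then show ?thesis
    by (cases g) (auto simp: relabel_def image_image intro!: image_cong)
qed

lemma connected_relabel:
  assumes "connected_graph g" "inj_on f (verts g)"
  shows "connected_graph (relabel f g)"
proof -
  have "(f u, f v) \<in> reach (relabel f g)" if "(u, v) \<in> reach g" for u v
    using that unfolding reach_def
  proof (induction rule: rtrancl_induct)
    case (step y z)
    then have "f ` {y, z} \<in> edges (relabel f g)"
      unfolding relabel_def by (intro image_eqI[of _ _ "{y, z}"] | simp)+
    then have "{f y, f z} \<in> edges (relabel f g)"
      by simp
    with step show ?case by (auto intro: rtrancl_into_rtrancl)
  qed simp
  then show ?thesis
    using assms is_graph_relabel[of g f]
    by (auto simp: connected_graph_def) (auto simp: relabel_def)
qed

lemma finite_graphs:
  assumes "finite S"
  shows "finite {g. is_graph g \<and> verts g = S}"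
proof (rule finite_subset)
  show "{g. is_graph g \<and> verts g = S} \<subseteq> {S} \<times> Pow (Pow S)"
    by (auto simp: is_graph_def)
qed (use assms in auto)

text \<open>Relabelling along a bijection is injective on graphs, since the inverse map undoes it;
  exchanging \<open>S\<close> and \<open>S'\<close> gives the reverse inequality.\<close>

lemma card_relabel:
  assumes S: "finite S" "card S = card S'" "finite S'"
    and P: "\<And>g f. P g \<Longrightarrow> inj_on f (verts g) \<Longrightarrow> P (relabel f g)" and gr: "\<And>g. P g \<Longrightarrow> is_graph g"
  shows "card {g. P g \<and> verts g = S} = card {g. P g \<and> verts g = S'}"
proof -
  have *: "card {g. P g \<and> verts g = S} \<le> card {g. P g \<and> verts g = S'}"
    if "finite S" "card S = card S'" "finite S'" for S S'
  proof -
    have "\<exists>f. bij_betw f S S'"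
      using that finite_same_card_bij by blast
    then obtain f where f: "bij_betw f S S'" ..
    have inj: "inj_on f S" and im: "f ` S = S'" using f by (auto simp: bij_betw_def)
    show ?thesis
    proof (rule card_inj_on_le)
      show "inj_on (relabel f) {g. P g \<and> verts g = S}"
        by (rule inj_on_inverseI[where g = "relabel (inv_into S f)"])
          (use inj gr in \<open>auto intro!: relabel_relabel\<close>)
      show "relabel f ` {g. P g \<and> verts g = S} \<subseteq> {g. P g \<and> verts g = S'}"
        using P inj im by (auto simp: relabel_def)
      show "finite {g. P g \<and> verts g = S'}"
        by (rule finite_subset[OF _ finite_graphs[OF \<open>finite S'\<close>]]) (use gr in auto)
    qed
  qed
  show ?thesis using *[of S S'] *[of S' S] S by simp
qed

lemma closed_class_relabel:
  assumes "closed_class \<G>" "g \<in> \<G>" "inj_on f (verts g)"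
  shows "relabel f g \<in> \<G>"
  using assms graph_iso_relabel[OF assms(3)] is_graph_relabel[OF _ assms(3)]
  unfolding closed_class_def by blast

lemma card_graphs_with_verts:
  assumes "closed_class \<G>" "finite S"
  shows "card {g \<in> \<G>. verts g = S} = num_graphs \<G> (card S)"
    "card {g \<in> \<G>. connected_graph g \<and> verts g = S} = num_connected \<G> (card S)"
proof -
  have gr: "\<And>g. g \<in> \<G> \<Longrightarrow> is_graph g" using assms by (simp add: closed_class_def)
  have "card {g \<in> \<G>. verts g = S} = card {g \<in> \<G>. verts g = {1..card S}}"
    by (rule card_relabel) (use assms closed_class_relabel gr in auto)
  then show "card {g \<in> \<G>. verts g = S} = num_graphs \<G> (card S)"
    by (simp add: num_graphs_def graphs_on_def)
  have "card {g. (g \<in> \<G> \<and> connected_graph g) \<and> verts g = S}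
    = card {g. (g \<in> \<G> \<and> connected_graph g) \<and> verts g = {1..card S}}"
    by (rule card_relabel) (use assms closed_class_relabel connected_relabel gr in auto)
  moreover have "{g \<in> graphs_on \<G> (card S). connected_graph g}
    = {g. (g \<in> \<G> \<and> connected_graph g) \<and> verts g = {1..card S}}"
    by (auto simp: graphs_on_def)
  ultimately show "card {g \<in> \<G>. connected_graph g \<and> verts g = S} = num_connected \<G> (card S)"
    by (simp add: num_connected_def conj_assoc)
qed

lemma finite_graphs_on: "closed_class \<G> \<Longrightarrow> finite (graphs_on \<G> n)"
  by (rule finite_subset[OF _ finite_graphs[of "{1..n}"]]) (auto simp: graphs_on_def closed_class_def)

section \<open>Splitting off a union of components\<close>

text \<open>Cutting along \<open>W\<close> is inverted by the disjoint union \<open>?j\<close>. The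
  predicate \<open>Q\<close> makes one bijection serve two counts: a connected rest for the exact
  law, an arbitrary rest for the bound on balanced splittings.\<close>

lemma card_graphs_split:
  assumes G: "closed_class \<G>" and S: "finite S" "W \<subseteq> S"
    and Q: "Q = (\<lambda>_. True) \<or> Q = connected_graph"
  shows "card {g \<in> \<G>. verts g = S \<and> union_of_components g W \<and> Q (induced g (S - W))}
    = card {g \<in> \<G>. verts g = W} * card {g \<in> \<G>. Q g \<and> verts g = S - W}"
proof -
  have gr: "is_graph g" if "g \<in> \<G>" for g using that G by (simp add: closed_class_def)
  let ?A = "{g \<in> \<G>. verts g = S \<and> union_of_components g W \<and> Q (induced g (S - W))}"
  let ?B = "{g \<in> \<G>. verts g = W}" and ?D = "{g \<in> \<G>. Q g \<and> verts g = S - W}"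
  let ?j = "\<lambda>(h, k). (verts h \<union> verts k, edges h \<union> edges k) :: graph"
  have "bij_betw (\<lambda>g. (induced g W, induced g (S - W))) ?A (?B \<times> ?D)"
  proof (rule bij_betw_byWitness[where f' = ?j])
    show "\<forall>a\<in>?A. ?j (induced a W, induced a (S - W)) = a"
    proof
      fix a assume a: "a \<in> ?A"
      obtain V E where VE: "a = (V, E)" by (cases a)
      have E: "e \<subseteq> V" if "e \<in> E" for e using gr[of a] a VE that by (auto simp: is_graph_def)
      have W: "e \<subseteq> W \<or> e \<subseteq> V - W" if "e \<in> E" for e
        using a VE E[OF that] that by (auto simp: union_of_components_def)
      have "{e \<in> E. e \<subseteq> W} \<union> {e \<in> E. e \<subseteq> V - W} = E" using W by blast
      moreover have "V \<inter> W \<union> V \<inter> (V - W) = V" by blast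
      ultimately show "?j (induced a W, induced a (S - W)) = a"
        using a VE by (simp add: induced_def)
    qed
    have ind: "induced (?j (h, k)) W = h \<and> induced (?j (h, k)) (S - W) = k \<and>
        is_graph (?j (h, k)) \<and> union_of_components (?j (h, k)) W \<and> verts (?j (h, k)) = S"
      if "h \<in> ?B" "k \<in> ?D" for h k
    proof -
      obtain E E' where hk: "h = (W, E)" "k = (S - W, E')"
        using \<open>h \<in> ?B\<close> \<open>k \<in> ?D\<close> by (cases h; cases k) auto
      have E: "e \<subseteq> W \<and> card e = 2" if "e \<in> E" for e
        using gr[of h] \<open>h \<in> ?B\<close> that hk by (auto simp: is_graph_def)
      have E': "e \<subseteq> S - W \<and> card e = 2" if "e \<in> E'" for e
        using gr[of k] \<open>k \<in> ?D\<close> that hk by (auto simp: is_graph_def)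
      \<comment> \<open>An edge is nonempty, so it cannot lie in both \<open>W\<close> and
        \<open>S - W\<close>; restricting the disjoint union to one side therefore returns exactly
        the edges of that side.\<close>
      have ne: "e \<noteq> {}" if "card e = 2" for e :: "nat set" using that by auto
      have 1: "\<not> e \<subseteq> W" if "e \<in> E'" for e using E'[OF that] ne[of e] by auto
      have 2: "\<not> e \<subseteq> S - W" if "e \<in> E" for e using E[OF that] ne[of e] by auto
      show ?thesis
        unfolding hk induced_def is_graph_def union_of_components_def
        using S finite_subset[OF S(2,1)] E E' 1 2 by (auto dest: E E')
    qed
    show "\<forall>p\<in>?B \<times> ?D. (\<lambda>g. (induced g W, induced g (S - W))) (?j p) = p"
    proof
      fix p assume "p \<in> ?B \<times> ?D"
      then obtain h k where p: "p = (h, k)" "h \<in> ?B" "k \<in> ?D" by blast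
      then show "(\<lambda>g. (induced g W, induced g (S - W))) (?j p) = p"
        using ind[OF p(2,3)] unfolding p(1) by metis
    qed
    show "(\<lambda>g. (induced g W, induced g (S - W))) ` ?A \<subseteq> ?B \<times> ?D"
    proof
      fix p assume "p \<in> (\<lambda>g. (induced g W, induced g (S - W))) ` ?A"
      then obtain g where g: "p = (induced g W, induced g (S - W))" "g \<in> \<G>" "verts g = S"
        "union_of_components g W" "Q (induced g (S - W))" by blast
      then have "induced g W \<in> \<G> \<and> induced g (S - W) \<in> \<G>"
        using closed_class_split[OF G gr[OF g(2)] g(4)] by simp
      then show "p \<in> ?B \<times> ?D"
        using g S verts_induced[of W g] verts_induced[of "S - W" g] by auto
    qed
    show "?j ` (?B \<times> ?D) \<subseteq> ?A"
    proof
      fix p assume "p \<in> ?j ` (?B \<times> ?D)"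
      then obtain h k where p: "p = ?j (h, k)" and *: "h \<in> ?B" "k \<in> ?D" by blast
      note i = ind[OF *]
      have "?j (h, k) \<in> \<G>"
        using closed_class_split[OF G, of "?j (h, k)" W] i * Un_absorb1[OF S(2)] by simp
      then show "p \<in> ?A"
        unfolding p using i * Un_absorb1[OF S(2)] by simp
    qed
  qed
  then show ?thesis
    by (simp add: bij_betw_same_card card_cartesian_product)
qed

section \<open>The number of vertices outside the largest component\<close>

lemma largest_component_props:
  assumes "is_graph g" "verts g \<noteq> {}"
  obtains v where "v \<in> verts g" "largest_component g = card (component g v)"
    and "\<And>u. u \<in> verts g \<Longrightarrow> card (component g u) \<le> largest_component g"
proof -
  have fin: "finite (verts g)" using assms by (simp add: is_graph_def)
  have "verts (induced g (component g v)) = component g v" if "v \<in> verts g" for v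
    using union_of_components_component[OF assms(1) that]
    by (simp add: union_of_components_def verts_induced)
  then have eq: "(\<lambda>h. card (verts h)) ` components_of g = (\<lambda>v. card (component g v)) ` verts g"
    by (simp add: components_of_eq image_image)
  have "largest_component g \<in> (\<lambda>v. card (component g v)) ` verts g"
    unfolding largest_component_def eq by (rule Max_in) (use fin assms in auto)
  moreover have "card (component g u) \<le> largest_component g" if "u \<in> verts g" for u
    unfolding largest_component_def eq by (rule Max_ge) (use fin that in auto)
  ultimately show thesis using that by blast
qed

lemma card_component_le:
  assumes "is_graph g" "v \<in> verts g"
  shows "component g v \<subseteq> verts g" "card (component g v) \<le> card (verts g)"
    "finite (component g v)"
proof -
  show *: "component g v \<subseteq> verts g"
    using union_of_components_component[OF assms] by (simp add: union_of_components_def)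
  have "finite (verts g)" using assms by (simp add: is_graph_def)
  with * show "card (component g v) \<le> card (verts g)" "finite (component g v)"
    by (auto intro: card_mono finite_subset)
qed

lemma component_eq_or_disjoint:
  "component g u = component g v \<or> component g u \<inter> component g v = {}"
  unfolding component_def using reach_trans reach_sym by blast

text \<open>As k < n/2, a component on n - k vertices beats all others, which must fit into the k
  remaining vertices. No tie for the largest component can occur in this range.\<close>

lemma missed_eq_iff:
  assumes g: "is_graph g" and n: "card (verts g) = n" "2 * k < n"
  shows "missed g = k \<longleftrightarrow>
    (\<exists>W\<subseteq>verts g. card W = k \<and> union_of_components g W \<and> connected_graph (induced g (verts g - W)))"
proof -
  have fin: "finite (verts g)" using g by (simp add: is_graph_def)
  have ne: "verts g \<noteq> {}" using n by auto
  obtain v where v: "v \<in> verts g" "largest_component g = card (component g v)"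
    and mx: "\<And>u. u \<in> verts g \<Longrightarrow> card (component g u) \<le> largest_component g"
    using largest_component_props[OF g ne] by metis
  note cv = card_component_le[OF g v(1)]
  show ?thesis
  proof
    assume "missed g = k"
    then have "card (verts g - component g v) = k"
      using v cv fin by (simp add: missed_def card_Diff_subset)
    moreover have "verts g - (verts g - component g v) = component g v"
      using cv by auto
    ultimately show "\<exists>W\<subseteq>verts g. card W = k \<and> union_of_components g W
        \<and> connected_graph (induced g (verts g - W))"
      using union_of_components_Diff[OF g union_of_components_component[OF g v(1)]]
        connected_component[OF g v(1)]
      by (intro exI[of _ "verts g - component g v"]) auto
  next
    assume "\<exists>W\<subseteq>verts g. card W = k \<and> union_of_components g W
        \<and> connected_graph (induced g (verts g - W))"
    then obtain W where W: "W \<subseteq> verts g" "card W = k" "union_of_components g W"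
      "connected_graph (induced g (verts g - W))" by blast
    have cW: "card (verts g - W) = n - k"
      using W fin n by (simp add: card_Diff_subset finite_subset)
    then have "verts g - W \<noteq> {}" using n by (metis card.empty diff_is_0_eq leD le_add2 mult_2 le_trans)
    then obtain w where w: "w \<in> verts g - W" by blast
    have eq: "verts g - W = component g w"
      by (rule connected_union_is_component[OF union_of_components_Diff[OF g W(3)] W(4) w])
    have "n - k \<le> largest_component g" using mx[of w] w cW eq by auto
    moreover have "largest_component g \<le> n - k"
    proof (cases "component g v = component g w")
      case True
      then show ?thesis using v cW eq by simp
    next
      case False
      then have "component g v \<subseteq> W"
        using component_eq_or_disjoint[of g v w] cv eq by blast
      then have "card (component g v) \<le> k"
        using W fin by (metis card_mono finite_subset)
      then show ?thesis using v n by simp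
    qed
    ultimately show "missed g = k" using n by (simp add: missed_def)
  qed
qed

lemma card_missed:
  assumes G: "closed_class \<G>" and k: "2 * k < n"
  shows "card {g \<in> graphs_on \<G> n. missed g = k}
    = (n choose k) * num_graphs \<G> k * num_connected \<G> (n - k)"
proof -
  have gr: "is_graph g" if "g \<in> \<G>" for g using that G by (simp add: closed_class_def)
  let ?P = "{W. W \<subseteq> {1..n} \<and> card W = k}"
  define A where "A W = {g \<in> \<G>. verts g = {1..n} \<and> union_of_components g W \<and>
      connected_graph (induced g ({1..n} - W))}" for W
  have fA: "finite (A W)" for W
    by (rule finite_subset[OF _ finite_graphs_on[OF G, of n]]) (auto simp: A_def graphs_on_def)
  have "g \<in> {g \<in> graphs_on \<G> n. missed g = k} \<longleftrightarrow> g \<in> (\<Union>W\<in>?P. A W)" for g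
  proof (cases "g \<in> \<G> \<and> verts g = {1..n}")
    case True
    then show ?thesis
      using missed_eq_iff[OF gr _ k, of g] by (simp add: graphs_on_def A_def)
  next
    case False
    then show ?thesis by (auto simp: graphs_on_def A_def)
  qed
  then have "{g \<in> graphs_on \<G> n. missed g = k} = (\<Union>W\<in>?P. A W)" by blast
  moreover have "card (\<Union>W\<in>?P. A W) = (\<Sum>W\<in>?P. card (A W))"
  proof (rule card_UN_disjoint)
    show "finite ?P" by simp
    show "\<forall>W\<in>?P. finite (A W)" using fA by simp
    have "W = W'" if W: "W \<in> ?P" "W' \<in> ?P" and g: "g \<in> A W" "g \<in> A W'" for W W' g
    proof -
      have G': "is_graph g" using g gr by (simp add: A_def)
      have fin: "finite W" "finite W'" using W by (auto intro: finite_subset)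
      \<comment> \<open>Two sets of size k < n/2 cannot cover all vertices. A vertex outside both
        has one component, and this is the complement of each; so a graph determines its set
        \<open>W\<close>, and the count is a disjoint sum.\<close>
      have "card (W \<union> W') \<le> 2 * k" using W card_Un_le[of W W'] by simp
      then have "\<not> {1..n} \<subseteq> W \<union> W'"
        using k card_mono[of "W \<union> W'" "{1..n}"] fin by auto
      then obtain w where w: "w \<in> {1..n} - W" "w \<in> {1..n} - W'" by blast
      have "{1..n} - W = component g w"
        using connected_union_is_component[of g "{1..n} - W" w] w g
          union_of_components_Diff[OF G', of W] by (simp add: A_def)
      moreover have "{1..n} - W' = component g w"
        using connected_union_is_component[of g "{1..n} - W'" w] w g
          union_of_components_Diff[OF G', of W'] by (simp add: A_def)
      ultimately show ?thesis using W by blast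
    qed
    then show "\<forall>W\<in>?P. \<forall>W'\<in>?P. W \<noteq> W' \<longrightarrow> A W \<inter> A W' = {}" by blast
  qed
  moreover have "card (A W) = num_graphs \<G> k * num_connected \<G> (n - k)" if "W \<in> ?P" for W
  proof -
    have W: "W \<subseteq> {1..n}" "card W = k" using that by auto
    then have "finite W" by (auto intro: finite_subset)
    then show ?thesis
      using card_graphs_split[OF G _ W(1), of connected_graph] W
        card_graphs_with_verts[OF G, of W] card_graphs_with_verts[OF G, of "{1..n} - W"]
      by (simp add: A_def card_Diff_subset)
  qed
  ultimately show ?thesis by (simp add: n_subsets)
qed

text \<open>A smallest union \<open>W\<close> of components with at least n/3 vertices works. Taking
  a component \<open>K\<close> away leaves fewer than n/3 vertices, and \<open>K\<close> itself has
  fewer than n/3 unless it is all of \<open>W\<close>, whence \<open>W\<close> has fewer than 2n/3.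
  If \<open>K\<close> is all of \<open>W\<close>, the assumption on \<open>missed\<close> bounds it
  by n/2.\<close>

lemma balanced_union_exists:
  assumes g: "is_graph g" and n: "card (verts g) = n" "0 < n" "n \<le> 2 * missed g"
  shows "\<exists>W. union_of_components g W \<and> n \<le> 3 * card W \<and> 3 * card W \<le> 2 * n"
proof -
  have fin: "finite (verts g)" using g by (simp add: is_graph_def)
  have "union_of_components g (verts g) \<and> n \<le> 3 * card (verts g)"
    using n g by (auto simp: union_of_components_def is_graph_def)
  then obtain W where W: "union_of_components g W" "n \<le> 3 * card W"
    and min: "\<And>W'. card W' < card W \<Longrightarrow> union_of_components g W' \<Longrightarrow> \<not> n \<le> 3 * card W'"
    using exists_least_iff[of "\<lambda>m. \<exists>W. card W = m \<and> union_of_components g W \<and> n \<le> 3 * card W"]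
    by metis
  have Wv: "W \<subseteq> verts g" "finite W"
    using W fin by (auto simp: union_of_components_def intro: finite_subset)
  have "W \<noteq> {}" using W n by auto
  then obtain w where w: "w \<in> W" by blast
  with Wv have wv: "w \<in> verts g" by auto
  define K where "K = component g w"
  note ck = card_component_le[OF g wv, folded K_def]
  have KW: "K \<subseteq> W" using component_induced(2)[OF W(1) w] by (simp add: K_def)
  have uK: "union_of_components g K"
    using union_of_components_component[OF g wv] by (simp add: K_def)
  have "K \<noteq> {}" using component_self[of w g] by (auto simp: K_def)
  then have cK: "0 < card K" using ck by (simp add: card_gt_0_iff)
  have "card K \<le> largest_component g"
    using largest_component_props[OF g] wv unfolding K_def by blast
  then have K2: "2 * card K \<le> n" using n by (simp add: missed_def)
  show ?thesis
  proof (cases "K = W")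
    case True
    then show ?thesis using W K2 by auto
  next
    case False
    then have "card K < card W" using KW Wv by (simp add: psubset_card_mono psubset_eq)
    moreover have "card (W - K) = card W - card K"
      using KW ck by (simp add: card_Diff_subset)
    ultimately have "\<not> n \<le> 3 * card K" "\<not> n \<le> 3 * (card W - card K)"
      using min[of K] min[of "W - K"] uK union_of_components_Diff2[OF W(1) uK] cK by auto
    then show ?thesis using W by (intro exI[of _ W]) linarith
  qed
qed

text \<open>A union bound over the balanced sets \<open>W\<close>; graphs with several such sets are
  counted repeatedly, which is harmless here.\<close>

lemma card_missed_large:
  assumes G: "closed_class \<G>" and n: "0 < n"
  shows "card {g \<in> graphs_on \<G> n. n \<le> 2 * missed g}
    \<le> (\<Sum>m | n \<le> 3 * m \<and> 3 * m \<le> 2 * n. (n choose m) * num_graphs \<G> m * num_graphs \<G> (n - m))"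
proof -
  have gr: "is_graph g" if "g \<in> \<G>" for g using that G by (simp add: closed_class_def)
  let ?M = "{m. n \<le> 3 * m \<and> 3 * m \<le> 2 * n}"
  let ?P = "\<lambda>m. {W. W \<subseteq> {1..n} \<and> card W = m}"
  have finM: "finite ?M" by (rule finite_subset[of _ "{..n}"]) auto
  define A where "A W = {g \<in> \<G>. verts g = {1..n} \<and> union_of_components g W}" for W
  have cA: "card (A W) = num_graphs \<G> m * num_graphs \<G> (n - m)" if "W \<in> ?P m" for W m
  proof -
    have W: "W \<subseteq> {1..n}" "card W = m" using that by auto
    then have "finite W" by (auto intro: finite_subset)
    then show ?thesis
      using card_graphs_split[OF G _ W(1), of "\<lambda>_. True"] W
        card_graphs_with_verts[OF G, of W] card_graphs_with_verts[OF G, of "{1..n} - W"]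
      by (simp add: A_def card_Diff_subset)
  qed
  have fA: "finite (A W)" for W
    by (rule finite_subset[OF _ finite_graphs_on[OF G, of n]]) (auto simp: A_def graphs_on_def)
  have "{g \<in> graphs_on \<G> n. n \<le> 2 * missed g} \<subseteq> (\<Union>m\<in>?M. \<Union>W\<in>?P m. A W)"
  proof
    fix g assume "g \<in> {g \<in> graphs_on \<G> n. n \<le> 2 * missed g}"
    then have g: "g \<in> \<G>" "verts g = {1..n}" "n \<le> 2 * missed g" by (auto simp: graphs_on_def)
    obtain W where "union_of_components g W" "n \<le> 3 * card W" "3 * card W \<le> 2 * n"
      using balanced_union_exists[OF gr[OF g(1)] _ n g(3)] g(2) by auto
    then show "g \<in> (\<Union>m\<in>?M. \<Union>W\<in>?P m. A W)"
      using g by (auto simp: A_def union_of_components_def)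
  qed
  then have "card {g \<in> graphs_on \<G> n. n \<le> 2 * missed g} \<le> card (\<Union>m\<in>?M. \<Union>W\<in>?P m. A W)"
    by (rule card_mono[rotated]) (use finM fA in auto)
  also have "\<dots> \<le> (\<Sum>m\<in>?M. card (\<Union>W\<in>?P m. A W))"
    by (rule card_UN_le[OF finM])
  also have "\<dots> \<le> (\<Sum>m\<in>?M. \<Sum>W\<in>?P m. card (A W))"
    by (intro sum_mono card_UN_le) auto
  also have "\<dots> = (\<Sum>m\<in>?M. (n choose m) * num_graphs \<G> m * num_graphs \<G> (n - m))"
  proof (rule sum.cong)
    fix m assume "m \<in> ?M"
    have "(\<Sum>W\<in>?P m. card (A W)) = (\<Sum>W\<in>?P m. num_graphs \<G> m * num_graphs \<G> (n - m))"
      by (rule sum.cong) (use cA in auto)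
    then show "(\<Sum>W\<in>?P m. card (A W)) = (n choose m) * num_graphs \<G> m * num_graphs \<G> (n - m)"
      by (simp add: n_subsets)
  qed simp
  finally show ?thesis .
qed

section \<open>The single edge\<close>

lemma split_part_card:
  assumes "split_part g h" "finite (verts g)"
  shows "card (verts h) < card (verts g) \<and> finite (verts h)"
proof -
  have "\<exists>A B. A \<union> B = verts g \<and> B - A \<noteq> {} \<and> verts h = A"
    using assms(1) unfolding split_part_def by fastforce
  then obtain A B where "A \<union> B = verts g" "B - A \<noteq> {}" "verts h = A" by blast
  then have "verts h \<subset> verts g" by auto
  then show ?thesis using assms(2) by (auto intro: psubset_card_mono finite_subset)
qed

lemma split_parts_card:
  assumes "split_part\<^sup>*\<^sup>* g h" "finite (verts g)"
  shows "card (verts h) \<le> card (verts g) \<and> finite (verts h)"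
  using assms(1)
proof (induction rule: rtranclp_induct)
  case (step y z)
  then show ?case using split_part_card[of y z] by auto
qed (use assms in auto)

lemma two_connected_edge:
  assumes "u \<noteq> v"
  shows "two_connected ({u, v}, {{u, v}})"
proof -
  let ?g = "({u, v}, {{u, v}}) :: graph"
  have gr: "is_graph ?g" using assms by (simp add: is_graph_def)
  have single: "connected_graph (induced ?g {w})" if "w \<in> {u, v}" for w
    using that assms
    by (auto simp: connected_graph_def reach_refl is_graph_induced[OF gr]) (auto simp: induced_def reach_refl)
  have "(u, v) \<in> reach ?g" by (rule reach_edge) simp
  then have whole: "connected_graph ?g"
    using gr by (auto simp: connected_graph_def reach_refl intro: reach_sym)
  have "connected_graph (induced ?g (verts ?g - S))" if S: "S \<subseteq> verts ?g" "card S < 2" for S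
  proof -
    have "finite S" using S(1) by (auto intro: finite_subset)
    with S(2) have "S = {} \<or> (\<exists>w. S = {w})"
      by (metis One_nat_def card_0_eq card_1_singletonE less_2_cases)
    with S(1) consider "verts ?g - S = verts ?g" | w where "w \<in> {u, v}" "verts ?g - S = {w}"
      using assms by fastforce
    then show ?thesis
    proof cases
      case 1
      then show ?thesis using whole induced_verts[OF gr] by simp
    next
      case 2
      then show ?thesis using single by simp
    qed
  qed
  then show ?thesis
    using gr assms by (auto simp: two_connected_def)
qed

lemma closed_class_three_components:
  assumes "closed_class \<G>" "is_graph g"
  shows "g \<in> \<G> \<longleftrightarrow> three_components_of g \<subseteq> \<G>"
  using assms unfolding closed_class_def by metis

text \<open>A single edge has no 3-connected component, hence it belongs to every closed class.  This makes the
  coefficient of \<open>x\<close> in \<open>B'\<close> positive, so that \<open>Re B'\<close> has on a circle a unique maximum.\<close>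

lemma num_two_connected_2_pos:
  assumes G: "closed_class \<G>"
  shows "0 < num_two_connected \<G> 2"
proof -
  let ?g = "({1, 2}, {{1, 2}}) :: graph"
  have gr: "is_graph ?g" by (simp add: is_graph_def)
  \<comment> \<open>Splitting never enlarges the vertex set, so no part reaches the four vertices
    that 3-connectedness requires.\<close>
  have "card (verts h) \<le> 2" if "b \<in> blocks_of ?g" "split_part\<^sup>*\<^sup>* b h" for b h
  proof -
    have b: "verts b \<subseteq> {1, 2}" using that(1) by (auto simp: blocks_of_def subgraph_of_def)
    then have "card (verts b) \<le> 2" using card_mono[of "{1, 2::nat}" "verts b"] by simp
    then show ?thesis
      using split_parts_card[OF that(2)] b by (meson finite.intros finite_subset order_trans)
  qed
  then have "three_components_of ?g = {}"
    by (force simp: three_components_of_def three_connected_def)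
  then have "three_components_of ?g \<subseteq> \<G>" by simp
  then have "?g \<in> \<G>" using closed_class_three_components[OF G gr] by blast
  moreover have "{1..2} = {1, 2::nat}" by auto
  ultimately have "?g \<in> {g \<in> graphs_on \<G> 2. two_connected g}"
    using two_connected_edge[of 1 2] by (simp add: graphs_on_def)
  moreover have "finite {g \<in> graphs_on \<G> 2. two_connected g}"
    using finite_graphs_on[OF G, of 2] by simp
  ultimately show ?thesis
    unfolding num_two_connected_def by (metis card_gt_0_iff empty_iff)
qed

section \<open>Exponentials of power series with polynomially decaying coefficients\<close>

lemma summable_weight:
  assumes "\<alpha> > 1"
  shows "summable (\<lambda>n. (real n + 1) powr (-\<alpha>))"
proof -
  have "summable (\<lambda>n. real n powr (-\<alpha>))"
    using assms by (simp add: summable_real_powr_iff)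
  then have "summable (\<lambda>n. real (Suc n) powr (-\<alpha>))"
    by (subst summable_Suc_iff)
  then show ?thesis by (simp add: add.commute)
qed

text \<open>One of k and n - k is at least n/2, where the weight is at most 2^\<alpha> times the
  weight at n; the other factor is summable. This is where \<alpha> > 1 enters.\<close>

lemma conv_weight_le:
  assumes "\<alpha> > 1"
  obtains M where "M \<ge> 0"
    "\<And>n. (\<Sum>k\<le>n. (real k + 1) powr (-\<alpha>) * (real (n - k) + 1) powr (-\<alpha>)) \<le> M * (real n + 1) powr (-\<alpha>)"
proof
  define w where "w n = (real n + 1) powr (-\<alpha>)" for n
  have w0: "w n \<ge> 0" for n by (simp add: w_def)
  have sm: "summable w" unfolding w_def by (rule summable_weight[OF assms])
  have W: "sum w A \<le> suminf w" if "finite A" for A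
    by (rule sum_le_suminf[OF sm that]) (use w0 in auto)
  show "2 powr \<alpha> * (2 * suminf w) \<ge> 0" using w0 by (simp add: suminf_nonneg[OF sm])
  fix n
  have big: "w k \<le> 2 powr \<alpha> * w n" if "n \<le> 2 * k" for k
  proof -
    have "w k \<le> ((real n + 1) / 2) powr (-\<alpha>)"
      unfolding w_def by (rule powr_mono2') (use that assms in auto)
    also have "\<dots> = 2 powr \<alpha> * w n"
      by (simp add: w_def powr_divide powr_minus field_simps)
    finally show ?thesis .
  qed
  have "w k * w (n - k) \<le> 2 powr \<alpha> * w n * (w k + w (n - k))" if "k \<le> n" for k
  proof (cases "n \<le> 2 * k")
    case True
    have "w k * w (n - k) \<le> 2 powr \<alpha> * w n * w (n - k)"
      by (rule mult_right_mono[OF big[OF True] w0])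
    also have "\<dots> \<le> 2 powr \<alpha> * w n * (w k + w (n - k))"
      by (rule mult_left_mono) (use w0 in auto)
    finally show ?thesis .
  next
    case False
    have "w k * w (n - k) \<le> w k * (2 powr \<alpha> * w n)"
      by (rule mult_left_mono[OF big w0]) (use False in auto)
    also have "\<dots> = 2 powr \<alpha> * w n * w k" by simp
    also have "\<dots> \<le> 2 powr \<alpha> * w n * (w k + w (n - k))"
      by (rule mult_left_mono) (use w0 in auto)
    finally show ?thesis .
  qed
  then have "(\<Sum>k\<le>n. w k * w (n - k)) \<le> (\<Sum>k\<le>n. 2 powr \<alpha> * w n * (w k + w (n - k)))"
    by (intro sum_mono) auto
  also have "\<dots> = 2 powr \<alpha> * w n * ((\<Sum>k\<le>n. w k) + (\<Sum>k\<le>n. w (n - k)))"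
    by (simp only: sum_distrib_left[symmetric] sum.distrib)
  also have "(\<Sum>k\<le>n. w (n - k)) = (\<Sum>k\<le>n. w k)"
    by (rule sum.reindex_bij_witness[where i = "\<lambda>k. n - k" and j = "\<lambda>k. n - k"]) auto
  also have "2 powr \<alpha> * w n * ((\<Sum>k\<le>n. w k) + (\<Sum>k\<le>n. w k)) \<le> 2 powr \<alpha> * w n * (2 * suminf w)"
    by (intro mult_left_mono) (use W[of "{..n}"] w0 in auto)
  finally show "(\<Sum>k\<le>n. (real k + 1) powr (-\<alpha>) * (real (n - k) + 1) powr (-\<alpha>))
      \<le> 2 powr \<alpha> * (2 * suminf w) * (real n + 1) powr (-\<alpha>)"
    by (simp add: w_def mult_ac)
qed

text \<open>Each further factor \<open>A\<close> costs a constant D M, so the coefficients of A^i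
  are at most (D M)^i w n, and dividing by i! and summing gives the exponential. The condition on
  \<open>w 0\<close> covers the power A^0 = 1.\<close>

lemma fps_exp_compose_nth_le:
  fixes A :: "real fps"
  assumes A0: "\<And>n. 0 \<le> fps_nth A n" and Aw: "\<And>n. fps_nth A n \<le> D * w n"
    and w: "\<And>n. 0 \<le> w n" "1 \<le> w 0" "\<And>n. (\<Sum>k\<le>n. w k * w (n - k)) \<le> M * w n"
    and M: "0 \<le> M" "0 \<le> D"
  shows "fps_nth (fps_exp 1 oo A) n \<le> exp (D * M) * w n"
proof -
  have pow: "0 \<le> fps_nth (A ^ i) n \<and> fps_nth (A ^ i) n \<le> (D * M) ^ i * w n" for i n
  proof (induction i arbitrary: n)
    case 0
    then show ?case using w by auto
  next
    case (Suc i)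
    have "fps_nth (A ^ Suc i) n = (\<Sum>k\<le>n. fps_nth A k * fps_nth (A ^ i) (n - k))"
      by (simp add: fps_mult_nth atMost_atLeast0)
    moreover have "(\<Sum>k\<le>n. fps_nth A k * fps_nth (A ^ i) (n - k)) \<le> (\<Sum>k\<le>n. (D * w k) * ((D * M) ^ i * w (n - k)))"
      by (intro sum_mono mult_mono) (use Suc A0 Aw w M in auto)
    moreover have "\<dots> = D * (D * M) ^ i * (\<Sum>k\<le>n. w k * w (n - k))"
      by (simp add: sum_distrib_left mult_ac)
    moreover have "\<dots> \<le> D * (D * M) ^ i * (M * w n)"
      by (intro mult_left_mono) (use w M in auto)
    moreover have "0 \<le> (\<Sum>k\<le>n. fps_nth A k * fps_nth (A ^ i) (n - k))"
      using Suc A0 by (intro sum_nonneg) auto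
    ultimately show ?case by (simp add: mult_ac)
  qed
  have "fps_nth (fps_exp 1 oo A) n = (\<Sum>i=0..n. fps_nth (A ^ i) n / fact i)"
    by (simp add: fps_compose_nth)
  also have "\<dots> \<le> (\<Sum>i=0..n. (D * M) ^ i * w n / fact i)"
    by (intro sum_mono divide_right_mono) (use pow in auto)
  also have "\<dots> = (\<Sum>i=0..n. (D * M) ^ i /\<^sub>R fact i) * w n"
    unfolding sum_distrib_right by (intro sum.cong) (auto simp: divide_inverse)
  also have "\<dots> \<le> exp (D * M) * w n"
  proof (rule mult_right_mono)
    show "(\<Sum>i=0..n. (D * M) ^ i /\<^sub>R fact i) \<le> exp (D * M)"
      unfolding exp_def by (rule sum_le_suminf[OF summable_exp_generic]) (use M in auto)
  qed (rule w)
  finally show ?thesis .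
qed

text \<open>Tannery's theorem: the k-th term tends to b \<open>y k\<close>. The restriction 2k < n
  keeps n - k above n/2, so that replacing (n - k)^\<beta> by n^\<beta> costs at most 2^\<beta> and
  the terms are dominated by a multiple of \<open>y k\<close>.\<close>

lemma convolution_head_limit:
  fixes y h :: "nat \<Rightarrow> real"
  assumes y: "summable y" "\<And>k. 0 \<le> y k"
    and h: "(\<lambda>n. h n * real n powr \<beta>) \<longlonglongrightarrow> b" and \<beta>: "0 < \<beta>"
  shows "(\<lambda>n. \<Sum>k | 2 * k < n. y k * h (n - k) * real n powr \<beta>) \<longlonglongrightarrow> b * suminf y"
proof -
  obtain B where B: "\<And>n. norm (h n * real n powr \<beta>) \<le> B" "B > 0"
    using convergent_imp_Bseq[of "\<lambda>n. h n * real n powr \<beta>"] h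
    by (auto simp: convergent_def Bseq_def)
  define f where "f k n = (if 2 * k < n then y k * h (n - k) * real n powr \<beta> else 0)" for k n
  have "(\<lambda>n. f k n) \<longlonglongrightarrow> b * y k" for k
  proof -
    have ev: "eventually (\<lambda>n. 2 * k < n) at_top" by (rule eventually_gt_at_top)
    have "(\<lambda>n. h (n - k) * real (n - k) powr \<beta>) \<longlonglongrightarrow> b"
      using h by (rule filterlim_compose) (rule filterlim_minus_const_nat_at_top)
    moreover have "(\<lambda>n. (real n / (real n - real k)) powr \<beta>) \<longlonglongrightarrow> 1"
      by real_asymp
    ultimately have "(\<lambda>n. y k * ((h (n - k) * real (n - k) powr \<beta>) * (real n / (real n - real k)) powr \<beta>))
        \<longlonglongrightarrow> y k * (b * 1)"
      by (intro tendsto_intros)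
    moreover have "eventually (\<lambda>n. y k * ((h (n - k) * real (n - k) powr \<beta>) * (real n / (real n - real k)) powr \<beta>)
        = f k n) at_top"
      using ev by eventually_elim (simp add: f_def of_nat_diff powr_divide)
    ultimately show ?thesis by (simp add: Lim_transform_eventually mult.commute)
  qed
  moreover have "eventually (\<lambda>(k, n). norm (f k n) \<le> y k * (2 powr \<beta> * B)) (at_top \<times>\<^sub>F sequentially)"
  proof (rule always_eventually, clarify)
    fix k n
    show "norm (f k n) \<le> y k * (2 powr \<beta> * B)"
    proof (cases "2 * k < n")
      case True
      then have "real n powr \<beta> \<le> (2 * real (n - k)) powr \<beta>"
        using \<beta> by (intro powr_mono2) auto
      then have "\<bar>h (n - k)\<bar> * real n powr \<beta> \<le> \<bar>h (n - k)\<bar> * (2 powr \<beta> * real (n - k) powr \<beta>)"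
        by (intro mult_left_mono) (auto simp: powr_mult)
      also have "\<dots> = 2 powr \<beta> * norm (h (n - k) * real (n - k) powr \<beta>)"
        by (simp add: abs_mult)
      also have "\<dots> \<le> 2 powr \<beta> * B" using B by (intro mult_left_mono) auto
      finally have "y k * (\<bar>h (n - k)\<bar> * real n powr \<beta>) \<le> y k * (2 powr \<beta> * B)"
        by (rule mult_left_mono) (rule y)
      then show ?thesis using True y by (simp add: f_def abs_mult mult_ac)
    next
      case False
      then show ?thesis using y B by (simp add: f_def)
    qed
  qed
  moreover have "summable (\<lambda>k. y k * (2 powr \<beta> * B))" using y by (intro summable_mult2)
  ultimately have "(\<lambda>n. suminf (\<lambda>k. f k n)) \<longlonglongrightarrow> (\<Sum>k. b * y k)"
    using tannerys_theorem[of f "\<lambda>k. b * y k" sequentially "\<lambda>k. y k * (2 powr \<beta> * B)"] by simp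
  moreover have "suminf (\<lambda>k. f k n) = (\<Sum>k | 2 * k < n. y k * h (n - k) * real n powr \<beta>)" for n
  proof -
    have fin: "finite {k. 2 * k < n}" by (rule finite_subset[of _ "{..n}"]) auto
    have "suminf (\<lambda>k. f k n) = (\<Sum>k | 2 * k < n. f k n)"
      by (rule suminf_finite[OF fin]) (simp add: f_def)
    then show ?thesis by (simp add: f_def)
  qed
  ultimately show ?thesis using suminf_mult[OF y(1), of b] by simp
qed

section \<open>Asymptotics and moments of the exponential of a sequence\<close>

text \<open>The coefficients of C(\<rho>x) and of G(\<rho>x) = exp(C(\<rho>x)), seen as plain
  sequences: \<open>rec\<close> is x G' = x C' G, and \<open>gam_le\<close> is an a priori bound of
  the order that \<open>gam_limit\<close> then sharpens to an asymptotic equality.\<close>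

locale exp_sequence =
  fixes a gam :: "nat \<Rightarrow> real" and \<alpha> b :: real
  assumes a_nonneg: "\<And>n. 0 \<le> a n" and gam_nonneg: "\<And>n. 0 \<le> gam n" and gam_0: "gam 0 = 1"
    and rec: "\<And>n. real n * gam n = (\<Sum>k\<le>n. real k * a k * gam (n - k))"
    and gam_le: "\<exists>K. \<forall>n. gam n \<le> K * (real n + 1) powr (-\<alpha>)"
    and a_lim: "(\<lambda>n. a n * real n powr \<alpha>) \<longlonglongrightarrow> b"
    and b_pos: "0 < b" and \<alpha>_gt: "2 < \<alpha>"
begin

lemma gam_bound:
  obtains K where "0 < K" "\<And>n. gam n \<le> K * (real n + 1) powr (-\<alpha>)"
    "\<And>n. 0 < n \<Longrightarrow> gam n \<le> K * real n powr (-\<alpha>)"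
proof -
  obtain K where K: "\<And>n. gam n \<le> K * (real n + 1) powr (-\<alpha>)" using gam_le by blast
  from K[of 0] gam_0 have "0 < K" by simp
  moreover have "gam n \<le> K * real n powr (-\<alpha>)" if "0 < n" for n
  proof -
    have "(real n + 1) powr (-\<alpha>) \<le> real n powr (-\<alpha>)"
      using that \<alpha>_gt by (intro powr_mono2') auto
    then show ?thesis using K[of n] \<open>0 < K\<close> by (smt (verit) mult_left_mono)
  qed
  ultimately show thesis using K that by blast
qed

lemma summable_of_bound:
  fixes x :: "nat \<Rightarrow> real"
  assumes "\<And>n. 0 \<le> x n" "\<And>n. 0 < n \<Longrightarrow> x n \<le> K * real n powr (-\<alpha>)" "real j + 1 < \<alpha>"
  shows "summable (\<lambda>n. real n ^ j * x n)"
proof (rule summable_comparison_test)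
  show "\<exists>N. \<forall>n\<ge>N. norm (real n ^ j * x n) \<le> K * real n powr (real j - \<alpha>)"
  proof (intro exI[of _ 1] allI impI)
    fix n :: nat assume n: "1 \<le> n"
    have "real n ^ j * x n \<le> real n ^ j * (K * real n powr (-\<alpha>))"
      by (rule mult_left_mono) (use assms n in auto)
    also have "\<dots> = K * real n powr (real j - \<alpha>)"
      using n by (simp add: powr_diff powr_realpow powr_minus divide_inverse)
    finally show "norm (real n ^ j * x n) \<le> K * real n powr (real j - \<alpha>)"
      using assms n by simp
  qed
  show "summable (\<lambda>n. K * real n powr (real j - \<alpha>))"
    using assms(3) by (intro summable_mult) (simp add: summable_real_powr_iff)
qed

lemma summable_gam: "real j + 1 < \<alpha> \<Longrightarrow> summable (\<lambda>n. real n ^ j * gam n)"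
  by (rule gam_bound) (rule summable_of_bound[OF gam_nonneg])

lemma summable_a:
  assumes "real j + 1 < \<alpha>"
  shows "summable (\<lambda>n. real n ^ j * a n)"
proof -
  obtain B where B: "\<And>n. norm (a n * real n powr \<alpha>) \<le> B"
    using convergent_imp_Bseq[of "\<lambda>n. a n * real n powr \<alpha>"] a_lim
    by (auto simp: convergent_def Bseq_def)
  have "a n \<le> B * real n powr (-\<alpha>)" if "0 < n" for n
    using B[of n] a_nonneg[of n] that by (simp add: powr_minus field_simps)
  then show ?thesis by (rule summable_of_bound[OF a_nonneg _ assms])
qed

definition Gam :: real where "Gam = suminf gam"

lemma summable_gam0: "summable gam"
  using summable_gam[of 0] \<alpha>_gt by simp

lemma Gam_ge_1: "1 \<le> Gam"
  using sum_le_suminf[OF summable_gam0, of "{0}"] gam_nonneg gam_0 by (simp add: Gam_def)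

text \<open>In \<open>rec\<close> divided by n, the terms with \<open>gam k\<close>, k < n/2, yield
  the limit, as \<open>h n\<close> = n \<open>a n\<close> decays like n^(1-\<alpha>). For k >= n/2
  the factor \<open>gam k\<close> is O(n^(-\<alpha>)) and \<open>h\<close> is summable because
  \<alpha> > 2; multiplied by n^(\<alpha>-1), this part is O(1/n).\<close>

lemma gam_limit: "(\<lambda>n. gam n * real n powr \<alpha>) \<longlonglongrightarrow> b * Gam"
proof -
  define h where "h n = real n * a n" for n
  define \<beta> where "\<beta> = \<alpha> - 1"
  have \<beta>: "1 < \<beta>" using \<alpha>_gt by (simp add: \<beta>_def)
  have h0: "0 \<le> h n" for n using a_nonneg by (simp add: h_def)
  have sh: "summable h" using summable_a[of 1] \<alpha>_gt by (simp add: h_def[abs_def])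
  have hl: "(\<lambda>n. h n * real n powr \<beta>) \<longlonglongrightarrow> b"
  proof (rule Lim_transform_eventually[OF a_lim])
    show "\<forall>\<^sub>F n in sequentially. a n * real n powr \<alpha> = h n * real n powr \<beta>"
      using eventually_gt_at_top[of 0]
      by eventually_elim (simp add: h_def \<beta>_def powr_diff)
  qed
  let ?t = "\<lambda>n k. gam k * h (n - k) * real n powr \<beta>"
  have 1: "(\<lambda>n. \<Sum>k | 2 * k < n. ?t n k) \<longlonglongrightarrow> b * Gam"
    unfolding Gam_def using convolution_head_limit[OF summable_gam0 gam_nonneg hl] \<beta> by simp
  obtain K where K: "0 < K" "\<And>n. gam n \<le> K * (real n + 1) powr (-\<alpha>)"
    "\<And>n. 0 < n \<Longrightarrow> gam n \<le> K * real n powr (-\<alpha>)" using gam_bound by blast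
  have 2: "(\<lambda>n. \<Sum>k | n \<le> 2 * k \<and> k \<le> n. ?t n k) \<longlonglongrightarrow> 0"
  proof (rule Lim_null_comparison)
    show "\<forall>\<^sub>F n in sequentially. norm (\<Sum>k | n \<le> 2 * k \<and> k \<le> n. ?t n k)
      \<le> K * 2 powr \<alpha> * suminf h / real n"
      using eventually_gt_at_top[of 0]
    proof eventually_elim
      case (elim n)
      let ?S = "{k. n \<le> 2 * k \<and> k \<le> n}"
      have fin: "finite ?S" by (rule finite_subset[of _ "{..n}"]) auto
      have g: "gam k \<le> K * 2 powr \<alpha> * real n powr (-\<alpha>)" if "k \<in> ?S" for k
      proof -
        have "gam k \<le> K * real k powr (-\<alpha>)" using K that elim by auto
        also have "real k powr (-\<alpha>) \<le> (real n / 2) powr (-\<alpha>)"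
          using that elim \<alpha>_gt by (intro powr_mono2') auto
        also have "(real n / 2) powr (-\<alpha>) = 2 powr \<alpha> * real n powr (-\<alpha>)"
          by (simp add: powr_divide powr_minus field_simps)
        finally show ?thesis using K by (simp add: mult_ac)
      qed
      have "(\<Sum>k\<in>?S. h (n - k)) = sum h ((\<lambda>k. n - k) ` ?S)"
        by (subst sum.reindex) (auto simp: inj_on_def)
      also have "\<dots> \<le> suminf h" using fin h0 by (intro sum_le_suminf sh) auto
      finally have hs: "(\<Sum>k\<in>?S. h (n - k)) \<le> suminf h" .
      have "(\<Sum>k\<in>?S. ?t n k)
        \<le> (\<Sum>k\<in>?S. K * 2 powr \<alpha> * real n powr (-\<alpha>) * h (n - k) * real n powr \<beta>)"
        by (intro sum_mono mult_right_mono g h0) auto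
      also have "\<dots> = K * 2 powr \<alpha> * (real n powr (-\<alpha>) * real n powr \<beta>) * (\<Sum>k\<in>?S. h (n - k))"
        by (simp add: sum_distrib_left mult_ac)
      also have "real n powr (-\<alpha>) * real n powr \<beta> = 1 / real n"
        using elim by (simp add: \<beta>_def powr_minus powr_diff field_simps)
      also have "K * 2 powr \<alpha> * (1 / real n) * (\<Sum>k\<in>?S. h (n - k)) \<le> K * 2 powr \<alpha> * (1 / real n) * suminf h"
        by (intro mult_left_mono hs) (use K in auto)
      finally show ?case
        by (subst real_norm_def, subst abs_of_nonneg)
          (auto intro!: sum_nonneg mult_nonneg_nonneg gam_nonneg h0 simp: field_simps)
    qed
    show "(\<lambda>n. K * 2 powr \<alpha> * suminf h / real n) \<longlonglongrightarrow> 0"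
      by (rule real_tendsto_divide_at_top[OF tendsto_const filterlim_real_sequentially])
  qed
  have "(\<Sum>k | 2 * k < n. ?t n k)
      + (\<Sum>k | n \<le> 2 * k \<and> k \<le> n. ?t n k) = gam n * real n powr \<alpha>" if "0 < n" for n
  proof -
    have "(\<Sum>k | 2 * k < n. ?t n k)
      + (\<Sum>k | n \<le> 2 * k \<and> k \<le> n. ?t n k)
      = (\<Sum>k\<in>{k. 2 * k < n} \<union> {k. n \<le> 2 * k \<and> k \<le> n}. ?t n k)"
      by (rule sum.union_disjoint[symmetric]) (auto intro: finite_subset[of _ "{..n}"])
    also have "{k. 2 * k < n} \<union> {k. n \<le> 2 * k \<and> k \<le> n} = {..n}" by auto
    also have "(\<Sum>k\<le>n. ?t n k) = (\<Sum>k\<le>n. h (n - k) * gam k) * real n powr \<beta>"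
      unfolding sum_distrib_right by (simp add: mult_ac)
    also have "(\<Sum>k\<le>n. h (n - k) * gam k) = (\<Sum>k\<le>n. h k * gam (n - k))"
      by (rule sum.reindex_bij_witness[where i = "\<lambda>k. n - k" and j = "\<lambda>k. n - k"]) auto
    also have "\<dots> = real n * gam n" using rec[of n] by (simp add: h_def)
    finally show ?thesis using that by (simp add: \<beta>_def powr_diff)
  qed
  then have "\<forall>\<^sub>F n in sequentially. (\<Sum>k | 2 * k < n. ?t n k)
      + (\<Sum>k | n \<le> 2 * k \<and> k \<le> n. ?t n k) = gam n * real n powr \<alpha>"
    by (intro eventually_mono[OF eventually_gt_at_top[of "0::nat"]])
  from Lim_transform_eventually[OF tendsto_add[OF 1 2] this] show ?thesis by simp
qed

lemma bGam_pos: "0 < b * Gam"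
  using b_pos Gam_ge_1 by simp

lemma eventually_gam_pos: "\<forall>\<^sub>F n in sequentially. 0 < gam n"
proof -
  have "\<forall>\<^sub>F n in sequentially. 0 < gam n * real n powr \<alpha>"
    by (rule order_tendstoD(1)[OF gam_limit bGam_pos])
  then show ?thesis
    by eventually_elim (metis gam_nonneg less_eq_real_def mult_zero_left)
qed

lemma quotient_limit:
  assumes "(\<lambda>n. x n * real n powr \<alpha>) \<longlonglongrightarrow> c"
  shows "(\<lambda>n. x n / gam n) \<longlonglongrightarrow> c / (b * Gam)"
proof -
  have "(\<lambda>n. (x n * real n powr \<alpha>) / (gam n * real n powr \<alpha>)) \<longlonglongrightarrow> c / (b * Gam)"
    using bGam_pos by (intro tendsto_divide assms gam_limit) auto
  moreover have "\<forall>\<^sub>F n in sequentially. (x n * real n powr \<alpha>) / (gam n * real n powr \<alpha>) = x n / gam n"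
    using eventually_gt_at_top[of 0] by eventually_elim simp
  ultimately show ?thesis by (rule Lim_transform_eventually)
qed

lemma connected_limit: "(\<lambda>n. a n / gam n) \<longlonglongrightarrow> 1 / Gam"
  using quotient_limit[OF a_lim] b_pos by simp

text \<open>Convolution with the indicator sequence of \<open>k\<close> is a shift by
  \<open>k\<close>, so the head limit applies.\<close>

lemma shifted_limit: "(\<lambda>n. a (n - k) / gam n) \<longlonglongrightarrow> 1 / Gam"
proof -
  have "(\<lambda>n. (\<Sum>j | 2 * j < n. (if j = k then 1 else 0) * a (n - j) * real n powr \<alpha>)) \<longlonglongrightarrow> b * 1"
    using convolution_head_limit[OF _ _ a_lim, of "\<lambda>j. if j = k then 1 else 0"] \<alpha>_gt
    using sums_single[of k "\<lambda>_. 1::real"] by (simp add: sums_iff)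
  moreover have "\<forall>\<^sub>F n in sequentially. (\<Sum>j | 2 * j < n. (if j = k then 1 else 0) * a (n - j) * real n powr \<alpha>)
     = a (n - k) * real n powr \<alpha>"
    using eventually_gt_at_top[of "2 * k"]
  proof eventually_elim
    case (elim n)
    have "finite {j. 2 * j < n}" by (rule finite_subset[of _ "{..n}"]) auto
    then show ?case using elim by (simp add: if_distrib if_distribR sum.delta cong: if_cong)
  qed
  ultimately have "(\<lambda>n. a (n - k) * real n powr \<alpha>) \<longlonglongrightarrow> b"
    by (simp add: Lim_transform_eventually)
  from quotient_limit[OF this] show ?thesis using b_pos by simp
qed

lemma moment_head_limit:
  assumes "real j + 1 < \<alpha>"
  shows "(\<lambda>n. \<Sum>k | 2 * k < n. real k ^ j * (gam k * a (n - k) / gam n))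
    \<longlonglongrightarrow> (\<Sum>k. real k ^ j * gam k) / Gam"
proof -
  have "(\<lambda>n. (\<Sum>k | 2 * k < n. real k ^ j * gam k * a (n - k)) * real n powr \<alpha>)
      \<longlonglongrightarrow> b * (\<Sum>k. real k ^ j * gam k)"
    using convolution_head_limit[OF summable_gam[OF assms] _ a_lim] \<alpha>_gt gam_nonneg
    by (simp add: sum_distrib_right)
  from quotient_limit[OF this] show ?thesis
    using b_pos by (simp add: sum_divide_distrib mult_ac)
qed

text \<open>Both m and n - m are at least n/3, so each product is O(n^(-2\<alpha>)). There are at
  most n + 1 of them; with the factor n^j and after division by \<open>gam n\<close> the total is
  O(n^(j+1-\<alpha>)).\<close>

lemma moment_tail_limit:
  assumes "real j + 1 < \<alpha>"
  shows "(\<lambda>n. real n ^ j * (\<Sum>m | n \<le> 3 * m \<and> 3 * m \<le> 2 * n. gam m * gam (n - m)) / gam n) \<longlonglongrightarrow> 0"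
proof -
  obtain K where K: "0 < K" "\<And>n. gam n \<le> K * (real n + 1) powr (-\<alpha>)"
    "\<And>n. 0 < n \<Longrightarrow> gam n \<le> K * real n powr (-\<alpha>)" using gam_bound by blast
  let ?M = "\<lambda>n. {m. n \<le> 3 * m \<and> 3 * m \<le> 2 * n}"
  have "(\<lambda>n. real n ^ j * (\<Sum>m\<in>?M n. gam m * gam (n - m)) * real n powr \<alpha>) \<longlonglongrightarrow> 0"
  proof (rule Lim_null_comparison)
    show "\<forall>\<^sub>F n in sequentially. norm (real n ^ j * (\<Sum>m\<in>?M n. gam m * gam (n - m)) * real n powr \<alpha>)
      \<le> (K * 3 powr \<alpha>) ^ 2 * ((real n + 1) * real n powr (real j - \<alpha>))"
      using eventually_gt_at_top[of 0]
    proof eventually_elim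
      case (elim n)
      have g: "gam m \<le> K * 3 powr \<alpha> * real n powr (-\<alpha>)" if "n \<le> 3 * m" for m
      proof -
        have "gam m \<le> K * real m powr (-\<alpha>)" using K that elim by auto
        also have "real m powr (-\<alpha>) \<le> (real n / 3) powr (-\<alpha>)"
          using that elim \<alpha>_gt by (intro powr_mono2') auto
        also have "(real n / 3) powr (-\<alpha>) = 3 powr \<alpha> * real n powr (-\<alpha>)"
          by (simp add: powr_divide powr_minus field_simps)
        finally show ?thesis using K by (simp add: mult_ac)
      qed
      have "(\<Sum>m\<in>?M n. gam m * gam (n - m)) \<le> (\<Sum>m\<in>?M n. (K * 3 powr \<alpha> * real n powr (-\<alpha>)) ^ 2)"
        unfolding power2_eq_square
        by (intro sum_mono mult_mono g) (use gam_nonneg K in auto)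
      also have "\<dots> = real (card (?M n)) * (K * 3 powr \<alpha> * real n powr (-\<alpha>)) ^ 2" by simp
      also have "\<dots> \<le> (real n + 1) * (K * 3 powr \<alpha> * real n powr (-\<alpha>)) ^ 2"
      proof (rule mult_right_mono)
        have "card (?M n) \<le> card {..n}" by (rule card_mono) auto
        then show "real (card (?M n)) \<le> real n + 1" by simp
      qed simp
      finally have le: "(\<Sum>m\<in>?M n. gam m * gam (n - m)) \<le> (real n + 1) * (K * 3 powr \<alpha> * real n powr (-\<alpha>)) ^ 2" .
      have nn: "0 \<le> (\<Sum>m\<in>?M n. gam m * gam (n - m))"
        by (intro sum_nonneg mult_nonneg_nonneg gam_nonneg)
      have "real n ^ j * (\<Sum>m\<in>?M n. gam m * gam (n - m)) * real n powr \<alpha>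
        \<le> real n ^ j * ((real n + 1) * (K * 3 powr \<alpha> * real n powr (-\<alpha>)) ^ 2) * real n powr \<alpha>"
        by (intro mult_right_mono mult_left_mono le) auto
      also have "\<dots> = (K * 3 powr \<alpha>) ^ 2 * ((real n + 1) * (real n ^ j * (real n powr (-\<alpha>)) ^ 2 * real n powr \<alpha>))"
        by (simp add: power_mult_distrib)
      also have "real n ^ j * (real n powr (-\<alpha>)) ^ 2 * real n powr \<alpha> = real n powr (real j - \<alpha>)"
        using elim by (simp add: powr_diff powr_minus powr_realpow power2_eq_square field_simps)
      finally show ?case using nn by simp
    qed
    show "(\<lambda>n. (K * 3 powr \<alpha>) ^ 2 * ((real n + 1) * real n powr (real j - \<alpha>))) \<longlonglongrightarrow> 0"
    proof -
      define d where "d = \<alpha> - real j - 1"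
      have "0 < d" using assms by (simp add: d_def)
      then have "(\<lambda>n. (real n + 1) * real n powr (- d - 1)) \<longlonglongrightarrow> 0" by real_asymp
      moreover have "- d - 1 = real j - \<alpha>" by (simp add: d_def)
      ultimately show ?thesis by (intro tendsto_mult_right_zero) simp
    qed
  qed
  from quotient_limit[OF this] show ?thesis by simp
qed

text \<open>Summing \<open>rec\<close> over all indices gives a Cauchy product.\<close>

lemma first_moment: "(\<Sum>k. real k * gam k) = (\<Sum>k. real k * a k) * Gam"
proof -
  have 1: "summable (\<lambda>k. norm (real k * a k))" using summable_a[of 1] \<alpha>_gt a_nonneg by simp
  have 2: "summable (\<lambda>k. norm (gam k))" using summable_gam0 gam_nonneg by simp
  from Cauchy_product_sums[OF 1 2] show ?thesis
    by (simp add: rec[symmetric] sums_iff Gam_def)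
qed

text \<open>A second factor k, written as i + (k - i) inside \<open>rec\<close>, splits k^2
  \<open>gam k\<close> into two convolutions: the operator x d/dx applied once more to the product
  of x C' and G.\<close>

lemma second_moment:
  assumes "3 < \<alpha>"
  shows "(\<Sum>k. real k ^ 2 * gam k) = (\<Sum>k. real k ^ 2 * a k) * Gam + (\<Sum>k. real k * a k) ^ 2 * Gam"
proof -
  have 1: "summable (\<lambda>k. norm (real k * a k))" using summable_a[of 1] \<alpha>_gt a_nonneg by simp
  have 2: "summable (\<lambda>k. norm (gam k))" using summable_gam0 gam_nonneg by simp
  have 3: "summable (\<lambda>k. norm (real k ^ 2 * a k))" using summable_a[of 2] assms a_nonneg by simp
  have 4: "summable (\<lambda>k. norm (real k * gam k))" using summable_gam[of 1] \<alpha>_gt gam_nonneg by simp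
  have "(\<Sum>i\<le>k. (real i ^ 2 * a i) * gam (k - i)) + (\<Sum>i\<le>k. (real i * a i) * (real (k - i) * gam (k - i)))
      = real k ^ 2 * gam k" for k
  proof -
    have "(\<Sum>i\<le>k. (real i ^ 2 * a i) * gam (k - i)) + (\<Sum>i\<le>k. (real i * a i) * (real (k - i) * gam (k - i)))
      = (\<Sum>i\<le>k. real k * (real i * a i * gam (k - i)))"
      unfolding sum.distrib[symmetric]
      by (intro sum.cong) (auto simp: of_nat_diff power2_eq_square algebra_simps)
    also have "\<dots> = real k ^ 2 * gam k"
      unfolding sum_distrib_left[symmetric] rec[symmetric] by (simp add: power2_eq_square)
    finally show ?thesis .
  qed
  with sums_add[OF Cauchy_product_sums[OF 3 2] Cauchy_product_sums[OF 1 4]]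
  have "(\<lambda>k. real k ^ 2 * gam k) sums ((\<Sum>k. real k ^ 2 * a k) * Gam + (\<Sum>k. real k * a k) * (\<Sum>k. real k * gam k))"
    by (simp add: Gam_def)
  then show ?thesis by (simp add: sums_iff first_moment power2_eq_square)
qed

end

section \<open>Fourier coefficients and Laplace's method\<close>

lemma has_integral_cis:
  fixes k :: int
  shows "((\<lambda>t. cis (of_int k * t)) has_integral (if k = 0 then complex_of_real (2 * pi) else 0)) {-pi..pi}"
proof (cases "k = 0")
  case True
  have "((\<lambda>t. 1::complex) has_integral (2 * pi) *\<^sub>R 1) {-pi..pi}"
    using has_integral_const_real[of "1::complex" "-pi" pi] by simp
  then show ?thesis using True by (simp add: scaleR_conv_of_real cis_zero)
next
  case False
  have *: "((\<lambda>t. cis (of_int k * t) / (\<i> * of_int k)) has_vector_derivative cis (of_int k * t)) (at t within {-pi..pi})" for t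
  proof -
    have "((\<lambda>z. exp (\<i> * (of_int k * z)) / (\<i> * of_int k)) has_field_derivative exp (\<i> * (of_int k * of_real t))) (at (of_real t))"
      using False by (auto intro!: derivative_eq_intros simp: mult.commute[of "exp _" \<i>])
    from has_vector_derivative_real_field[OF this] show ?thesis
      by (simp add: cis_conv_exp)
  qed
  have "((\<lambda>t. cis (of_int k * t)) has_integral
      (cis (of_int k * pi) / (\<i> * of_int k) - cis (of_int k * (-pi)) / (\<i> * of_int k))) {-pi..pi}"
    by (rule fundamental_theorem_of_calculus) (use * in auto)
  moreover have "cis (of_int k * pi) = cis (of_int k * (-pi))"
    by (auto simp: complex_eq_iff sin_int_times_real sin_times_pi_eq_0)
  ultimately show ?thesis using False by simp
qed

text \<open>The power series converges uniformly on the circle, so it may be integrated termwise; by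
  orthogonality the integral of a partial sum does not change once it contains the n-th
  term.\<close>

lemma fourier_coefficient:
  fixes F :: "complex fps"
  assumes r: "0 < r" "ereal r < fps_conv_radius F"
  shows "((\<lambda>t. eval_fps F (of_real r * cis t) * cis (- (real n * t)))
    has_integral (2 * of_real pi * fps_nth F n * of_real r ^ n)) {-pi..pi}"
proof -
  let ?r = "2 * of_real pi * fps_nth F n * of_real r ^ n"
  let ?c = "\<lambda>m. if int m - int n = 0 then complex_of_real (2 * pi) else 0"
  let ?f = "\<lambda>m t. fps_nth F m * of_real r ^ m * cis (of_int (int m - int n) * t)"
  let ?g = "\<lambda>t. \<Sum>m. ?f m t"
  have sm: "summable (\<lambda>m. norm (fps_nth F m * of_real r ^ m))"
    using norm_summable_fps[of "of_real r" F] r by simp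
  have eq: "?f m t = (fps_nth F m * (of_real r * cis t) ^ m) * cis (- (real n * t))" for m t
    by (simp add: power_mult_distrib Complex.DeMoivre cis_mult algebra_simps)
  have g: "?g t = eval_fps F (of_real r * cis t) * cis (- (real n * t))" for t
    unfolding eq eval_fps_def
    by (rule suminf_mult2[symmetric]) (use r in \<open>auto intro!: summable_fps simp: norm_mult\<close>)
  have ul: "uniform_limit (cbox (-pi) pi) (\<lambda>N t. \<Sum>m<N. ?f m t) ?g sequentially"
    by (rule Weierstrass_m_test[OF _ sm]) (simp add: norm_mult)
  obtain I J where I: "\<And>N. ((\<lambda>t. \<Sum>m<N. ?f m t) has_integral I N) (cbox (-pi) pi)"
    and J: "(?g has_integral J) (cbox (-pi) pi)" and IJ: "I \<longlonglongrightarrow> J"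
    by (rule uniform_limit_integral_cbox[OF ul])
      (auto intro!: continuous_intros simp: cis_conv_exp)
  have "I N = ?r" if "n < N" for N
  proof (rule has_integral_unique[OF I])
    have "((\<lambda>t. \<Sum>m<N. ?f m t) has_integral
      (\<Sum>m<N. fps_nth F m * of_real r ^ m * ?c m)) {-pi..pi}"
      by (intro has_integral_sum has_integral_mult_right has_integral_cis) auto
    moreover have "(\<Sum>m<N. fps_nth F m * of_real r ^ m * ?c m)
       = (\<Sum>m<N. if m = n then fps_nth F m * of_real r ^ m * complex_of_real (2 * pi) else 0)"
      by (intro sum.cong) auto
    ultimately show "((\<lambda>t. \<Sum>m<N. ?f m t) has_integral ?r) (cbox (-pi) pi)"
      using that by (simp add: mult_ac)
  qed
  then have "I \<longlonglongrightarrow> ?r"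
    by (intro tendsto_eventually eventually_mono[OF eventually_gt_at_top[of n]]) auto
  then have "J = ?r"
    using IJ LIMSEQ_unique by blast
  then show ?thesis using J unfolding g by simp
qed

text \<open>The integrand is a multiple of the normal density with variance 1/(2s).\<close>

lemma gaussian_integral:
  fixes s :: real
  assumes "0 < s"
  shows "integrable lborel (\<lambda>x. exp (- s * x\<^sup>2))" "(\<integral>x. exp (- s * x\<^sup>2) \<partial>lborel) = sqrt (pi / s)"
proof -
  define \<sigma> where "\<sigma> = 1 / sqrt (2 * s)"
  have \<sigma>: "0 < \<sigma>" "2 * \<sigma>\<^sup>2 = 1 / s" using assms by (auto simp: \<sigma>_def power_divide)
  have eq: "exp (- s * x\<^sup>2) = sqrt (pi / s) * normal_density 0 \<sigma> x" for x
  proof -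
    have "- (x - 0)\<^sup>2 / (2 * \<sigma>\<^sup>2) = - s * x\<^sup>2" unfolding \<sigma>(2) using assms by simp
    moreover have "2 * pi * \<sigma>\<^sup>2 = pi / s" using \<sigma>(2) by (metis mult.assoc mult.commute times_divide_eq_right mult.right_neutral)
    ultimately show ?thesis using assms unfolding normal_density_def by simp
  qed
  show "integrable lborel (\<lambda>x. exp (- s * x\<^sup>2))"
    unfolding eq using \<sigma> by (intro integrable_mult_right integrable_normal_density)
  show "(\<integral>x. exp (- s * x\<^sup>2) \<partial>lborel) = sqrt (pi / s)"
    unfolding eq using \<sigma> by (simp add: integral_normal_density)
qed

text \<open>After the substitution x / sqrt n the integrand converges pointwise to exp(-s x^2), the
  factor \<open>cis\<close> tending to 1. The global quadratic bound on Re h supplies the integrable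
  majorant exp(-c x^2) on the whole line, so no separate estimate away from 0 is needed.\<close>

lemma laplace_method:
  fixes h :: "real \<Rightarrow> complex"
  assumes cont: "continuous_on {-pi..pi} h" and c: "0 < c" and s: "0 < s"
    and le: "\<And>x. x \<in> {-pi..pi} \<Longrightarrow> Re (h x) \<le> - c * x\<^sup>2"
    and lim: "((\<lambda>x. h x / of_real (x\<^sup>2)) \<longlongrightarrow> - of_real s) (at 0)"
    and I: "\<And>n. ((\<lambda>x. cis x * exp (of_nat n * h x)) has_integral I n) {-pi..pi}"
  shows "(\<lambda>n. of_real (sqrt (real n)) * I n) \<longlonglongrightarrow> of_real (sqrt (pi / s))"
proof -
  let ?e = "\<lambda>x. complex_of_real (exp (- s * x\<^sup>2))"
  define f where "f n x = cis x * exp (of_nat n * h x)" for n x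
  define g where "g n x = indicator {-pi..pi} x *\<^sub>R f n x" for n x
  have fc: "continuous_on {-pi..pi} (f n)" for n
    unfolding f_def using cont by (intro continuous_intros) auto
  have int: "set_integrable lborel {-pi..pi} (f n)" for n
    by (rule borel_integrable_atLeastAtMost') (rule fc)
  have "(LINT x:{-pi..pi}|lborel. f n x) = I n" for n
    using set_borel_integral_eq_integral(2)[OF int] I[of n] unfolding f_def by (simp add: integral_unique)
  then have gI: "(\<integral>x. g n x \<partial>lborel) = I n" for n
    by (simp add: set_lebesgue_integral_def g_def)
  have gm: "g n \<in> borel_measurable lborel" for n
    using int[of n] unfolding set_integrable_def g_def by (rule borel_measurable_integrable)
  define k where "k n x = g n (x / sqrt (real n))" for n x
  have kI: "(\<integral>x. k n x \<partial>lborel) = of_real (sqrt (real n)) * I n" if "0 < n" for n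
  proof -
    have "(\<integral>x. g n x \<partial>lborel) = \<bar>1 / sqrt (real n)\<bar> *\<^sub>R (\<integral>x. g n (0 + 1 / sqrt (real n) * x) \<partial>lborel)"
      using that by (intro lborel_integral_real_affine) simp
    then show ?thesis using that by (simp add: gI k_def scaleR_conv_of_real)
  qed
  \<comment> \<open>The shifted index avoids the scaling by sqrt 0.\<close>
  have "(\<lambda>n. \<integral>x. k (Suc n) x \<partial>lborel) \<longlonglongrightarrow> (\<integral>x. ?e x \<partial>lborel)"
  proof (rule integral_dominated_convergence[where w = "\<lambda>x. exp (- c * x\<^sup>2)"])
    show "?e \<in> borel_measurable lborel" by measurable
    show "k (Suc n) \<in> borel_measurable lborel" for n
      using gm[of "Suc n"] unfolding k_def by simp
    show "integrable lborel (\<lambda>x. exp (- c * x\<^sup>2))" by (rule gaussian_integral[OF c])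
    show "AE x in lborel. norm (k (Suc n) x) \<le> exp (- c * x\<^sup>2)" for n
    proof (rule AE_I2)
      fix x
      define y where "y = x / sqrt (real (Suc n))"
      have y: "real (Suc n) * y\<^sup>2 = x\<^sup>2" by (simp add: y_def power_divide)
      have "norm (g (Suc n) y) \<le> exp (- c * x\<^sup>2)"
      proof (cases "y \<in> {-pi..pi}")
        case True
        have "real (Suc n) * Re (h y) \<le> real (Suc n) * (- c * y\<^sup>2)"
          using le[OF True] by (intro mult_left_mono) auto
        also have "\<dots> = - c * (real (Suc n) * y\<^sup>2)" by (simp only: mult_ac)
        finally have "real (Suc n) * Re (h y) \<le> - c * x\<^sup>2" by (simp only: y)
        then show ?thesis using True by (simp add: g_def f_def norm_mult)
      qed (simp add: g_def)
      then show "norm (k (Suc n) x) \<le> exp (- c * x\<^sup>2)" by (simp add: k_def y_def)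
    qed
    show "AE x in lborel. (\<lambda>n. k (Suc n) x) \<longlonglongrightarrow> ?e x"
    proof (rule AE_I2)
      fix x
      define y where "y n = x / sqrt (real (Suc n))" for n
      have y0: "y \<longlonglongrightarrow> 0" unfolding y_def by real_asymp
      have "(\<lambda>n. of_nat (Suc n) * h (y n)) \<longlonglongrightarrow> of_real (- s * x\<^sup>2)"
      proof (cases "x = 0")
        case True
        \<comment> \<open>The limit hypothesis is silent about the point 0 itself. Since h(x)/x^2
          converges, h tends to 0 there, and continuity gives the value.\<close>
        have "h 0 = 0"
        proof -
          have "((\<lambda>x. h x / of_real (x\<^sup>2) * of_real (x\<^sup>2)) \<longlongrightarrow> - of_real s * of_real (0\<^sup>2)) (at 0)"
            by (intro tendsto_intros lim)
          then have "((\<lambda>x. h x / of_real (x\<^sup>2) * of_real (x\<^sup>2)) \<longlongrightarrow> 0) (at 0)" by simp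
          then have "(h \<longlongrightarrow> 0) (at 0)"
            by (rule Lim_transform_eventually) (simp add: eventually_at_filter)
          moreover have "(h \<longlongrightarrow> h 0) (at 0)"
          proof -
            have "continuous (at 0 within {-pi..pi}) h"
              using cont by (simp add: continuous_on_eq_continuous_within)
            moreover have "at (0::real) within {-pi..pi} = at 0"
              by (rule at_within_interior) simp
            ultimately show ?thesis by (simp add: continuous_within)
          qed
          ultimately show ?thesis using tendsto_unique[OF at_neq_bot] by blast
        qed
        then show ?thesis using True by (simp add: y_def)
      next
        case False
        have "filterlim y (at 0) sequentially"
          using y0 False by (auto simp: filterlim_at y_def)
        from filterlim_compose[OF lim this]
        have "(\<lambda>n. of_real (x\<^sup>2) * (h (y n) / of_real ((y n)\<^sup>2))) \<longlonglongrightarrow> of_real (x\<^sup>2) * (- of_real s)"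
          by (intro tendsto_intros)
        moreover have "of_real (x\<^sup>2) * (h (y n) / of_real ((y n)\<^sup>2)) = of_nat (Suc n) * h (y n)" for n
        proof -
          have "x\<^sup>2 = real (Suc n) * (y n)\<^sup>2" by (simp add: y_def power_divide)
          moreover have "y n \<noteq> 0" using False by (simp add: y_def)
          ultimately show ?thesis by (simp del: of_nat_Suc)
        qed
        ultimately show ?thesis by (simp add: mult.commute)
      qed
      then have "(\<lambda>n. cis (y n) * exp (of_nat (Suc n) * h (y n))) \<longlonglongrightarrow> cis 0 * exp (of_real (- s * x\<^sup>2))"
        by (intro tendsto_intros y0)
      then have *: "(\<lambda>n. f (Suc n) (y n)) \<longlonglongrightarrow> ?e x"
        by (simp add: f_def exp_of_real cis_zero flip: exp_of_real)
      have "\<forall>\<^sub>F n in sequentially. \<bar>y n\<bar> < pi"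
        by (rule order_tendstoD(2)[OF tendsto_rabs_zero[OF y0]]) simp
      then have "\<forall>\<^sub>F n in sequentially. f (Suc n) (y n) = k (Suc n) x"
      proof eventually_elim
        case (elim n)
        then have "y n \<in> {-pi..pi}" by auto
        then show ?case unfolding k_def g_def y_def[symmetric] by simp
      qed
      with * show "(\<lambda>n. k (Suc n) x) \<longlonglongrightarrow> ?e x"
        by (rule Lim_transform_eventually)
    qed
  qed
  moreover have "(\<integral>x. ?e x \<partial>lborel) = of_real (sqrt (pi / s))"
    using gaussian_integral[OF s] by (simp only: integral_complex_of_real)
  ultimately have "(\<lambda>n. of_real (sqrt (real (Suc n))) * I (Suc n)) \<longlonglongrightarrow> of_real (sqrt (pi / s))"
    using kI by (simp del: of_nat_Suc)
  then show ?thesis by (rule LIMSEQ_imp_Suc)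
qed

section \<open>Lagrange inversion\<close>

text \<open>With \<phi> = X/\<psi> this coefficient is the formal residue of \<psi>^(-m-1) \<psi>'.
  To stay within power series, \<phi> \<psi>' = 1 - \<phi>' \<psi> is used; for m > 0 the two
  resulting terms cancel because \<phi>^(m-1) \<phi>' is the derivative of \<phi>^m divided by
  m.\<close>

lemma lagrange_residue:
  fixes \<phi> \<psi> :: "'a::field_char_0 fps"
  assumes eq: "\<phi> * \<psi> = fps_X" and \<psi>0: "fps_nth \<psi> 0 = 0"
  shows "fps_nth (\<phi> ^ Suc (j + m) * (\<psi> ^ j * fps_deriv \<psi>)) (j + m) = (if m = 0 then 1 else 0)"
proof -
  have "fps_deriv (\<phi> * \<psi>) = 1" by (simp add: eq)
  then have d: "\<phi> * fps_deriv \<psi> = 1 - fps_deriv \<phi> * \<psi>" by (simp add: algebra_simps)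
  have "\<phi> ^ Suc (j + m) * (\<psi> ^ j * fps_deriv \<psi>) = \<phi> ^ m * (\<phi> * \<psi>) ^ j * (\<phi> * fps_deriv \<psi>)"
    by (simp add: power_add power_mult_distrib mult_ac)
  also have "\<dots> = fps_X ^ j * (\<phi> ^ m * (1 - fps_deriv \<phi> * \<psi>))"
    by (simp only: eq d mult_ac)
  finally have *: "fps_nth (\<phi> ^ Suc (j + m) * (\<psi> ^ j * fps_deriv \<psi>)) (j + m)
      = fps_nth (\<phi> ^ m * (1 - fps_deriv \<phi> * \<psi>)) m"
    by (simp add: fps_X_power_mult_nth)
  show ?thesis
  proof (cases m)
    case 0
    then show ?thesis using \<psi>0 unfolding * by simp
  next
    case (Suc l)
    have "\<phi> ^ m * (1 - fps_deriv \<phi> * \<psi>) = \<phi> ^ m - fps_X * (\<phi> ^ l * fps_deriv \<phi>)"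
      unfolding eq[symmetric] Suc by (simp add: algebra_simps)
    moreover have "fps_nth (fps_deriv (\<phi> ^ m)) l = of_nat m * fps_nth (\<phi> ^ m) m"
      using Suc fps_deriv_nth[of "\<phi> ^ m" l] by (simp only: Suc_eq_plus1)
    moreover have "fps_deriv (\<phi> ^ m) = fps_const (of_nat m) * (\<phi> ^ l * fps_deriv \<phi>)"
      unfolding Suc fps_deriv_power by (simp add: mult_ac)
    then have "fps_nth (fps_deriv (\<phi> ^ m)) l = of_nat m * fps_nth (\<phi> ^ l * fps_deriv \<phi>) l"
      by (simp only: fps_mult_left_const_nth)
    ultimately show ?thesis using Suc unfolding * by (simp del: of_nat_Suc power_Suc fps_deriv_power)
  qed
qed

text \<open>The series \<psi> = X/\<phi> is the compositional inverse of U, so U'(\<psi>) \<psi>' =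
  1. Multiplying by \<phi>^(n+1) and expanding U'(\<psi>) in powers of \<psi>, only the n-th power
  has a nonzero residue.\<close>

lemma lagrange_inversion:
  fixes U \<phi> :: "'a::field_char_0 fps"
  assumes U: "U = fps_X * (\<phi> oo U)" and \<phi>0: "fps_nth \<phi> 0 \<noteq> 0"
  shows "of_nat (Suc n) * fps_nth U (Suc n) = fps_nth (\<phi> ^ Suc n) n"
proof -
  have U0: "fps_nth U 0 = 0" by (subst U) simp
  define \<psi> where "\<psi> = fps_X * inverse \<phi>"
  have \<psi>0: "fps_nth \<psi> 0 = 0" "fps_nth \<psi> 1 \<noteq> 0" using \<phi>0 by (auto simp: \<psi>_def)
  have \<phi>\<psi>: "\<phi> * \<psi> = fps_X" using inverse_mult_eq_1[OF \<phi>0] by (simp add: \<psi>_def mult_ac)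
  have "(\<phi> oo U) * (\<psi> oo U) = U"
    using fps_compose_mult_distrib[OF U0, of \<phi> \<psi>] \<phi>\<psi> U0 by simp
  then have "(\<phi> oo U) * (\<psi> oo U) = (\<phi> oo U) * fps_X" using U by (metis mult.commute)
  moreover have "\<phi> oo U \<noteq> 0" using \<phi>0 by (metis fps_compose_nth_0 fps_zero_nth)
  ultimately have \<psi>U: "\<psi> oo U = fps_X" by simp
  have "fps_inv \<psi> oo (\<psi> oo U) = (fps_inv \<psi> oo \<psi>) oo U"
    using fps_compose_assoc[OF U0 \<psi>0(1)] by simp
  then have "fps_inv \<psi> = U" using fps_inv[OF \<psi>0] \<psi>U U0 by (simp add: fps_X_fps_compose_startby0)
  then have "U oo \<psi> = fps_X" using fps_inv[OF \<psi>0] by simp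
  then have "(fps_deriv U oo \<psi>) * fps_deriv \<psi> = 1"
    using fps_compose_deriv[OF \<psi>0(1), of U] by simp
  then have eq: "\<phi> ^ Suc n = (fps_deriv U oo \<psi>) * (\<phi> ^ Suc n * fps_deriv \<psi>)"
    by (metis mult.assoc mult.commute mult.right_neutral)
  \<comment> \<open>Cutting the expansion after j = n does not affect coefficients up to n, because
    \<psi> has no constant term.\<close>
  let ?S = "\<Sum>j\<le>n. fps_const (fps_nth (fps_deriv U) j) * \<psi> ^ j"
  have le: "fps_nth (fps_deriv U oo \<psi>) i = fps_nth ?S i" if "i \<le> n" for i
  proof -
    have "fps_nth (fps_deriv U oo \<psi>) i = (\<Sum>j\<in>{0..i}. fps_nth (fps_deriv U) j * fps_nth (\<psi> ^ j) i)"
      by (simp add: fps_compose_nth)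
    also have "\<dots> = (\<Sum>j\<in>{..n}. fps_nth (fps_deriv U) j * fps_nth (\<psi> ^ j) i)"
      using that \<psi>0(1) startsby_zero_power_prefix[OF \<psi>0(1)] by (intro sum.mono_neutral_left) auto
    finally show ?thesis by (simp add: fps_sum_nth)
  qed
  have "fps_nth (\<phi> ^ Suc n) n
      = fps_nth (?S * (\<phi> ^ Suc n * fps_deriv \<psi>)) n"
    by (subst eq, unfold fps_mult_nth[of _ "\<phi> ^ Suc n * fps_deriv \<psi>"]) (intro sum.cong, use le in auto)
  also have "\<dots> = (\<Sum>j\<le>n. fps_nth (fps_deriv U) j * fps_nth (\<phi> ^ Suc n * (\<psi> ^ j * fps_deriv \<psi>)) n)"
    by (simp only: sum_distrib_right fps_sum_nth mult.assoc fps_mult_left_const_nth mult.left_commute[of "_ ^ _" "_ ^ Suc _"])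
  also have "\<dots> = (\<Sum>j\<le>n. if j = n then fps_nth (fps_deriv U) n else 0)"
  proof (intro sum.cong refl)
    fix j assume "j \<in> {..n}"
    then show "fps_nth (fps_deriv U) j * fps_nth (\<phi> ^ Suc n * (\<psi> ^ j * fps_deriv \<psi>)) n
      = (if j = n then fps_nth (fps_deriv U) n else 0)"
      using lagrange_residue[OF \<phi>\<psi> \<psi>0(1), of j "n - j"] by auto
  qed
  also have "\<dots> = of_nat (Suc n) * fps_nth U (Suc n)" by simp
  finally show ?thesis ..
qed

section \<open>The tree equation\<close>

text \<open>Order and monotonicity arguments use the real series; this copy serves Fourier integrals
  and holomorphy.\<close>

definition complex_fps :: "real fps \<Rightarrow> complex fps" where
  "complex_fps F = Abs_fps (\<lambda>n. of_real (fps_nth F n))"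

lemma complex_fps_nth [simp]: "fps_nth (complex_fps F) n = of_real (fps_nth F n)"
  by (simp add: complex_fps_def)

lemma complex_fps_mult: "complex_fps (F * G) = complex_fps F * complex_fps G"
  by (rule fps_ext) (simp add: fps_mult_nth)

lemma complex_fps_X [simp]: "complex_fps fps_X = fps_X"
  by (rule fps_ext) simp

lemma complex_fps_1 [simp]: "complex_fps 1 = 1"
  by (rule fps_ext) simp

lemma complex_fps_exp [simp]: "complex_fps (fps_exp c) = fps_exp (of_real c)"
  by (rule fps_ext) simp

lemma complex_fps_power: "complex_fps (F ^ n) = complex_fps F ^ n"
  by (induction n) (simp_all add: complex_fps_mult)

lemma complex_fps_compose: "complex_fps (F oo G) = complex_fps F oo complex_fps G"
  by (rule fps_ext) (simp add: fps_compose_nth flip: complex_fps_power)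

lemma fps_conv_radius_complex_fps [simp]: "fps_conv_radius (complex_fps F) = fps_conv_radius F"
  using fps_conv_radius_norm[of F] fps_conv_radius_norm[of "complex_fps F"] by simp

lemma eval_complex_fps:
  assumes "summable (\<lambda>n. fps_nth F n * x ^ n)"
  shows "eval_fps (complex_fps F) (of_real x) = of_real (eval_fps F x)"
  unfolding eval_fps_def suminf_of_real[OF assms] by simp

text \<open>The function exp(c F(z)) is holomorphic on the disc of convergence of F, and its Taylor
  series at 0 is the formal composition; hence the latter converges there to this function.\<close>

lemma eval_fps_exp_compose:
  fixes F :: "complex fps"
  assumes "fps_nth F 0 = 0" "ereal (norm z) < fps_conv_radius F"
  shows "eval_fps (fps_exp c oo F) z = exp (c * eval_fps F z)"
    and "fps_conv_radius F \<le> fps_conv_radius (fps_exp c oo F)"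
proof -
  have pos: "0 < fps_conv_radius F" using assms(2) by (meson ereal_less_eq(5) norm_ge_zero order_le_less_trans)
  have 1: "((\<lambda>w. exp (c * w)) \<circ> eval_fps F) has_fps_expansion (fps_exp c oo F)"
    by (intro has_fps_expansion_compose has_fps_expansion_exp eval_fps_has_fps_expansion pos assms)
  have 2: "((\<lambda>w. exp (c * w)) \<circ> eval_fps F) holomorphic_on eball 0 (fps_conv_radius F)"
    unfolding o_def by (intro holomorphic_intros) auto
  show "fps_conv_radius F \<le> fps_conv_radius (fps_exp c oo F)"
    by (rule holomorphic_on_imp_fps_conv_radius_ge[OF 1 2])
  show "eval_fps (fps_exp c oo F) z = exp (c * eval_fps F z)"
    using has_fps_expansion_imp_sums_complex[OF 1 2 assms(2)] by (simp add: eval_fps_def sums_iff)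
qed

section \<open>The saddle-point asymptotics of the tree function\<close>

text \<open>With y = |t|/2 <= 2 the Taylor bound gives sin y >= y - y^3/6 >= y/3, and 1 - cos t = 2
  sin^2 y turns this into t^2/18.\<close>

lemma one_minus_cos_ge:
  assumes "\<bar>t\<bar> \<le> pi"
  shows "t\<^sup>2 / 18 \<le> 1 - cos t"
proof -
  define y where "y = \<bar>t\<bar> / 2"
  have y: "0 \<le> y" "y \<le> 2" using assms pi_less_4 by (auto simp: y_def)
  have "\<bar>Im (iexp y - (\<Sum>k\<le>2. (\<i> * y) ^ k / fact k))\<bar> \<le> \<bar>y\<bar> ^ 3 / fact 3"
    using abs_Im_le_cmod[of "iexp y - (\<Sum>k\<le>2. (\<i> * y) ^ k / fact k)"] iexp_approx1[of y 2]
    by (simp add: numeral_3_eq_3 numeral_2_eq_2)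
  moreover have "Im (iexp y - (\<Sum>k\<le>2. (\<i> * y) ^ k / fact k)) = sin y - y"
    by (simp add: numeral_2_eq_2 Im_exp power_mult_distrib)
  ultimately have "\<bar>sin y - y\<bar> \<le> y ^ 3 / 6" using y by (simp add: fact_numeral)
  then have "y - y ^ 3 / 6 \<le> sin y" by linarith
  moreover have "y * y\<^sup>2 \<le> y * 4" using y power_mono[of y 2 2] by (intro mult_left_mono) auto
  then have "y ^ 3 \<le> 4 * y" by (simp add: power3_eq_cube power2_eq_square)
  ultimately have "y / 3 \<le> sin y" by simp
  then have "(y / 3)\<^sup>2 \<le> (sin y)\<^sup>2" using y by (intro power_mono) auto
  moreover have "cos t = 1 - 2 * (sin y)\<^sup>2"
    using cos_double_sin[of y] by (simp add: y_def abs_if split: if_splits)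
  ultimately show ?thesis by (simp add: y_def power_divide)
qed

lemma norm_iexp_diff_le: "norm (cis x - 1 - \<i> * of_real x) \<le> x\<^sup>2 / 2"
  using iexp_approx1[of x 1] by (simp add: cis_conv_exp numeral_2_eq_2 diff_diff_eq power2_eq_square)

lemma iexp_second_order:
  "((\<lambda>x. (cis (k * x) - 1 - \<i> * of_real (k * x)) / of_real (x\<^sup>2)) \<longlongrightarrow> - of_real (k\<^sup>2 / 2)) (at 0)"
proof (rule Lim_transform)
  let ?d = "\<lambda>x. (cis (k * x) - 1 - \<i> * of_real (k * x)) / of_real (x\<^sup>2) - - of_real (k\<^sup>2 / 2)"
  have "norm (?d x) \<le> \<bar>k\<bar> ^ 3 / 6 * \<bar>x\<bar>"
    if "x \<noteq> 0" for x
  proof -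
    have "?d x
      = (iexp (k * x) - (\<Sum>j\<le>2. (\<i> * of_real (k * x)) ^ j / fact j)) / of_real (x\<^sup>2)"
      using that by (simp add: numeral_2_eq_2 cis_conv_exp field_simps power_mult_distrib)
    also have "norm \<dots> \<le> \<bar>k * x\<bar> ^ 3 / 6 / x\<^sup>2"
    proof -
      have "norm (iexp (k * x) - (\<Sum>j\<le>2. (\<i> * of_real (k * x)) ^ j / fact j)) \<le> \<bar>k * x\<bar> ^ 3 / 6"
        using iexp_approx1[of "k * x" 2] by (simp add: fact_numeral flip: numeral_3_eq_3)
      then have "norm (iexp (k * x) - (\<Sum>j\<le>2. (\<i> * of_real (k * x)) ^ j / fact j)) / x\<^sup>2 \<le> \<bar>k * x\<bar> ^ 3 / 6 / x\<^sup>2"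
        by (rule divide_right_mono) simp
      then show ?thesis by (simp add: norm_divide norm_power)
    qed
    also have "\<dots> = \<bar>k\<bar> ^ 3 / 6 * \<bar>x\<bar>"
      using that by (simp add: abs_mult power_mult_distrib power3_eq_cube power2_eq_square field_simps)
    finally show ?thesis .
  qed
  then have "\<forall>\<^sub>F x in at 0. norm (?d x) \<le> \<bar>k\<bar> ^ 3 / 6 * \<bar>x\<bar>"
    by (simp add: eventually_at_filter)
  moreover have "((\<lambda>x. \<bar>k\<bar> ^ 3 / 6 * \<bar>x\<bar>) \<longlongrightarrow> 0) (at 0)"
    by (auto intro!: tendsto_eq_intros)
  ultimately show "(?d \<longlongrightarrow> 0) (at 0)"
    by (rule Lim_null_comparison)
qed simp

text \<open>Here \<beta> plays the role of B', and the series condition on \<tau> is the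
  saddle-point equation \<tau> B''(\<tau>) = 1. Lagrange inversion with exp(\<beta>) produces an
  integral of an n-th power, and the extra factor n in front of the coefficient turns the n^(-1/2)
  of Laplace's method into n^(-3/2).\<close>

lemma tree_coefficients_asymptotic:
  fixes \<beta> U :: "real fps"
  assumes U: "U = fps_X * (fps_exp 1 oo (\<beta> oo U))"
    and \<beta>0: "fps_nth \<beta> 0 = 0" and \<beta>1: "0 < fps_nth \<beta> 1" and \<beta>: "\<And>n. 0 \<le> fps_nth \<beta> n"
    and \<tau>: "0 < \<tau>" "ereal \<tau> < fps_conv_radius \<beta>"
    and \<tau>_eq: "(\<lambda>n. real n * fps_nth \<beta> n * \<tau> ^ n) sums 1"
    and \<rho>: "\<rho> = \<tau> * exp (- eval_fps \<beta> \<tau>)"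
  obtains b where "0 < b" "(\<lambda>n. fps_nth U n * \<rho> ^ n * real n powr (3/2)) \<longlonglongrightarrow> b"
proof -
  define w where "w k = fps_nth \<beta> k * \<tau> ^ k" for k
  have w0: "0 \<le> w k" for k using \<beta> \<tau> by (simp add: w_def)
  have w1: "0 < w 1" using \<beta>1 \<tau> by (simp add: w_def)
  have sw: "summable w"
    using summable_fps[of \<tau> \<beta>] \<tau> by (simp add: w_def[abs_def])
  have sw1: "(\<lambda>k. real k * w k) sums 1" using \<tau>_eq by (simp add: w_def mult_ac)
  have sw2: "summable (\<lambda>k. (real k)\<^sup>2 * w k)"
  proof -
    \<comment> \<open>This is x d/dx applied twice to \<beta>. The disc of convergence does not
      shrink, and \<tau> lies strictly inside it.\<close>
    define D where "D = fps_X * fps_deriv (fps_X * fps_deriv \<beta>)"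
    have D: "fps_nth D k = (real k)\<^sup>2 * fps_nth \<beta> k" for k
      by (cases k) (simp_all add: D_def power2_eq_square algebra_simps)
    have X: "fps_conv_radius f \<le> fps_conv_radius (fps_X * fps_deriv f)" for f :: "real fps"
      using fps_conv_radius_deriv[of f] fps_conv_radius_mult[of fps_X "fps_deriv f"] by simp
    have "ereal \<tau> < fps_conv_radius D"
      unfolding D_def using X[of "fps_X * fps_deriv \<beta>"] X[of \<beta>] \<tau>(2) by order
    then show ?thesis using summable_fps[of \<tau> D] \<tau> by (simp add: D w_def mult_ac)
  qed
  define s where "s = (\<Sum>k. (real k)\<^sup>2 * w k) / 2"
  have s: "0 < s"
  proof -
    have "(real 1)\<^sup>2 * w 1 \<le> (\<Sum>k. (real k)\<^sup>2 * w k)"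
      using sum_le_suminf[OF sw2, of "{1}"] w0 by simp
    then show ?thesis using w1 by (simp add: s_def)
  qed
  have s_sums: "(\<lambda>k. (real k)\<^sup>2 * w k / 2) sums s"
    unfolding s_def using summable_sums[OF sw2] by (rule sums_divide)
  \<comment> \<open>The exponent \<beta>(\<tau> e^(it)) - \<beta>(\<tau>) - it. Since the k
    \<open>w k\<close> sum to 1, the linear term it can be distributed over the series, after which
    every term vanishes to second order at 0.\<close>
  define h where "h t = (\<Sum>k. of_real (w k) * (cis (real k * t) - 1 - \<i> * of_real (k * t)))" for t :: real
  define B where "B = complex_fps \<beta>"
  have evB: "(\<lambda>k. of_real (w k) * cis (real k * t)) sums eval_fps B (of_real \<tau> * cis t)" for t :: real
  proof -
    have "(\<lambda>k. fps_nth B k * (of_real \<tau> * cis t) ^ k) sums eval_fps B (of_real \<tau> * cis t)"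
      using \<tau> by (intro sums_eval_fps) (auto simp: B_def norm_mult)
    then show ?thesis by (simp add: B_def w_def power_mult_distrib Complex.DeMoivre mult_ac)
  qed
  have ev\<tau>: "w sums eval_fps \<beta> \<tau>"
    using sums_eval_fps[of \<tau> \<beta>] \<tau> by (simp add: w_def[abs_def])
  have h_eq: "h t = eval_fps B (of_real \<tau> * cis t) - of_real (eval_fps \<beta> \<tau>) - \<i> * of_real t"
    and h_sums: "(\<lambda>k. of_real (w k) * (cis (real k * t) - 1 - \<i> * of_real (k * t))) sums h t" for t :: real
  proof -
    have "(\<lambda>k. of_real (real k * w k) * (\<i> * of_real t)) sums (of_real 1 * (\<i> * of_real t))"
      using sw1 by (intro sums_mult2 sums_of_real)
    then have "(\<lambda>k. of_real (w k) * cis (real k * t) - of_real (w k) - of_real (real k * w k) * (\<i> * of_real t))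
      sums (eval_fps B (of_real \<tau> * cis t) - of_real (eval_fps \<beta> \<tau>) - of_real 1 * (\<i> * of_real t))"
      by (intro sums_diff evB sums_of_real ev\<tau>)
    then have *: "(\<lambda>k. of_real (w k) * (cis (real k * t) - 1 - \<i> * of_real (k * t)))
       sums (eval_fps B (of_real \<tau> * cis t) - of_real (eval_fps \<beta> \<tau>) - \<i> * of_real t)"
      by (simp add: algebra_simps)
    then show "h t = eval_fps B (of_real \<tau> * cis t) - of_real (eval_fps \<beta> \<tau>) - \<i> * of_real t"
      by (simp add: h_def sums_iff)
    with * show "(\<lambda>k. of_real (w k) * (cis (real k * t) - 1 - \<i> * of_real (k * t))) sums h t" by simp
  qed
  have cont: "continuous_on {-pi..pi} h"
  proof -
    have "h = (\<lambda>t. eval_fps B (of_real \<tau> * cis t) - of_real (eval_fps \<beta> \<tau>) - \<i> * of_real t)"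
      by (rule ext) (rule h_eq)
    moreover have "continuous_on {-pi..pi} (\<lambda>t. eval_fps B (of_real \<tau> * cis t) - of_real (eval_fps \<beta> \<tau>) - \<i> * of_real t)"
      using \<tau> by (intro continuous_intros) (auto simp: B_def norm_mult)
    ultimately show ?thesis by simp
  qed
  \<comment> \<open>All terms of -Re h are nonnegative, and the one with k = 1 alone gives the
    quadratic bound on the whole circle.\<close>
  have Re: "Re (h x) \<le> - (w 1 / 18) * x\<^sup>2" if "x \<in> {-pi..pi}" for x
  proof -
    have "(\<lambda>k. w k * (1 - cos (real k * x))) sums (- Re (h x))"
      using sums_minus[OF sums_Re[OF h_sums[of x]]] by (simp add: algebra_simps)
    then have "w 1 * (1 - cos (real 1 * x)) \<le> - Re (h x)"
      using sum_le_suminf[of "\<lambda>k. w k * (1 - cos (real k * x))" "{1}"] w0 by (auto simp: sums_iff)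
    moreover have "w 1 * (x\<^sup>2 / 18) \<le> w 1 * (1 - cos x)"
      using one_minus_cos_ge[of x] that w1 by (intro mult_left_mono) auto
    ultimately show ?thesis by simp
  qed
  have lim: "((\<lambda>x. h x / of_real (x\<^sup>2)) \<longlongrightarrow> - of_real s) (at 0)"
  proof -
    let ?a = "\<lambda>k x. of_real (w k) * ((cis (real k * x) - 1 - \<i> * of_real (k * x)) / of_real (x\<^sup>2))"
    have "((\<lambda>x. \<Sum>k. ?a k x) \<longlongrightarrow> (\<Sum>k. of_real (w k) * (- of_real ((real k)\<^sup>2 / 2)))) (at (0::real))"
    proof (rule conjunct2[OF conjunct2[OF tannerys_theorem[where M = "\<lambda>k. (real k)\<^sup>2 * w k / 2"]]])
      show "((\<lambda>x. ?a k x) \<longlongrightarrow> of_real (w k) * (- of_real ((real k)\<^sup>2 / 2))) (at 0)" for k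
        by (intro tendsto_intros iexp_second_order)
      have "norm (?a k x) \<le> (real k)\<^sup>2 * w k / 2" for k and x :: real
      proof (cases "x = 0")
        case False
        have "norm (cis (real k * x) - 1 - \<i> * of_real (k * x)) / x\<^sup>2 \<le> (real k * x)\<^sup>2 / 2 / x\<^sup>2"
          by (intro divide_right_mono norm_iexp_diff_le) auto
        also have "\<dots> = (real k)\<^sup>2 / 2" using False by (simp add: power_mult_distrib)
        finally have "w k * (norm (cis (real k * x) - 1 - \<i> * of_real (k * x)) / x\<^sup>2) \<le> w k * ((real k)\<^sup>2 / 2)"
          using w0 by (intro mult_left_mono)
        then show ?thesis using w0 by (simp add: norm_mult norm_divide norm_power mult_ac)
      qed (use w0 in simp)
      then show "\<forall>\<^sub>F (k, x) in at_top \<times>\<^sub>F at 0. norm (?a k x) \<le> (real k)\<^sup>2 * w k / 2"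
        by (intro always_eventually) auto
      show "summable (\<lambda>k. (real k)\<^sup>2 * w k / 2)" using s_sums by (simp add: sums_iff)
    qed simp
    moreover have "(\<Sum>k. ?a k x) = h x / of_real (x\<^sup>2)" for x :: real
      using sums_divide[OF h_sums[of x], of "of_real (x\<^sup>2)"] by (simp add: sums_iff)
    moreover have "(\<lambda>k. complex_of_real (w k) * (- of_real ((real k)\<^sup>2 / 2))) sums (- of_real s)"
      using sums_minus[OF sums_of_real[OF s_sums, where ?'a = complex]] by (simp add: mult_ac)
    ultimately show ?thesis by (simp add: sums_iff)
  qed
  have \<phi>U: "U = fps_X * ((fps_exp 1 oo \<beta>) oo U)"
    using U fps_compose_assoc[of U \<beta> "fps_exp 1"] \<beta>0 by (metis fps_X_mult_nth fps_mult_nth_0 fps_X_nth mult_zero_left zero_neq_one)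
  \<comment> \<open>The coefficient at n is taken of a power with exponent n + 1: the factor
    cis(-nt) equals cis t times cis(-(n+1)t), which leaves one \<open>cis t\<close> outside the
    exponential.\<close>
  have coeff: "((\<lambda>t. cis t * exp (of_nat (Suc n) * h t)) has_integral
      of_real (2 * pi / \<tau> * (real (Suc n) * (fps_nth U (Suc n) * \<rho> ^ Suc n)))) {-pi..pi}" for n
  proof -
    let ?e = "exp (- real (Suc n) * eval_fps \<beta> \<tau>)"
    define \<Phi> where "\<Phi> = fps_exp (of_nat (Suc n)) oo B"
    have B0: "fps_nth B 0 = 0" by (simp add: B_def \<beta>0)
    have "complex_fps ((fps_exp 1 oo \<beta>) ^ Suc n) = (fps_exp 1 oo B) ^ Suc n"
      by (simp only: complex_fps_power complex_fps_compose complex_fps_exp of_real_1 B_def)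
    also have "\<dots> = \<Phi>"
      by (simp only: \<Phi>_def fps_compose_power[OF B0] fps_exp_power_mult mult.right_neutral)
    finally have "fps_nth \<Phi> n = of_real (fps_nth ((fps_exp 1 oo \<beta>) ^ Suc n) n)"
      by (metis complex_fps_nth)
    also have "\<dots> = of_real (real (Suc n) * fps_nth U (Suc n))"
      using lagrange_inversion[OF \<phi>U, of n] by simp
    finally have \<Phi>n: "fps_nth \<Phi> n = of_real (real (Suc n) * fps_nth U (Suc n))" .
    have cr: "ereal \<tau> < fps_conv_radius B" using \<tau> by (simp add: B_def)
    have nz: "norm (of_real \<tau> * cis t) = \<tau>" for t using \<tau> by (simp add: norm_mult)
    have "ereal \<tau> < fps_conv_radius \<Phi>"
      using eval_fps_exp_compose(2)[OF B0, of "of_real \<tau>"] cr \<tau> unfolding \<Phi>_def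
      by (smt (verit) norm_of_real order_less_le_trans abs_of_pos)
    from fourier_coefficient[OF \<tau>(1) this, of n]
    have "((\<lambda>t. exp (of_nat (Suc n) * eval_fps B (of_real \<tau> * cis t)) * cis (- (real n * t)))
        has_integral 2 * of_real pi * of_real (real (Suc n) * fps_nth U (Suc n)) * of_real \<tau> ^ n) {-pi..pi}"
      unfolding \<Phi>n unfolding \<Phi>_def
      by (subst (asm) eval_fps_exp_compose(1)[OF B0]) (simp_all only: nz cr)
    from has_integral_mult_left[OF this, of "of_real (?e)"]
    have 1: "((\<lambda>t. exp (of_nat (Suc n) * eval_fps B (of_real \<tau> * cis t)) * cis (- (real n * t)) * of_real (?e))
        has_integral 2 * of_real pi * of_real (real (Suc n) * fps_nth U (Suc n)) * of_real \<tau> ^ n * of_real (?e)) {-pi..pi}" .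
    have 2: "exp (of_nat (Suc n) * eval_fps B (of_real \<tau> * cis t)) * cis (- (real n * t)) * of_real (?e)
      = cis t * exp (of_nat (Suc n) * h t)" for t
      unfolding h_eq cis_conv_exp exp_of_real[symmetric] exp_add[symmetric]
      by (rule arg_cong[where f = exp]) (simp add: algebra_simps)
    have "\<rho> ^ Suc n = \<tau> * \<tau> ^ n * ?e"
      unfolding \<rho> power_mult_distrib exp_of_nat_mult[symmetric] by (simp add: algebra_simps)
    then have "2 * pi / \<tau> * (real (Suc n) * (fps_nth U (Suc n) * \<rho> ^ Suc n))
      = 2 * pi * (real (Suc n) * fps_nth U (Suc n)) * \<tau> ^ n * ?e"
      using \<tau> by (simp add: field_simps)
    then have 3: "2 * of_real pi * of_real (real (Suc n) * fps_nth U (Suc n)) * of_real \<tau> ^ n * of_real (?e)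
      = complex_of_real (2 * pi / \<tau> * (real (Suc n) * (fps_nth U (Suc n) * \<rho> ^ Suc n)))"
      by (simp only: of_real_mult of_real_power of_real_numeral)
    show ?thesis using 1 unfolding 2 3 .
  qed
  \<comment> \<open>Lagrange inversion covers the positive indices; the entry at 0 is simply the
    integral of \<open>cis\<close> over the interval.\<close>
  define I where "I n = (case n of 0 \<Rightarrow> integral {-pi..pi} cis
    | Suc m \<Rightarrow> of_real (2 * pi / \<tau> * (real n * (fps_nth U n * \<rho> ^ n))))" for n
  have I: "((\<lambda>t. cis t * exp (of_nat n * h t)) has_integral I n) {-pi..pi}" for n
  proof (cases n)
    case 0
    have "cis integrable_on {-pi..pi}" by (intro integrable_continuous_real continuous_intros)
    then show ?thesis using 0 by (simp add: I_def has_integral_integral)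
  next
    case (Suc m)
    then show ?thesis using coeff[of m] by (simp add: I_def)
  qed
  have "0 < w 1 / 18" using w1 by simp
  from laplace_method[OF cont this s Re lim I]
  have "(\<lambda>n. of_real (sqrt (real n)) * I n) \<longlonglongrightarrow> of_real (sqrt (pi / s))" by simp
  moreover have "\<forall>\<^sub>F n in sequentially. of_real (sqrt (real n)) * I n
      = complex_of_real (2 * pi / \<tau> * (fps_nth U n * \<rho> ^ n * real n powr (3/2)))"
    using eventually_gt_at_top[of 0]
  proof eventually_elim
    case (elim n)
    have "real n powr (3/2) = real n powr (1 + 1/2)" by simp
    also have "\<dots> = real n * sqrt (real n)" using elim unfolding powr_add by (simp add: powr_half_sqrt)
    finally show ?case using elim by (cases n) (simp_all add: I_def mult_ac)
  qed
  ultimately have "(\<lambda>n. complex_of_real (2 * pi / \<tau> * (fps_nth U n * \<rho> ^ n * real n powr (3/2)))) \<longlonglongrightarrow> of_real (sqrt (pi / s))"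
    by (rule Lim_transform_eventually)
  then have "(\<lambda>n. 2 * pi / \<tau> * (fps_nth U n * \<rho> ^ n * real n powr (3/2))) \<longlonglongrightarrow> sqrt (pi / s)"
    by (simp only: tendsto_of_real_iff)
  from tendsto_mult_left[OF this, of "\<tau> / (2 * pi)"]
  have "(\<lambda>n. fps_nth U n * \<rho> ^ n * real n powr (3/2)) \<longlonglongrightarrow> \<tau> / (2 * pi) * sqrt (pi / s)"
    using \<tau> by (simp add: mult_ac)
  moreover have "0 < \<tau> / (2 * pi) * sqrt (pi / s)" using \<tau> s by simp
  ultimately show thesis by (rule that[rotated])
qed

section \<open>The value of the tree function at its singularity\<close>

lemma suminf_strict_mono:
  fixes f g :: "nat \<Rightarrow> real"
  assumes "summable f" "summable g" "\<And>n. f n \<le> g n" "f i < g i"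
  shows "suminf f < suminf g"
  using suminf_pos2[of "\<lambda>n. g n - f n" i] assms
  by (simp add: summable_diff suminf_diff[symmetric])

text \<open>Formally, \<psi> increases because v \<psi>'(v)/\<psi>(v) = 1 - v \<beta>'(v) is
  nonnegative up to \<sigma>. As \<psi> inverts U below \<rho> and \<psi>(\<sigma>) = \<rho>, the
  increasing function U rises exactly to \<sigma>. Only summability at \<sigma> is assumed, so that
  \<sigma> may lie on the circle of convergence of \<beta>; this serves \<tau> and R alike.\<close>

lemma tree_function_at_singularity:
  fixes \<beta> U :: "real fps"
  assumes U: "U = fps_X * (fps_exp 1 oo (\<beta> oo U))" and Un: "\<And>n. 0 \<le> fps_nth U n"
    and cU: "fps_conv_radius U = ereal \<rho>" "0 < \<rho>"
    and \<beta>0: "fps_nth \<beta> 0 = 0" and \<beta>1: "0 < fps_nth \<beta> 1" and \<beta>: "\<And>n. 0 \<le> fps_nth \<beta> n"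
    and \<sigma>: "0 < \<sigma>" and sm: "summable (\<lambda>n. fps_nth \<beta> n * \<sigma> ^ n)"
    and sm1: "summable (\<lambda>n. real n * fps_nth \<beta> n * \<sigma> ^ n)"
    and le1: "(\<Sum>n. real n * fps_nth \<beta> n * \<sigma> ^ n) \<le> 1"
    and \<rho>: "\<rho> = \<sigma> * exp (- eval_fps \<beta> \<sigma>)"
  shows "(\<lambda>n. fps_nth U n * \<rho> ^ n) sums \<sigma>"
proof -
  have U0: "fps_nth U 0 = 0" by (subst U) simp
  have "fps_nth U (Suc 0) = 1"
    by (subst U) (simp add: \<beta>0)
  then have U1: "fps_nth U 1 = 1" by simp
  have smv: "summable (\<lambda>n. fps_nth \<beta> n * v ^ n)" if "0 \<le> v" "v \<le> \<sigma>" for v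
    by (rule summable_comparison_test'[OF sm, of 0])
      (use that \<beta> in \<open>auto intro!: mult_left_mono power_mono\<close>)
  define \<psi> where "\<psi> v = v * exp (- eval_fps \<beta> v)" for v
  have \<psi>_mono: "\<psi> v < \<psi> w" if vw: "0 \<le> v" "v < w" "w \<le> \<sigma>" for v w
  proof (cases "v = 0")
    case True
    then show ?thesis using that by (simp add: \<psi>_def)
  next
    case False
    then have v: "0 < v" using vw by simp
    \<comment> \<open>On the logarithmic scale w^n - v^n = w^n (1 - e^(-nl)) <= n l \<sigma>^n.
      Summed against the coefficients of \<beta>, whose weighted sum is at most 1, the increase of
      \<beta> is less than l = ln w - ln v; strictness comes from n = 1.\<close>
    define l where "l = ln (w / v)"
    have l: "0 < l" using v vw by (simp add: l_def)
    have step: "w ^ n - v ^ n \<le> real n * l * \<sigma> ^ n" "n = 1 \<Longrightarrow> w ^ n - v ^ n < real n * l * \<sigma> ^ n" for n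
    proof -
      have vl: "v = w * exp (- l)" using v vw by (simp add: l_def exp_minus)
      have eq: "w ^ n - v ^ n = w ^ n * (1 - exp (- (n * l)))"
        by (simp add: vl power_mult_distrib algebra_simps flip: exp_of_nat_mult)
      have wn: "0 < w ^ n" "w ^ n \<le> \<sigma> ^ n" using v vw by (auto intro!: power_mono)
      have "w ^ n * (1 - exp (- (n * l))) \<le> w ^ n * (n * l)"
        using wn exp_ge_add_one_self[of "- (n * l)"] by (intro mult_left_mono) auto
      moreover have "w ^ n * (n * l) \<le> \<sigma> ^ n * (n * l)"
        using wn l by (intro mult_right_mono) auto
      ultimately show "w ^ n - v ^ n \<le> real n * l * \<sigma> ^ n" unfolding eq by (simp add: mult_ac)
      assume n: "n = 1"
      have "w ^ n * (1 - exp (- (n * l))) < w ^ n * (n * l)"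
        using wn l n exp_minus_greater[of "n * l"] by (intro mult_strict_left_mono) auto
      then show "w ^ n - v ^ n < real n * l * \<sigma> ^ n"
        using \<open>w ^ n * (n * l) \<le> \<sigma> ^ n * (n * l)\<close> unfolding eq by (simp add: mult_ac)
    qed
    have s1: "(\<lambda>n. fps_nth \<beta> n * w ^ n - fps_nth \<beta> n * v ^ n) sums (eval_fps \<beta> w - eval_fps \<beta> v)"
      unfolding eval_fps_def using vw by (intro sums_diff summable_sums smv) auto
    have s2: "(\<lambda>n. l * (real n * fps_nth \<beta> n * \<sigma> ^ n)) sums (l * (\<Sum>n. real n * fps_nth \<beta> n * \<sigma> ^ n))"
      by (intro sums_mult summable_sums sm1)
    have t: "fps_nth \<beta> n * w ^ n - fps_nth \<beta> n * v ^ n \<le> l * (real n * fps_nth \<beta> n * \<sigma> ^ n)" for n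
      using mult_left_mono[OF step(1)[of n] \<beta>[of n]] by (simp add: algebra_simps)
    have "eval_fps \<beta> w - eval_fps \<beta> v < l * (\<Sum>n. real n * fps_nth \<beta> n * \<sigma> ^ n)"
    proof -
      have "(\<Sum>n. fps_nth \<beta> n * w ^ n - fps_nth \<beta> n * v ^ n) < (\<Sum>n. l * (real n * fps_nth \<beta> n * \<sigma> ^ n))"
      proof (rule suminf_strict_mono[where i = 1])
        show "fps_nth \<beta> 1 * w ^ 1 - fps_nth \<beta> 1 * v ^ 1 < l * (real 1 * fps_nth \<beta> 1 * \<sigma> ^ 1)"
          using mult_strict_left_mono[OF step(2)[OF refl] \<beta>1] by (simp add: algebra_simps)
      qed (use t s1 s2 in \<open>auto simp: sums_iff\<close>)
      then show ?thesis using s1 s2 by (simp add: sums_iff)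
    qed
    also have "\<dots> \<le> l * 1" using le1 l by (intro mult_left_mono) auto
    finally have "ln v - eval_fps \<beta> v < ln w - eval_fps \<beta> w"
      using v vw by (simp add: l_def ln_div)
    then have "exp (ln v - eval_fps \<beta> v) < exp (ln w - eval_fps \<beta> w)" by simp
    then show ?thesis using v vw by (simp add: \<psi>_def exp_diff exp_minus divide_inverse)
  qed
  have \<psi>_cont: "continuous_on {0..\<sigma>} \<psi>"
  proof -
    have "uniform_limit {0..\<sigma>} (\<lambda>N x. \<Sum>n<N. fps_nth \<beta> n * x ^ n) (\<lambda>x. \<Sum>n. fps_nth \<beta> n * x ^ n) sequentially"
      by (rule Weierstrass_m_test[OF _ sm])
        (use \<beta> in \<open>auto simp: abs_mult power_abs intro!: mult_left_mono power_mono\<close>)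
    then have "continuous_on {0..\<sigma>} (eval_fps \<beta>)"
      unfolding eval_fps_def[abs_def]
      by (intro uniform_limit_theorem[where F = sequentially]) (auto intro!: always_eventually continuous_intros)
    then show ?thesis
      unfolding \<psi>_def by (intro continuous_on_mult continuous_on_id continuous_on_exp continuous_on_minus)
  qed
  have sU: "summable (\<lambda>n. fps_nth U n * x ^ n)" if "0 \<le> x" "x < \<rho>" for x
    by (rule summable_fps) (use that cU in auto)
  have U_mono: "eval_fps U x < eval_fps U y" if "0 \<le> x" "x < y" "y < \<rho>" for x y
    unfolding eval_fps_def
    by (rule suminf_strict_mono[where i = 1]) (use that Un U1 sU in \<open>auto intro!: mult_left_mono power_mono\<close>)
  \<comment> \<open>The formal equation may be evaluated where U takes values in the disc of radius
    \<sigma>, on which \<beta> converges. The auxiliary point \<open>x0\<close> guarantees this, as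
    nonnegative coefficients give |U(z)| <= U(|z|) < U(x0).\<close>
  have fixp: "\<psi> (eval_fps U x) = x" if x0: "x0 < \<rho>" "eval_fps U x0 \<le> \<sigma>" and x: "0 \<le> x" "x < x0" for x x0
  proof -
    let ?B = "complex_fps \<beta>" and ?U = "complex_fps U"
    have cb: "ereal \<sigma> \<le> fps_conv_radius ?B"
    proof -
      have "norm \<sigma> \<le> fps_conv_radius \<beta>"
        using sm unfolding fps_conv_radius_def by (intro conv_radius_geI) auto
      then show ?thesis using \<sigma> by simp
    qed
    have Ub: "norm (eval_fps ?U z) < \<sigma>" if "norm z < x0" for z
    proof -
      have "norm (eval_fps ?U z) \<le> (\<Sum>n. norm (fps_nth ?U n * z ^ n))"
        unfolding eval_fps_def by (intro summable_norm norm_summable_fps) (use that x0 cU in auto)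
      also have "\<dots> = eval_fps U (norm z)" using Un by (simp add: eval_fps_def norm_mult norm_power)
      also have "\<dots> < eval_fps U x0" using that x0 by (intro U_mono) auto
      finally show ?thesis using x0 by simp
    qed
    have posU: "0 < fps_conv_radius ?U" and posB: "0 < fps_conv_radius ?B"
      using cU less_le_trans[OF _ cb, of 0] \<sigma> by simp_all
    have U0': "fps_nth ?U 0 = 0" "fps_nth (?B oo ?U) 0 = 0" using U0 \<beta>0 by auto
    have 1: "(\<lambda>z. z * (exp \<circ> (eval_fps ?B \<circ> eval_fps ?U)) z) has_fps_expansion fps_X * (fps_exp 1 oo (?B oo ?U))"
      by (intro has_fps_expansion_mult has_fps_expansion_fps_X has_fps_expansion_compose has_fps_expansion_exp1
          eval_fps_has_fps_expansion posU posB U0')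
    have 2: "fps_X * (fps_exp 1 oo (?B oo ?U)) = ?U"
      by (subst (2) U) (simp add: complex_fps_mult complex_fps_compose)
    have 3: "(\<lambda>z. z * (exp \<circ> (eval_fps ?B \<circ> eval_fps ?U)) z) holomorphic_on ball 0 x0"
      unfolding o_def
    proof (intro holomorphic_intros)
      show "(\<lambda>z. eval_fps ?B (eval_fps ?U z)) holomorphic_on ball 0 x0"
      proof (rule holomorphic_on_compose_gen[of "eval_fps ?U" _ "eval_fps ?B" "ball 0 \<sigma>", unfolded o_def])
        show "eval_fps ?U holomorphic_on ball 0 x0"
          using x0 cU by (intro holomorphic_on_eval_fps) auto
        show "eval_fps ?B holomorphic_on ball 0 \<sigma>"
          using cb by (intro holomorphic_on_eval_fps) (auto intro!: less_le_trans[OF _ cb[unfolded fps_conv_radius_complex_fps]])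
        show "eval_fps ?U ` ball 0 x0 \<subseteq> ball 0 \<sigma>" using Ub by auto
      qed
    qed
    have "eval_fps ?U (of_real x) = of_real x * exp (eval_fps ?B (eval_fps ?U (of_real x)))"
      using has_fps_expansion_imp_eval_fps_eq[OF 1 _ 3, of "of_real x"] x unfolding 2 by simp
    moreover have eU: "eval_fps ?U (of_real x) = of_real (eval_fps U x)"
      using x x0 by (intro eval_complex_fps sU) auto
    moreover have pos: "0 \<le> eval_fps U x"
      unfolding eval_fps_def using x x0 Un by (intro suminf_nonneg sU) auto
    moreover have "eval_fps U x < \<sigma>" using U_mono[of x x0] x x0 by simp
    then have "eval_fps ?B (of_real (eval_fps U x)) = of_real (eval_fps \<beta> (eval_fps U x))"
      using pos by (intro eval_complex_fps smv) auto
    ultimately have "complex_of_real (eval_fps U x) = of_real (x * exp (eval_fps \<beta> (eval_fps U x)))"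
      by (simp flip: exp_of_real)
    then have "eval_fps U x = x * exp (eval_fps \<beta> (eval_fps U x))" by (simp only: of_real_eq_iff)
    then show ?thesis unfolding \<psi>_def by (metis exp_minus_inverse mult.assoc mult.right_neutral)
  qed
  have \<psi>\<sigma>: "\<psi> \<sigma> = \<rho>" by (simp add: \<psi>_def \<rho>)
  \<comment> \<open>Otherwise U takes the value \<sigma> at some x0 < \<rho>, and letting y increase
    to x0 in \<psi>(U(y)) = y gives x0 = \<psi>(\<sigma>) = \<rho>.\<close>
  have lt: "eval_fps U x < \<sigma>" if x: "0 \<le> x" "x < \<rho>" for x
  proof (rule ccontr)
    assume "\<not> eval_fps U x < \<sigma>"
    moreover have "eval_fps U 0 = 0" by (simp add: eval_fps_at_0 U0)
    moreover have "continuous_on {0..x} (eval_fps U)"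
      by (intro continuous_intros) (use x cU in auto)
    ultimately obtain x0 where x0: "0 \<le> x0" "x0 \<le> x" "eval_fps U x0 = \<sigma>"
      using IVT'[of "eval_fps U" 0 \<sigma> x] x \<sigma> by auto
    have x0': "0 < x0" using x0 \<sigma> \<open>eval_fps U 0 = 0\<close> by (cases "x0 = 0") auto
    have "((\<lambda>y. \<psi> (eval_fps U y)) \<longlongrightarrow> \<psi> (eval_fps U x0)) (at_left x0)"
    proof -
      have *: "continuous_on {0..x0} (eval_fps U)" by (intro continuous_intros) (use x x0 cU in auto)
      have "eval_fps U ` {0..x0} \<subseteq> {0..\<sigma>}"
      proof
        fix u assume "u \<in> eval_fps U ` {0..x0}"
        then obtain y where y: "0 \<le> y" "y \<le> x0" "u = eval_fps U y" by auto
        moreover have "0 \<le> eval_fps U y"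
          unfolding eval_fps_def using x x0 y Un by (intro suminf_nonneg sU) auto
        moreover have "eval_fps U y \<le> \<sigma>" using U_mono[of y x0] y x0 x by (cases "y = x0") auto
        ultimately show "u \<in> {0..\<sigma>}" by simp
      qed
      then have "continuous_on {0..x0} (\<psi> \<circ> eval_fps U)"
        by (intro continuous_on_compose * continuous_on_subset[OF \<psi>_cont])
      from continuous_on_Icc_at_leftD[OF this x0'] show ?thesis by (simp add: o_def)
    qed
    moreover have "\<forall>\<^sub>F y in at_left x0. \<psi> (eval_fps U y) = y"
      using eventually_at_left_real[OF x0'] by eventually_elim (use fixp[of x0] x0 x in auto)
    ultimately have "((\<lambda>y. y) \<longlongrightarrow> \<psi> (eval_fps U x0)) (at_left x0)"
      by (rule Lim_transform_eventually)
    moreover have "((\<lambda>y. y) \<longlongrightarrow> x0) (at_left x0)" by (rule tendsto_ident_at)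
    ultimately have "x0 = \<rho>"
      using tendsto_unique[OF trivial_limit_at_left_real] x0(3) \<psi>\<sigma> by metis
    then show False using x0 x by simp
  qed
  have fixp': "\<psi> (eval_fps U x) = x" if x: "0 \<le> x" "x < \<rho>" for x
    using fixp[of "(x + \<rho>) / 2" x] lt[of "(x + \<rho>) / 2"] x by (simp add: field_simps)
  \<comment> \<open>A finite sum is continuous at \<rho>, so its bound for x < \<rho> extends to the
    boundary; nonnegativity then yields convergence at \<rho>.\<close>
  have part: "(\<Sum>n<N. fps_nth U n * \<rho> ^ n) \<le> \<sigma>" for N
  proof (rule tendsto_upperbound)
    show "((\<lambda>x. \<Sum>n<N. fps_nth U n * x ^ n) \<longlongrightarrow> (\<Sum>n<N. fps_nth U n * \<rho> ^ n)) (at_left \<rho>)"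
      by (intro tendsto_intros)
    show "\<forall>\<^sub>F x in at_left \<rho>. (\<Sum>n<N. fps_nth U n * x ^ n) \<le> \<sigma>"
      using eventually_at_left_real[OF cU(2)]
    proof eventually_elim
      case (elim x)
      have "(\<Sum>n<N. fps_nth U n * x ^ n) \<le> eval_fps U x"
        unfolding eval_fps_def using elim Un by (intro sum_le_suminf sU) auto
      then show ?case using lt[of x] elim by simp
    qed
  qed simp
  have s\<rho>: "summable (\<lambda>n. fps_nth U n * \<rho> ^ n)"
    by (rule summableI_nonneg_bounded[OF _ part]) (use Un cU in auto)
  define L where "L = (\<Sum>n. fps_nth U n * \<rho> ^ n)"
  have L\<sigma>: "L \<le> \<sigma>" unfolding L_def by (rule suminf_le_const[OF s\<rho> part])
  \<comment> \<open>Monotonicity replaces Abel's theorem: every x in (0,\<rho>) is \<psi>(U(x)) with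
    U(x) <= L, hence at most \<psi>(L).\<close>
  have "\<rho> \<le> \<psi> L"
  proof (rule dense_le_bounded[OF cU(2)])
    fix x assume x: "0 < x" "x < \<rho>"
    have "eval_fps U x \<le> L"
      unfolding eval_fps_def L_def using x Un by (intro suminf_le sU s\<rho>) (auto intro!: mult_left_mono power_mono)
    moreover have "0 \<le> eval_fps U x"
      unfolding eval_fps_def using x Un by (intro suminf_nonneg sU) auto
    ultimately have "\<psi> (eval_fps U x) \<le> \<psi> L"
      using \<psi>_mono[of "eval_fps U x" L] L\<sigma> by (cases "eval_fps U x = L") auto
    then show "x \<le> \<psi> L" using fixp'[of x] x by simp
  qed
  moreover have "0 \<le> L" unfolding L_def using Un cU by (intro suminf_nonneg s\<rho>) auto
  ultimately have "L = \<sigma>" using \<psi>_mono[of L \<sigma>] L\<sigma> \<psi>\<sigma> by (cases "L = \<sigma>") auto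
  then show ?thesis using summable_sums[OF s\<rho>] by (simp add: L_def)
qed

section \<open>Coefficients of a function with a singular expansion\<close>

text \<open>The cosine decreases on [0,\<pi>], so the condition on the argument becomes an
  inequality for the real part, which is stable under small displacements.\<close>

lemma in_dented_disk:
  assumes w: "w \<noteq> of_real r" "norm w < s" and \<phi>: "0 < \<phi>" "\<phi> < pi / 2"
    and Re: "Re (w - of_real r) < norm (w - of_real r) * cos \<phi>"
  shows "w \<in> dented_disk r s \<phi>"
proof -
  let ?\<zeta> = "w - of_real r"
  have "Re ?\<zeta> = norm ?\<zeta> * cos \<bar>Arg ?\<zeta>\<bar>"
    using rcis_cmod_Arg[of ?\<zeta>] by (metis Re_rcis cos_abs_real)
  then have "norm ?\<zeta> * cos \<bar>Arg ?\<zeta>\<bar> < norm ?\<zeta> * cos \<phi>" using Re by simp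
  then have "cos \<bar>Arg ?\<zeta>\<bar> < cos \<phi>" using w by simp
  moreover have "cos \<phi> \<le> cos \<bar>Arg ?\<zeta>\<bar>" if "\<bar>Arg ?\<zeta>\<bar> \<le> \<phi>"
    using that \<phi> pi_gt_zero by (intro cos_monotone_0_pi_le) auto
  ultimately have "\<phi> < \<bar>Arg ?\<zeta>\<bar>" by force
  then show ?thesis using w by (simp add: dented_disk_def)
qed

text \<open>Cauchy's estimate on a disc around z whose radius is a fixed fraction of the distance d
  from z to \<rho>: there E is O(d^3), and five derivatives cost d^5. Such discs leave the disc of
  convergence, which is why the dented disk is needed.\<close>

lemma singular_remainder_derivative_bound:
  fixes E :: "complex \<Rightarrow> complex"
  assumes \<rho>: "0 < \<rho>" "\<rho> < s" and \<phi>: "0 < \<phi>" "\<phi> < pi / 2"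
    and E: "E holomorphic_on dented_disk \<rho> s \<phi>"
    and O: "E \<in> O[at (of_real \<rho>) within dented_disk \<rho> s \<phi>](\<lambda>z. (z - of_real \<rho>) ^ 3)"
  obtains K where "\<And>z. norm z < \<rho> \<Longrightarrow> norm ((deriv ^^ 5) E z) \<le> K / norm (of_real \<rho> - z) ^ 2"
    and "\<And>z. norm z < \<rho> \<Longrightarrow> norm (E z) \<le> K * norm (of_real \<rho> - z) ^ 3"
proof -
  let ?D = "dented_disk \<rho> s \<phi>"
  define \<kappa> where "\<kappa> = cos \<phi>"
  have \<kappa>: "0 < \<kappa>" "\<kappa> \<le> 1" using \<phi> by (auto simp: \<kappa>_def cos_gt_zero)
  \<comment> \<open>Points within c d of z, where d <= 2\<rho>, must stay in the region: c <=
    \<kappa>/4 controls the angle at \<rho>, and c\<rho> <= (s - \<rho>)/4 keeps the modulus below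
    the midpoint of \<rho> and s.\<close>
  define c where "c = min (\<kappa> / 4) ((s - \<rho>) / (4 * \<rho>))"
  have c: "0 < c" "c \<le> \<kappa> / 4" "c \<le> 1 / 4" "c * \<rho> \<le> (s - \<rho>) / 4"
  proof -
    show "0 < c" "c \<le> \<kappa> / 4" using \<kappa> \<rho> by (auto simp: c_def)
    then show "c \<le> 1 / 4" using \<kappa> by simp
    have "c * \<rho> \<le> (s - \<rho>) / (4 * \<rho>) * \<rho>" using \<rho> by (intro mult_right_mono) (auto simp: c_def)
    then show "c * \<rho> \<le> (s - \<rho>) / 4" using \<rho> by simp
  qed
  \<comment> \<open>A closed region that touches the boundary of the dented disk at \<rho> only: the
    cosine bound is halved and the radius is reduced. Outside a ball around \<rho> it is compact,
    which extends the local O-estimate to all of it.\<close>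
  define S where "S = {w. norm w \<le> (\<rho> + s) / 2 \<and> Re (w - of_real \<rho>) \<le> \<kappa> / 2 * norm (w - of_real \<rho>)}"
  have SD: "w \<in> ?D" if "w \<in> S" "w \<noteq> of_real \<rho>" for w
  proof (rule in_dented_disk)
    have "\<kappa> / 2 * norm (w - of_real \<rho>) < norm (w - of_real \<rho>) * \<kappa>"
      using that \<kappa> by simp
    moreover have "Re (w - of_real \<rho>) \<le> \<kappa> / 2 * norm (w - of_real \<rho>)" using that by (simp add: S_def)
    ultimately show "Re (w - of_real \<rho>) < norm (w - of_real \<rho>) * cos \<phi>" unfolding \<kappa>_def by linarith
  qed (use that \<rho> \<phi> in \<open>auto simp: S_def\<close>)
  have clS: "closed S"
    unfolding S_def by (intro closed_Collect_conj closed_Collect_le continuous_intros)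
  obtain K1 \<delta> where K1: "0 < \<delta>" "\<And>w. w \<in> ?D \<Longrightarrow> dist w (of_real \<rho>) < \<delta> \<Longrightarrow> norm (E w) \<le> K1 * norm (w - of_real \<rho>) ^ 3"
  proof -
    obtain K1 where "\<forall>\<^sub>F w in at (of_real \<rho>) within ?D. norm (E w) \<le> K1 * norm ((w - of_real \<rho>) ^ 3)"
      using landau_o.bigE[OF O] by blast
    then obtain \<delta> where "0 < \<delta>" "\<And>w. w \<in> ?D \<Longrightarrow> w \<noteq> of_real \<rho> \<Longrightarrow> dist w (of_real \<rho>) < \<delta> \<Longrightarrow> norm (E w) \<le> K1 * norm ((w - of_real \<rho>) ^ 3)"
      unfolding eventually_at by blast
    then show thesis by (intro that[of \<delta> K1]) (auto simp: dented_disk_def norm_power)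
  qed
  have "compact (S - ball (of_real \<rho>) \<delta>)"
  proof -
    have "bounded (S - ball (of_real \<rho>) \<delta>)"
      by (rule bounded_subset[of "cball 0 ((\<rho> + s) / 2)"]) (auto simp: S_def)
    then show ?thesis using clS by (simp add: compact_eq_bounded_closed closed_Diff)
  qed
  moreover have "continuous_on (S - ball (of_real \<rho>) \<delta>) E"
  proof (rule continuous_on_subset[OF holomorphic_on_imp_continuous_on[OF E]])
    show "S - ball (of_real \<rho>) \<delta> \<subseteq> ?D"
    proof
      fix x assume x: "x \<in> S - ball (of_real \<rho>) \<delta>"
      then have "x \<noteq> of_real \<rho>" using K1(1) by auto
      with x show "x \<in> ?D" by (intro SD) auto
    qed
  qed
  ultimately have "bounded (E ` (S - ball (of_real \<rho>) \<delta>))"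
    using compact_continuous_image compact_imp_bounded by blast
  then obtain K2 where K2: "\<And>w. w \<in> S - ball (of_real \<rho>) \<delta> \<Longrightarrow> norm (E w) \<le> K2"
    unfolding bounded_iff by blast
  define K where "K = 1 + \<bar>K1\<bar> + \<bar>K2\<bar> / \<delta> ^ 3"
  have K: "0 < K" using K1(1) by (simp add: K_def add_pos_nonneg)
  have EK: "norm (E w) \<le> K * norm (w - of_real \<rho>) ^ 3" if w: "w \<in> S" "w \<noteq> of_real \<rho>" for w
  proof (cases "dist w (of_real \<rho>) < \<delta>")
    case True
    have "norm (E w) \<le> K1 * norm (w - of_real \<rho>) ^ 3" by (rule K1(2)[OF SD[OF w] True])
    also have "\<dots> \<le> K * norm (w - of_real \<rho>) ^ 3"
    proof (rule mult_right_mono)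
      have "0 \<le> \<bar>K2\<bar> / \<delta> ^ 3" using K1(1) by simp
      then show "K1 \<le> K" unfolding K_def by linarith
    qed simp
    finally show ?thesis .
  next
    case False
    have "norm (E w) \<le> \<bar>K2\<bar>" using K2[of w] w False by (force simp: dist_commute)
    also have "\<dots> = \<bar>K2\<bar> / \<delta> ^ 3 * \<delta> ^ 3" using K1(1) by simp
    also have "\<dots> \<le> K * norm (w - of_real \<rho>) ^ 3"
      using K1(1) False by (intro mult_mono power_mono) (auto simp: K_def dist_norm)
    finally show ?thesis .
  qed
  have cb: "w \<in> S \<and> w \<noteq> of_real \<rho> \<and> norm (w - of_real \<rho>) \<le> 2 * norm (of_real \<rho> - z)"
    if z: "norm z < \<rho>" and w: "w \<in> cball z (c * norm (of_real \<rho> - z))" for z w :: complex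
  proof -
    define d where "d = norm (of_real \<rho> - z)"
    have d: "0 < d" "d \<le> 2 * \<rho>"
      using z \<rho> norm_triangle_ineq4[of "of_real \<rho>" z] by (auto simp: d_def)
    have wz: "norm (w - z) \<le> c * d" using w by (simp add: d_def dist_norm norm_minus_commute)
    have cd: "c * d \<le> d / 4" using c d by simp
    have "c * d \<le> c * (2 * \<rho>)" using c d by (intro mult_left_mono) auto
    then have "norm w \<le> (\<rho> + s) / 2"
      using norm_triangle_ineq[of "w - z" z] wz z c(4) by simp
    moreover have dw: "d - c * d \<le> norm (w - of_real \<rho>)" "norm (w - of_real \<rho>) \<le> d + c * d"
      using wz norm_triangle_ineq[of "w - z" "z - of_real \<rho>"] norm_triangle_ineq[of "z - w" "w - of_real \<rho>"]
      by (simp_all add: d_def norm_minus_commute)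
    moreover have dd: "d / 2 \<le> norm (w - of_real \<rho>)" "norm (w - of_real \<rho>) \<le> 2 * d"
      using dw cd d by linarith+
    moreover have "Re (w - of_real \<rho>) \<le> \<kappa> / 2 * norm (w - of_real \<rho>)"
    proof -
      have "Re z < \<rho>" using complex_Re_le_cmod[of z] z by simp
      then have "Re (w - of_real \<rho>) \<le> c * d" using complex_Re_le_cmod[of "w - z"] wz by simp
      also have "\<dots> \<le> \<kappa> / 4 * d" using c d by (intro mult_right_mono) auto
      also have "\<dots> = \<kappa> / 2 * (d / 2)" by simp
      also have "\<dots> \<le> \<kappa> / 2 * norm (w - of_real \<rho>)"
        using dd \<kappa> by (intro mult_left_mono) auto
      finally show ?thesis .
    qed
    moreover have "w \<noteq> of_real \<rho>" using dd d by auto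
    ultimately show ?thesis by (simp add: S_def d_def)
  qed
  \<comment> \<open>The 8 is 2^3, as |w - \<rho>| <= 2d on the disc; the added 1 makes the bound
    strict, as the open ball in Cauchy's estimate requires.\<close>
  let ?K = "K + fact 5 * (8 * K + 1) / c ^ 5"
  show thesis
  proof (rule that[of ?K])
    fix z :: complex assume z: "norm z < \<rho>"
    define d where "d = norm (of_real \<rho> - z)"
    have d: "0 < d" using z \<rho> by (auto simp: d_def)
    have "z \<in> cball z (c * norm (of_real \<rho> - z))" using c by simp
    from cb[OF z this] have "norm (E z) \<le> K * d ^ 3" using EK by (simp add: d_def norm_minus_commute)
    also have "\<dots> \<le> ?K * d ^ 3"
      using K c d by (intro mult_right_mono) auto
    finally show "norm (E z) \<le> ?K * norm (of_real \<rho> - z) ^ 3"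
      by (simp add: d_def)
    have sub: "cball z (c * d) \<subseteq> ?D" using cb[OF z] SD by (auto simp: d_def)
    have hE: "E holomorphic_on cball z (c * d)" by (rule holomorphic_on_subset[OF E sub])
    have "norm ((deriv ^^ 5) E z) \<le> fact 5 * ((8 * K + 1) * d ^ 3) / (c * d) ^ 5"
    proof (rule Cauchy_higher_deriv_bound[where y = 0])
      show "E holomorphic_on ball z (c * d)" by (rule holomorphic_on_subset[OF hE]) auto
      show "continuous_on (cball z (c * d)) E" by (rule holomorphic_on_imp_continuous_on[OF hE])
      fix w assume "w \<in> ball z (c * d)"
      then have w: "w \<in> cball z (c * norm (of_real \<rho> - z))" by (simp add: d_def)
      have "norm (E w) \<le> K * norm (w - of_real \<rho>) ^ 3" using cb[OF z w] EK by blast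
      also have "\<dots> \<le> K * (2 * d) ^ 3"
        using cb[OF z w] K by (intro mult_left_mono power_mono) (auto simp: d_def)
      also have "\<dots> < (8 * K + 1) * d ^ 3" using d by (simp add: power_mult_distrib algebra_simps)
      finally show "E w \<in> ball 0 ((8 * K + 1) * d ^ 3)" by simp
    qed (use c d in auto)
    also have "\<dots> = fact 5 * (8 * K + 1) / c ^ 5 / d ^ 2"
      using c d by (simp add: power_mult_distrib divide_simps)
    also have "\<dots> \<le> ?K / d ^ 2"
      using K by (intro divide_right_mono) auto
    finally show "norm ((deriv ^^ 5) E z) \<le> ?K / norm (of_real \<rho> - z) ^ 2"
      by (simp add: d_def)
  qed
qed

section \<open>Coefficients of a function bounded by a double pole\<close>

text \<open>On the unit circle the conjugate of 1 - q u is (u - q)/u, so the integral is Cauchy's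
  formula for 1/(1 - q u) at the point q.\<close>

lemma poisson_integral:
  fixes q :: real
  assumes "0 \<le> q" "q < 1"
  shows "((\<lambda>t. 1 / norm (1 - of_real q * cis t) ^ 2) has_integral (2 * pi / (1 - q\<^sup>2))) {0..2 * pi}"
proof -
  have nz: "1 - of_real q * w \<noteq> 0" if "norm w \<le> 1" for w :: complex
  proof
    assume "1 - of_real q * w = 0"
    then have "norm (of_real q * w) = 1" by (metis eq_iff_diff_eq_0 norm_one)
    moreover have "q * norm w \<le> q * 1" using that assms by (intro mult_left_mono) auto
    ultimately show False using assms by (simp add: norm_mult)
  qed
  have "((\<lambda>u. (1 / (1 - of_real q * u)) / (u - of_real q)) has_contour_integral
      (2 * of_real pi * \<i> * (1 / (1 - of_real q * of_real q)))) (circlepath 0 1)"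
  proof (rule Cauchy_integral_circlepath)
    show "continuous_on (cball 0 1) (\<lambda>u. 1 / (1 - complex_of_real q * u))"
      by (intro continuous_intros) (use nz in auto)
    show "(\<lambda>u. 1 / (1 - complex_of_real q * u)) holomorphic_on ball 0 1"
      by (intro holomorphic_intros) (use nz in auto)
  qed (use assms in auto)
  then have "((\<lambda>t. (1 / (1 - of_real q * cis t)) / (cis t - of_real q) * \<i> * cis t) has_integral
      (2 * of_real pi * \<i> * (1 / (1 - of_real q * of_real q)))) {0..2 * pi}"
    unfolding circlepath_def by (subst (asm) has_contour_integral_part_circlepath_iff) auto
  from has_integral_mult_left[OF this, of "- \<i>"]
  have 1: "((\<lambda>t. (1 / (1 - of_real q * cis t)) / (cis t - of_real q) * \<i> * cis t * - \<i>) has_integral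
      (2 * of_real pi * \<i> * (1 / (1 - of_real q * of_real q)) * - \<i>)) {0..2 * pi}" .
  have 2: "(1 / (1 - of_real q * cis t)) / (cis t - of_real q) * \<i> * cis t * - \<i>
      = of_real (1 / norm (1 - of_real q * cis t) ^ 2)" for t
  proof -
    have *: "1 / w / (c * v) * \<i> * c * - \<i> = 1 / (w * v)" if "c \<noteq> 0" for w v c :: complex
      using that by (cases "w = 0 \<or> v = 0") (auto simp: field_simps)
    have "cis t - of_real q = cis t * cnj (1 - of_real q * cis t)"
      by (simp add: algebra_simps cis_mult cis_cnj)
    then have "(1 / (1 - of_real q * cis t)) / (cis t - of_real q) * \<i> * cis t * - \<i>
      = 1 / ((1 - of_real q * cis t) * cnj (1 - of_real q * cis t))"
      using *[of "cis t"] by simp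
    also have "\<dots> = of_real (1 / norm (1 - of_real q * cis t) ^ 2)"
      using complex_norm_square[of "1 - of_real q * cis t"] by simp
    finally show ?thesis .
  qed
  have 3: "2 * of_real pi * \<i> * (1 / (1 - of_real q * of_real q)) * - \<i> = complex_of_real (2 * pi / (1 - q\<^sup>2))"
    by (simp add: power2_eq_square mult.assoc[of _ \<i> \<i>])
  from has_integral_Re[OF 1[unfolded 2 3]] show ?thesis by simp
qed

text \<open>Cauchy's formula on the radius \<rho>q, with the Poisson integral in place of the
  maximum of the bound: the maximum would give the square of m + 2, the mean gives m + 2.\<close>

lemma coefficient_bound_double_pole:
  fixes f :: "complex \<Rightarrow> complex"
  assumes \<rho>: "0 < \<rho>" and f: "f holomorphic_on ball 0 \<rho>"
    and K: "\<And>z. norm z < \<rho> \<Longrightarrow> norm (f z) \<le> K / norm (of_real \<rho> - z) ^ 2"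
  shows "norm ((deriv ^^ m) f 0 / fact m) * \<rho> ^ m \<le> exp 1 * K / \<rho>\<^sup>2 * (real m + 2)"
proof -
  let ?N = "norm ((deriv ^^ m) f 0 / fact m)"
  have K0: "0 \<le> K"
    using order_trans[OF norm_ge_zero K[of 0]] \<rho> by (simp add: zero_le_divide_iff)
  \<comment> \<open>With m + 2 instead of m + 1 the radius is positive also for m = 0; still q^(-m)
    = (1 + 1/(m+1))^m stays below e.\<close>
  define q where "q = 1 - 1 / (real m + 2)"
  have q: "0 < q" "q < 1" by (auto simp: q_def field_simps)
  define r where "r = \<rho> * q"
  have r: "0 < r" "r < \<rho>" using q \<rho> by (auto simp: r_def)
  have circ: "((\<lambda>u. f u / (u - 0) ^ Suc m) has_contour_integral (2 * pi * \<i> / fact m * (deriv ^^ m) f 0)) (circlepath 0 r)"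
  proof (rule Cauchy_has_contour_integral_higher_derivative_circlepath)
    show "continuous_on (cball 0 r) f"
      by (rule continuous_on_subset[OF holomorphic_on_imp_continuous_on[OF f]]) (use r in auto)
    show "f holomorphic_on ball 0 r" by (rule holomorphic_on_subset[OF f]) (use r in auto)
  qed (use r in auto)
  let ?f = "\<lambda>t. f (of_real r * cis t) / (of_real r * cis t) ^ Suc m * r * \<i> * cis t" and ?K = "K / \<rho>\<^sup>2 / r ^ m"
  have 1: "(?f has_integral
     (2 * pi * \<i> / fact m * (deriv ^^ m) f 0)) {0..2 * pi}"
    using circ unfolding circlepath_def by (subst (asm) has_contour_integral_part_circlepath_iff) auto
  have "((\<lambda>t. ?K * (1 / norm (1 - of_real q * cis t) ^ 2)) has_integral
      ?K * (2 * pi / (1 - q\<^sup>2))) {0..2 * pi}"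
    using q by (intro has_integral_mult_right poisson_integral) auto
  moreover have "norm (?f t)
      \<le> ?K * (1 / norm (1 - of_real q * cis t) ^ 2)" for t
  proof -
    have "norm (f (of_real r * cis t)) \<le> K / norm (of_real \<rho> - of_real r * cis t) ^ 2"
      using r by (intro K) (simp add: norm_mult)
    also have "of_real \<rho> - of_real r * cis t = of_real \<rho> * (1 - of_real q * cis t)"
      by (simp add: r_def algebra_simps)
    also have "norm \<dots> ^ 2 = \<rho>\<^sup>2 * norm (1 - of_real q * cis t) ^ 2"
      using \<rho> by (simp add: norm_mult power_mult_distrib)
    finally have *: "norm (f (of_real r * cis t)) \<le> K / (\<rho>\<^sup>2 * norm (1 - of_real q * cis t) ^ 2)" .
    have "norm (?f t) = norm (f (of_real r * cis t)) / r ^ m"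
      using r by (simp add: norm_mult norm_divide norm_power)
    also have "\<dots> \<le> K / (\<rho>\<^sup>2 * norm (1 - of_real q * cis t) ^ 2) / r ^ m"
      using * r by (intro divide_right_mono) auto
    also have "\<dots> = ?K * (1 / norm (1 - of_real q * cis t) ^ 2)" by simp
    finally show ?thesis .
  qed
  ultimately have 2: "norm (2 * pi * \<i> / fact m * (deriv ^^ m) f 0) \<le> ?K * (2 * pi / (1 - q\<^sup>2))"
    using has_integral_norm_bound_integral_component[OF 1, where k = "1::real"] by simp
  have "?N * r ^ m \<le> K / \<rho>\<^sup>2 * (1 / (1 - q\<^sup>2))"
  proof -
    have "2 * pi * ?N \<le> 2 * pi * (K / \<rho>\<^sup>2 * (1 / (1 - q\<^sup>2)) / r ^ m)"
      using 2 by (simp add: norm_mult norm_divide mult_ac)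
    then have "?N \<le> K / \<rho>\<^sup>2 * (1 / (1 - q\<^sup>2)) / r ^ m" by (rule mult_left_le_imp_le) simp
    then have "?N * r ^ m \<le> K / \<rho>\<^sup>2 * (1 / (1 - q\<^sup>2))"
      using r by (subst (asm) pos_le_divide_eq) auto
    then show ?thesis .
  qed
  also have "\<dots> \<le> K / \<rho>\<^sup>2 * (real m + 2)"
  proof (rule mult_left_mono)
    have "1 / (real m + 2) = 1 - q" by (simp add: q_def)
    also have "\<dots> \<le> 1 - q\<^sup>2" using q by (simp add: power2_eq_square mult_left_le)
    finally have le: "1 / (real m + 2) \<le> 1 - q\<^sup>2" .
    have "0 < 1 - q\<^sup>2" by (rule less_le_trans[OF _ le]) simp
    then have "1 / (1 - q\<^sup>2) \<le> 1 / (1 / (real m + 2))"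
      by (intro divide_left_mono[OF le]) (auto intro!: divide_pos_pos)
    then show "1 / (1 - q\<^sup>2) \<le> real m + 2" by simp
  qed (use K0 in simp)
  finally have 4: "?N * r ^ m \<le> K / \<rho>\<^sup>2 * (real m + 2)" .
  have "1 \<le> exp 1 * q ^ m"
  proof -
    have "1 / q = 1 + 1 / (real m + 1)" by (simp add: q_def field_simps)
    also have "\<dots> \<le> exp (1 / (real m + 1))" by (rule exp_ge_add_one_self)
    finally have "(1 / q) ^ m \<le> exp (1 / (real m + 1)) ^ m" using q by (intro power_mono) auto
    also have "\<dots> = exp (real m / (real m + 1))" by (simp flip: exp_of_nat_mult)
    also have "\<dots> \<le> exp 1" by simp
    finally show ?thesis using q by (simp add: power_divide field_simps)
  qed
  then have "?N * \<rho> ^ m * 1 \<le> ?N * \<rho> ^ m * (exp 1 * q ^ m)"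
    using \<rho> by (intro mult_left_mono) auto
  also have "\<dots> = exp 1 * (?N * r ^ m)"
    by (simp add: r_def power_mult_distrib mult_ac)
  also have "\<dots> \<le> exp 1 * (K / \<rho>\<^sup>2 * (real m + 2))" using 4 by (intro mult_left_mono) auto
  finally show ?thesis by simp
qed

section \<open>The second factorial moment from an expansion at the boundary\<close>

text \<open>The polynomial ((1 - \<epsilon>)^n - 1 + n\<epsilon>)/\<epsilon>^2, given by a recursion
  free of division, so that bounds and limit follow by induction.\<close>

fun second_quotient :: "nat \<Rightarrow> real \<Rightarrow> real" where
  "second_quotient 0 \<epsilon> = 0"
| "second_quotient (Suc n) \<epsilon> = (1 - \<epsilon>) * second_quotient n \<epsilon> + real n"

text \<open>By Tannery's theorem the second factorial moment of a sequence \<open>a\<close> is read off the expansion of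
  \<open>\<Sum> a\<^sub>n (1 - \<epsilon>)\<^sup>n\<close> at \<open>\<epsilon> = 0\<close>, without differentiating it.\<close>

lemma second_quotient_eq: "(1 - \<epsilon>) ^ n - 1 + real n * \<epsilon> = second_quotient n \<epsilon> * \<epsilon>\<^sup>2"
proof (induction n)
  case (Suc n)
  have "(1 - \<epsilon>) ^ Suc n - 1 + real (Suc n) * \<epsilon> = (1 - \<epsilon>) * ((1 - \<epsilon>) ^ n - 1 + real n * \<epsilon>) + real n * \<epsilon>\<^sup>2"
    by (simp add: algebra_simps power2_eq_square)
  then show ?case unfolding Suc by (simp add: algebra_simps)
qed simp

lemma second_quotient_bounds:
  assumes "0 \<le> \<epsilon>" "\<epsilon> \<le> 1"
  shows "0 \<le> second_quotient n \<epsilon> \<and> second_quotient n \<epsilon> \<le> (real n)\<^sup>2"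
proof (induction n)
  case (Suc n)
  define p where "p = (1 - \<epsilon>) * second_quotient n \<epsilon>"
  have "0 \<le> p" unfolding p_def using Suc assms by simp
  moreover have "p \<le> 1 * second_quotient n \<epsilon>"
    unfolding p_def by (rule mult_right_mono) (use Suc assms in auto)
  moreover have "(real (Suc n))\<^sup>2 = (real n)\<^sup>2 + 2 * real n + 1"
    by (simp add: power2_eq_square algebra_simps)
  moreover have "second_quotient (Suc n) \<epsilon> = p + real n" by (simp add: p_def)
  ultimately show ?case using Suc by linarith
qed simp

lemma second_quotient_limit: "(second_quotient n \<longlongrightarrow> real n * (real n - 1) / 2) (at_right 0)"
proof (induction n)
  case (Suc n)
  have "((\<lambda>\<epsilon>. (1 - \<epsilon>) * second_quotient n \<epsilon> + real n) \<longlongrightarrow> (1 - 0) * (real n * (real n - 1) / 2) + real n) (at_right 0)"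
    by (intro tendsto_intros Suc)
  then show ?case by (simp add: field_simps)
qed simp

text \<open>Multiplying the hypothesis by \<epsilon>^2, \<epsilon> and 1 in turn isolates d0, d1 and
  d2.\<close>

lemma quadratic_expansion_unique:
  fixes d0 d1 d2 :: real
  assumes "((\<lambda>\<epsilon>. (d0 + d1 * \<epsilon> + d2 * \<epsilon>\<^sup>2) / \<epsilon>\<^sup>2) \<longlongrightarrow> 0) (at_right 0)"
  shows "d2 = 0"
proof -
  have id: "((\<lambda>\<epsilon>::real. \<epsilon>) \<longlongrightarrow> 0) (at_right 0)" by (rule tendsto_ident_at)
  have uniq: "x = y" if "(f \<longlongrightarrow> x) (at_right 0)" "(g \<longlongrightarrow> y) (at_right 0)" "\<And>\<epsilon>::real. 0 < \<epsilon> \<Longrightarrow> f \<epsilon> = g \<epsilon>" for f g and x y :: real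
  proof -
    have "\<forall>\<^sub>F \<epsilon> in at_right 0. f \<epsilon> = g \<epsilon>"
      using eventually_at_right_less[of "0::real"] by eventually_elim (rule that(3))
    with that show ?thesis
      using tendsto_unique[OF trivial_limit_at_right_real] Lim_transform_eventually by blast
  qed
  have "0 * 0\<^sup>2 = d0 + d1 * 0 + d2 * 0\<^sup>2"
  proof (rule uniq[OF tendsto_mult[OF assms tendsto_power[OF id]]])
    show "((\<lambda>\<epsilon>. d0 + d1 * \<epsilon> + d2 * \<epsilon>\<^sup>2) \<longlongrightarrow> d0 + d1 * 0 + d2 * 0\<^sup>2) (at_right 0)"
      by (intro tendsto_intros id)
  qed simp
  then have d0: "d0 = 0" by simp
  have "0 * 0 = d1 + d2 * 0"
  proof (rule uniq[OF tendsto_mult[OF assms id]])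
    show "((\<lambda>\<epsilon>. d1 + d2 * \<epsilon>) \<longlongrightarrow> d1 + d2 * 0) (at_right 0)" by (intro tendsto_intros id)
  qed (simp add: d0 power2_eq_square field_simps)
  then have d1: "d1 = 0" by simp
  have "0 = d2" by (rule uniq[OF assms tendsto_const]) (simp add: d0 d1)
  then show ?thesis ..
qed

text \<open>The second quotients, dominated by n^2 \<open>a n\<close>, give an expansion whose
  quadratic coefficient is half the factorial moment. Comparison with \<open>ex\<close> identifies
  it; c0 and c1 need not be known beforehand.\<close>

lemma second_factorial_moment_eq:
  fixes a :: "nat \<Rightarrow> real"
  assumes a: "\<And>n. 0 \<le> a n" and sm: "summable (\<lambda>n. (real n)\<^sup>2 * a n)"
    and ex: "((\<lambda>\<epsilon>. ((\<Sum>n. a n * (1 - \<epsilon>) ^ n) - (c0 + c1 * \<epsilon> + c2 * \<epsilon>\<^sup>2)) / \<epsilon>\<^sup>2) \<longlongrightarrow> 0) (at_right 0)"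
  shows "(\<Sum>n. real n * (real n - 1) * a n) = 2 * c2"
proof -
  let ?A0 = "\<Sum>n. a n" and ?A1 = "\<Sum>n. real n * a n" and ?A2 = "\<Sum>n. a n * (real n * (real n - 1) / 2)"
  let ?f = "\<lambda>\<epsilon>. \<Sum>n. a n * (1 - \<epsilon>) ^ n"
  have sm0: "summable (\<lambda>n. a n)"
  proof (rule summable_comparison_test'[OF sm, of 1])
    fix n :: nat assume "1 \<le> n"
    then have "1 * a n \<le> (real n)\<^sup>2 * a n" using a by (intro mult_right_mono) auto
    then show "norm (a n) \<le> (real n)\<^sup>2 * a n" using a by simp
  qed
  have sm1: "summable (\<lambda>n. real n * a n)"
  proof (rule summable_comparison_test'[OF sm, of 1])
    fix n :: nat assume n: "1 \<le> n"
    then have "real n * 1 \<le> real n * real n" by (intro mult_left_mono) auto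
    then have "real n * a n \<le> (real n)\<^sup>2 * a n" using a by (intro mult_right_mono) (auto simp: power2_eq_square)
    then show "norm (real n * a n) \<le> (real n)\<^sup>2 * a n" using a by simp
  qed
  have "((\<lambda>\<epsilon>. \<Sum>n. a n * second_quotient n \<epsilon>) \<longlongrightarrow> ?A2) (at_right 0)"
  proof (rule conjunct2[OF conjunct2[OF tannerys_theorem[where M = "\<lambda>n. (real n)\<^sup>2 * a n"]]])
    show "((\<lambda>\<epsilon>. a n * second_quotient n \<epsilon>) \<longlongrightarrow> a n * (real n * (real n - 1) / 2)) (at_right 0)" for n
      by (intro tendsto_intros second_quotient_limit)
    have *: "norm (a n * second_quotient n \<epsilon>) \<le> (real n)\<^sup>2 * a n" if "\<epsilon> \<in> {0<..<1}" for n \<epsilon>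
    proof -
      have "0 \<le> second_quotient n \<epsilon> \<and> second_quotient n \<epsilon> \<le> (real n)\<^sup>2"
        using that by (intro second_quotient_bounds) auto
      then show ?thesis
        using a mult_left_mono[of "second_quotient n \<epsilon>" "(real n)\<^sup>2" "a n"] by (simp add: abs_mult mult_ac)
    qed
    show "\<forall>\<^sub>F (n, \<epsilon>) in at_top \<times>\<^sub>F at_right 0. norm (a n * second_quotient n \<epsilon>) \<le> (real n)\<^sup>2 * a n"
      unfolding eventually_prod_filter
      using eventually_at_right_real[OF zero_less_one] *
      by (intro exI[of _ "\<lambda>_. True"] exI[of _ "\<lambda>\<epsilon>. \<epsilon> \<in> {0<..<1}"]) auto
  qed (use sm in auto)
  moreover have "\<forall>\<^sub>F \<epsilon> in at_right 0. (\<Sum>n. a n * second_quotient n \<epsilon>)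
      = (?f \<epsilon> - ?A0 + ?A1 * \<epsilon>) / \<epsilon>\<^sup>2"
    using eventually_at_right_real[OF zero_less_one]
  proof eventually_elim
    fix \<epsilon> :: real assume e: "\<epsilon> \<in> {0<..<1}"
    have sq: "summable (\<lambda>n. a n * (1 - \<epsilon>) ^ n)"
      by (rule summable_comparison_test'[OF sm0, of 0])
        (use a e in \<open>auto simp: abs_mult power_abs intro!: mult_left_le power_le_one\<close>)
    have "(\<lambda>n. (a n * (1 - \<epsilon>) ^ n - a n + real n * a n * \<epsilon>) / \<epsilon>\<^sup>2) sums
      ((?f \<epsilon> - ?A0 + ?A1 * \<epsilon>) / \<epsilon>\<^sup>2)"
      by (intro sums_divide sums_add sums_diff sums_mult2 summable_sums sq sm0 sm1)
    moreover have "(a n * (1 - \<epsilon>) ^ n - a n + real n * a n * \<epsilon>) / \<epsilon>\<^sup>2 = a n * second_quotient n \<epsilon>" for n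
    proof -
      have "a n * (1 - \<epsilon>) ^ n - a n + real n * a n * \<epsilon> = a n * ((1 - \<epsilon>) ^ n - 1 + real n * \<epsilon>)"
        by (simp add: algebra_simps)
      then show ?thesis using e by (simp add: second_quotient_eq)
    qed
    ultimately show "(\<Sum>n. a n * second_quotient n \<epsilon>)
      = (?f \<epsilon> - ?A0 + ?A1 * \<epsilon>) / \<epsilon>\<^sup>2"
      by (simp add: sums_iff)
  qed
  ultimately have lim: "((\<lambda>\<epsilon>. (?f \<epsilon> - ?A0 + ?A1 * \<epsilon>) / \<epsilon>\<^sup>2)
     \<longlongrightarrow> ?A2) (at_right 0)"
    by (rule Lim_transform_eventually)
  define g where "g \<epsilon> = (?f \<epsilon> - ?A0 + ?A1 * \<epsilon>) / \<epsilon>\<^sup>2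
      - (?f \<epsilon> - (c0 + c1 * \<epsilon> + c2 * \<epsilon>\<^sup>2)) / \<epsilon>\<^sup>2 - ?A2" for \<epsilon>
  have "(g \<longlongrightarrow> ?A2 - 0 - ?A2) (at_right 0)"
    unfolding g_def by (intro tendsto_diff tendsto_const lim ex)
  then have "(g \<longlongrightarrow> 0) (at_right 0)" by simp
  moreover have "\<forall>\<^sub>F \<epsilon> in at_right 0. g \<epsilon>
      = ((c0 - ?A0) + (c1 + ?A1) * \<epsilon> + (c2 - ?A2) * \<epsilon>\<^sup>2) / \<epsilon>\<^sup>2"
    using eventually_at_right_less[of "0::real"] unfolding g_def by eventually_elim (simp add: field_simps)
  ultimately have "((\<lambda>\<epsilon>. ((c0 - ?A0) + (c1 + ?A1) * \<epsilon> + (c2 - ?A2) * \<epsilon>\<^sup>2) / \<epsilon>\<^sup>2) \<longlongrightarrow> 0) (at_right 0)"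
    by (rule Lim_transform_eventually)
  then have "?A2 = c2" using quadratic_expansion_unique by fastforce
  moreover have "2 * ?A2 = (\<Sum>n. real n * (real n - 1) * a n)"
  proof -
    have "summable (\<lambda>n. (real n)\<^sup>2 * a n - real n * a n)" by (intro summable_diff sm sm1)
    then have "summable (\<lambda>n. real n * (real n - 1) * a n)"
      by (simp add: power2_eq_square algebra_simps)
    from suminf_divide[OF this, of 2] show ?thesis by (simp add: mult_ac)
  qed
  ultimately show ?thesis by simp
qed

section \<open>The binomial singularity and the expansion of C\<close>

lemma csqrt_power_5: "w \<noteq> 0 \<Longrightarrow> csqrt w ^ 5 = w powr (5/2)"
proof -
  assume w: "w \<noteq> 0"
  have "csqrt w = exp (Ln w / 2)" using w by (rule csqrt_exp_Ln)
  then have "csqrt w ^ 5 = exp (of_nat 5 * (Ln w / 2))" by (metis exp_of_nat_mult)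
  then show ?thesis using w by (simp add: powr_def)
qed

lemma binomial_singularity_sums:
  fixes z :: complex
  assumes "norm z < \<rho>"
  shows "(\<lambda>n. ((5/2) gchoose n) * (- 1 / of_real \<rho>) ^ n * z ^ n) sums csqrt (1 - z / of_real \<rho>) ^ 5"
proof -
  have \<rho>: "0 < \<rho>" using assms norm_ge_zero[of z] by linarith
  have n: "norm (- z / of_real \<rho>) < 1" using assms \<rho> by (simp add: norm_divide)
  then have "1 - z / of_real \<rho> \<noteq> 0" by (auto simp: norm_divide)
  then have "csqrt (1 - z / of_real \<rho>) ^ 5 = (1 + - z / of_real \<rho>) powr (5/2)"
    by (simp add: csqrt_power_5)
  moreover have "(- z / of_real \<rho>) ^ n = (- 1 / of_real \<rho>) ^ n * z ^ n" for n
    by (simp flip: power_mult_distrib)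
  ultimately show ?thesis using gen_binomial_complex[OF n, of "5/2"] by (simp add: mult.assoc)
qed

lemma binomial_singularity_limit:
  "(\<lambda>n. ((5/2 :: real) gchoose n) * (- 1) ^ n * real n powr (7/2)) \<longlonglongrightarrow> rGamma (- 5/2)"
    "rGamma (- 5/2 :: real) \<noteq> 0"
proof -
  have "(\<lambda>n. ((5/2 :: real) gchoose n) / ((- 1) ^ n / exp ((5/2 + 1) * of_real (ln (real n))))) \<longlonglongrightarrow> inverse (Gamma (- (5/2)))"
    by (rule gbinomial_asymptotic)
  moreover have "\<forall>\<^sub>F n in sequentially. ((5/2 :: real) gchoose n) / ((- 1) ^ n / exp ((5/2 + 1) * of_real (ln (real n))))
     = ((5/2 :: real) gchoose n) * (- 1) ^ n * real n powr (7/2)"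
    using eventually_gt_at_top[of 0]
  proof eventually_elim
    case (elim n)
    have "exp ((5/2 + 1) * of_real (ln (real n))) = real n powr (7/2)" using elim by (simp add: powr_def)
    then show ?case by (simp add: minus_one_power_iff)
  qed
  ultimately have "(\<lambda>n. ((5/2 :: real) gchoose n) * (- 1) ^ n * real n powr (7/2)) \<longlonglongrightarrow> inverse (Gamma (- (5/2)))"
    by (rule Lim_transform_eventually)
  then show "(\<lambda>n. ((5/2 :: real) gchoose n) * (- 1) ^ n * real n powr (7/2)) \<longlonglongrightarrow> rGamma (- 5/2)"
    by (simp add: rGamma_inverse_Gamma)
  have "(- 5/2 :: real) \<notin> \<int>\<^sub>\<le>\<^sub>0"
  proof
    assume "(- 5/2 :: real) \<in> \<int>\<^sub>\<le>\<^sub>0"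
    then have "(- 5/2 :: real) \<in> \<int>" using nonpos_Ints_subset_Ints by blast
    then obtain k :: int where "(- 5/2 :: real) = of_int k" by (elim Ints_cases)
    then have "of_int (2 * k) = (of_int (- 5) :: real)" by simp
    then have "2 * k = - 5" by (simp only: of_int_eq_iff)
    then show False by presburger
  qed
  then show "rGamma (- 5/2 :: real) \<noteq> 0" using rGamma_eq_zero_iff by blast
qed

text \<open>The dented disk avoids the branch cut of the square root.\<close>

lemma csqrt_holomorphic_dented_disk:
  assumes "0 < \<rho>" "0 < \<phi>"
  shows "(\<lambda>z. csqrt (1 - z / of_real \<rho>)) holomorphic_on dented_disk \<rho> s \<phi>"
proof (rule holomorphic_on_compose_gen[of "\<lambda>z. 1 - z / of_real \<rho>" _ csqrt "- \<real>\<^sub>\<le>\<^sub>0", unfolded o_def])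
  show "(\<lambda>z. 1 - z / of_real \<rho>) holomorphic_on dented_disk \<rho> s \<phi>"
    using assms by (intro holomorphic_intros) auto
  show "csqrt holomorphic_on - \<real>\<^sub>\<le>\<^sub>0" by (rule holomorphic_on_csqrt)
  have "1 - z / of_real \<rho> \<notin> \<real>\<^sub>\<le>\<^sub>0" if z: "z \<in> dented_disk \<rho> s \<phi>" for z
  proof
    assume "1 - z / of_real \<rho> \<in> \<real>\<^sub>\<le>\<^sub>0"
    then obtain x where x: "x \<le> 0" "1 - z / of_real \<rho> = of_real x" by (elim nonpos_Reals_cases)
    from x(2) have "z / of_real \<rho> = 1 - of_real x" by (metis diff_diff_eq2 add_diff_cancel_left')
    then have "z = (1 - of_real x) * of_real \<rho>" using assms by (subst (asm) nonzero_divide_eq_eq) auto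
    then have "z - of_real \<rho> = of_real (- \<rho> * x)" by (simp add: algebra_simps)
    moreover have "0 \<le> - \<rho> * x" using x assms by (simp add: mult_le_0_iff)
    ultimately have "Arg (z - of_real \<rho>) = 0" by (metis Arg_of_real not_less)
    then show False using z assms by (simp add: dented_disk_def)
  qed
  then show "(\<lambda>z. 1 - z / of_real \<rho>) ` dented_disk \<rho> s \<phi> \<subseteq> - \<real>\<^sub>\<le>\<^sub>0" by auto
qed

text \<open>The even powers of X are polynomials in z, so from degree 3 on the coefficients come
  from C5 X^5 and from the remainder. The former are of order n^(-7/2), the latter
  O(n^(-4)).\<close>

lemma singular_expansion_coefficients:
  fixes C :: "real fps"
  assumes nn: "\<And>n. 0 \<le> fps_nth C n" and C5: "C5 \<noteq> 0"
    and cont: "dented_continuation (complex_fps C) \<rho> D F"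
    and O: "(\<lambda>z. F z - (of_real C0 + of_real C2 * csqrt (1 - z / of_real \<rho>) ^ 2
        + of_real C4 * csqrt (1 - z / of_real \<rho>) ^ 4 + of_real C5 * csqrt (1 - z / of_real \<rho>) ^ 5))
      \<in> O[at (of_real \<rho>) within D](\<lambda>z. csqrt (1 - z / of_real \<rho>) ^ 6)"
    and cr: "fps_conv_radius C = ereal \<rho>"
  obtains b where "0 < b" "(\<lambda>n. fps_nth C n * \<rho> ^ n * real n powr (7/2)) \<longlonglongrightarrow> b"
    and "(\<Sum>n. real n * (real n - 1) * (fps_nth C n * \<rho> ^ n)) = 2 * C4"
proof -
  define X where "X z = csqrt (1 - z / of_real \<rho>)" for z
  define E where "E z = F z - (of_real C0 + of_real C2 * X z ^ 2 + of_real C4 * X z ^ 4 + of_real C5 * X z ^ 5)" for z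
  define a where "a n = fps_nth C n * \<rho> ^ n" for n
  obtain s \<phi> where s: "0 < \<rho>" "\<rho> < s" and \<phi>: "0 < \<phi>" "\<phi> < pi / 2" and D: "D = dented_disk \<rho> s \<phi>"
    and F: "F holomorphic_on D" and FC: "\<And>z. z \<in> D \<Longrightarrow> norm z < \<rho> \<Longrightarrow> F z = eval_fps (complex_fps C) z"
    using cont unfolding dented_continuation_def by blast
  have a0: "0 \<le> a n" for n using nn s by (simp add: a_def)
  have ball: "z \<in> D" if "norm z < \<rho>" for z
    unfolding D
  proof (rule in_dented_disk)
    have "Re (z - of_real \<rho>) < 0" using that complex_Re_le_cmod[of z] by simp
    also have "0 \<le> norm (z - of_real \<rho>) * cos \<phi>"
      using \<phi> by (intro mult_nonneg_nonneg less_imp_le[OF cos_gt_zero]) auto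
    finally show "Re (z - of_real \<rho>) < norm (z - of_real \<rho>) * cos \<phi>" .
  qed (use that s \<phi> in auto)
  have X2: "X z ^ 2 = 1 - z / of_real \<rho>" for z by (simp add: X_def)
  have X4: "X z ^ 4 = (1 - z / of_real \<rho>)\<^sup>2" for z
    using X2[of z] by (metis power_mult numeral_times_numeral semiring_norm(12,13) mult_2 numeral_Bit0 power2_eq_square power_add)
  have X6: "X z ^ 6 = (- 1 / of_real \<rho> ^ 3) * (z - of_real \<rho>) ^ 3" for z
  proof -
    have "X z ^ 6 = (X z ^ 2) ^ 3" by (simp flip: power_mult)
    also have "\<dots> = (- (1 / of_real \<rho>) * (z - of_real \<rho>)) ^ 3"
      unfolding X2 using s by (intro arg_cong[where f = "\<lambda>x. x ^ 3"]) (simp add: field_simps)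
    also have "\<dots> = (- 1 / of_real \<rho> ^ 3) * (z - of_real \<rho>) ^ 3"
      unfolding power_mult_distrib by (simp add: power_one_over)
    finally show ?thesis .
  qed
  have E_hol: "E holomorphic_on D"
  proof -
    have "X holomorphic_on D"
      unfolding X_def D by (rule csqrt_holomorphic_dented_disk[OF s(1) \<phi>(1)])
    then show ?thesis unfolding E_def by (intro holomorphic_intros F)
  qed
  have "E \<in> O[at (of_real \<rho>) within D](\<lambda>z. X z ^ 6)"
    using O unfolding E_def X_def .
  then have E_O: "E \<in> O[at (of_real \<rho>) within D](\<lambda>z. (z - of_real \<rho>) ^ 3)"
    unfolding X6 using s by (subst (asm) landau_o.big.cmult) auto
  obtain K where K5: "\<And>z. norm z < \<rho> \<Longrightarrow> norm ((deriv ^^ 5) E z) \<le> K / norm (of_real \<rho> - z) ^ 2"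
    and K: "\<And>z. norm z < \<rho> \<Longrightarrow> norm (E z) \<le> K * norm (of_real \<rho> - z) ^ 3"
    using singular_remainder_derivative_bound[OF s \<phi> E_hol[unfolded D] E_O[unfolded D]] by metis
  have E_ball: "E holomorphic_on ball 0 \<rho>"
    by (rule holomorphic_on_subset[OF E_hol]) (use ball in auto)
  \<comment> \<open>The polynomial C0 + C2 X^2 + C4 X^4 rewritten in powers of z.\<close>
  define p0 p1 p2 where "p0 = C0 + C2 + C4" and "p1 = - (C2 + 2 * C4) / \<rho>" and "p2 = C4 / \<rho>\<^sup>2"
  define S where "S = Abs_fps (\<lambda>n. ((5/2 :: complex) gchoose n) * (- 1 / of_real \<rho>) ^ n)"
  let ?P = "complex_fps C - (fps_const (of_real p0) + fps_const (of_real p1) * fps_X + fps_const (of_real p2) * fps_X ^ 2) - fps_const (of_real C5) * S"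
  let ?Q = "\<lambda>z. eval_fps (complex_fps C) z - (of_real p0 + of_real p1 * z + of_real p2 * z ^ 2) - of_real C5 * X z ^ 5"
  have E_eq: "E z = ?Q z"
    if "norm z < \<rho>" for z
    unfolding E_def FC[OF ball[OF that] that] X2 X4 p0_def p1_def p2_def
    using s by (simp add: field_simps power2_eq_square)
  have near0: "\<forall>\<^sub>F z in nhds 0. norm (z::complex) < \<rho>"
    using eventually_nhds_in_open[of "ball 0 \<rho>" "0::complex"] s by simp
  have hE: "E has_fps_expansion ?P"
  proof (rule has_fps_expansion_cong[THEN iffD1, OF _ refl])
    have "(\<lambda>z. X z ^ 5) has_fps_expansion S"
    proof (rule has_fps_expansionI)
      show "\<forall>\<^sub>F u in nhds 0. (\<lambda>n. fps_nth S n * u ^ n) sums X u ^ 5"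
        using near0 by eventually_elim (use binomial_singularity_sums in \<open>simp add: S_def X_def\<close>)
    qed
    then show "?Q
      has_fps_expansion ?P"
      using cr s by (intro has_fps_expansion_diff has_fps_expansion_add has_fps_expansion_mult has_fps_expansion_const
          has_fps_expansion_fps_X has_fps_expansion_fps_X_power eval_fps_has_fps_expansion) auto
    show "\<forall>\<^sub>F z in nhds 0. ?Q z = E z"
      using near0 by eventually_elim (simp add: E_eq)
  qed
  then have e: "(deriv ^^ n) E 0 / fact n = of_real (fps_nth C n) - of_real C5 * fps_nth S n" if "2 < n" for n
  proof -
    have "(deriv ^^ n) E 0 / fact n = fps_nth (fps_expansion E 0) n" by (simp add: fps_expansion_def)
    then show ?thesis using that unfolding fps_expansion_eqI[OF hE] by simp
  qed
  have gb: "((5/2 :: complex) gchoose n) = of_real ((5/2) gchoose n)" for n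
    by (simp add: gbinomial_prod_rev)
  define e where "e n = norm ((deriv ^^ n) E 0 / fact n) * \<rho> ^ n" for n
  have e_lim: "(\<lambda>n. e n * real n powr (7/2)) \<longlonglongrightarrow> 0"
  proof -
    define K' where "K' = \<bar>exp 1 * K / \<rho>\<^sup>2 * \<rho> ^ 5\<bar>"
    \<comment> \<open>The coefficient m + 5 of E is the coefficient m of its fifth derivative
      divided by (m+1)...(m+5), so a bound linear in m becomes O(m^(-4)).\<close>
    have "e (m + 5) \<le> K' * (real m + 2) / (real m + 1) ^ 5" for m
    proof -
      define N where "N = norm ((deriv ^^ (m + 5)) E 0)"
      have "(deriv ^^ 5) E holomorphic_on ball 0 \<rho>" by (intro holomorphic_intros E_ball) auto
      from coefficient_bound_double_pole[OF s(1) this K5, of m]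
      have 1: "N / fact m * \<rho> ^ m \<le> exp 1 * K / \<rho>\<^sup>2 * (real m + 2)"
        by (simp add: N_def funpow_add norm_divide)
      have "fact m * (real m + 1) ^ 5 \<le> fact (m + 5)"
      proof -
        have "(real m + 1) ^ 5 = (real m + 1) * (real m + 1) * (real m + 1) * (real m + 1) * (real m + 1)"
          by (simp add: eval_nat_numeral)
        also have "\<dots> \<le> (real m + 1) * (real m + 2) * (real m + 3) * (real m + 4) * (real m + 5)"
          by (intro mult_mono mult_nonneg_nonneg) auto
        also have "fact m * \<dots> = fact (m + 5)" by (simp add: eval_nat_numeral algebra_simps)
        finally show ?thesis by (simp add: mult_left_mono)
      qed
      then have "N / fact (m + 5) \<le> N / (fact m * (real m + 1) ^ 5)"
        by (intro divide_left_mono) (auto simp: N_def)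
      then have "e (m + 5) \<le> N / (fact m * (real m + 1) ^ 5) * \<rho> ^ (m + 5)"
        unfolding e_def using s by (intro mult_right_mono) (auto simp: N_def norm_divide)
      also have "\<dots> = (N / fact m * \<rho> ^ m) * \<rho> ^ 5 / (real m + 1) ^ 5" by (simp add: power_add)
      also have "\<dots> \<le> (exp 1 * K / \<rho>\<^sup>2 * (real m + 2)) * \<rho> ^ 5 / (real m + 1) ^ 5"
        using 1 s by (intro divide_right_mono mult_right_mono) auto
      also have "\<dots> = (exp 1 * K / \<rho>\<^sup>2 * \<rho> ^ 5) * (real m + 2) / (real m + 1) ^ 5" by simp
      also have "\<dots> \<le> K' * (real m + 2) / (real m + 1) ^ 5"
        unfolding K'_def by (intro divide_right_mono mult_right_mono abs_ge_self) simp_all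
      finally show ?thesis .
    qed
    moreover have "0 \<le> e n" for n using s by (simp add: e_def)
    ultimately have "norm (e (m + 5) * real (m + 5) powr (7/2)) \<le> K' * (real m + 2) / (real m + 1) ^ 5 * real (m + 5) powr (7/2)" for m
      using mult_right_mono[of "e (m + 5)" "K' * (real m + 2) / (real m + 1) ^ 5" "real (m + 5) powr (7/2)"]
      by (simp only: real_norm_def abs_mult abs_of_nonneg powr_ge_zero)
    then have "\<forall>\<^sub>F m in sequentially. norm (e (m + 5) * real (m + 5) powr (7/2)) \<le> K' * (real m + 2) / (real m + 1) ^ 5 * real (m + 5) powr (7/2)"
      by simp
    moreover have "(\<lambda>m. K' * (real m + 2) / (real m + 1) ^ 5 * real (m + 5) powr (7/2)) \<longlonglongrightarrow> 0"
    proof -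
      have "(\<lambda>m. (real m + 2) / (real m + 1) ^ 5 * (real m + 5) powr (7/2)) \<longlonglongrightarrow> 0" by real_asymp
      from tendsto_mult_right_zero[OF this, of K'] show ?thesis by (simp add: mult_ac)
    qed
    ultimately have "(\<lambda>m. e (m + 5) * real (m + 5) powr (7/2)) \<longlonglongrightarrow> 0" by (rule Lim_null_comparison)
    then show ?thesis by (rule LIMSEQ_offset)
  qed
  define b where "b = C5 * rGamma (- 5/2)"
  let ?g = "\<lambda>n. ((5/2) gchoose n) * (- 1) ^ n :: real"
  have a_lim: "(\<lambda>n. a n * real n powr (7/2)) \<longlonglongrightarrow> b"
  proof -
    have "\<forall>\<^sub>F n in sequentially. norm (a n * real n powr (7/2) - C5 * (?g n * real n powr (7/2))) = e n * real n powr (7/2)"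
      using eventually_gt_at_top[of 2]
    proof eventually_elim
      case (elim n)
      have "e n = norm ((of_real (fps_nth C n) - of_real C5 * fps_nth S n) * of_real \<rho> ^ n)"
        unfolding e_def e[OF elim] using s by (simp add: norm_mult norm_power)
      also have "(of_real (fps_nth C n) - of_real C5 * fps_nth S n) * of_real \<rho> ^ n
        = complex_of_real (a n - C5 * ?g n)"
      proof -
        have "(- 1 / complex_of_real \<rho>) ^ n * of_real \<rho> ^ n = (- 1) ^ n"
          unfolding power_mult_distrib[symmetric] using s by simp
        then show ?thesis by (simp add: S_def gb a_def left_diff_distrib mult.assoc)
      qed
      finally have "e n = \<bar>a n - C5 * ?g n\<bar>" by (simp only: norm_of_real)
      moreover have "a n * real n powr (7/2) - C5 * (?g n * real n powr (7/2))
        = (a n - C5 * ?g n) * real n powr (7/2)" by (simp add: algebra_simps)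
      ultimately show ?case by (simp add: abs_mult)
    qed
    then have "(\<lambda>n. norm (a n * real n powr (7/2) - C5 * (?g n * real n powr (7/2)))) \<longlonglongrightarrow> 0"
      by (simp add: tendsto_cong e_lim)
    then have "(\<lambda>n. a n * real n powr (7/2) - C5 * (?g n * real n powr (7/2))) \<longlonglongrightarrow> 0"
      by (rule tendsto_norm_zero_cancel)
    from tendsto_add[OF this tendsto_mult_left[OF binomial_singularity_limit(1), of C5]]
    show ?thesis by (simp add: b_def)
  qed
  \<comment> \<open>No sign of C5 is assumed: nonnegative coefficients force b >= 0, and b is
    nonzero because -5/2 is not a pole of the Gamma function.\<close>
  have "0 \<le> b" by (rule tendsto_lowerbound[OF a_lim]) (use a0 in auto)
  moreover have "b \<noteq> 0" using C5 binomial_singularity_limit(2) by (simp add: b_def)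
  ultimately have b: "0 < b" by simp
  have sm: "summable (\<lambda>n. (real n)\<^sup>2 * a n)"
  proof (rule summable_comparison_test_ev)
    have "\<forall>\<^sub>F n in sequentially. a n * real n powr (7/2) < b + 1"
      by (rule order_tendstoD(2)[OF a_lim]) simp
    then show "\<forall>\<^sub>F n in sequentially. norm ((real n)\<^sup>2 * a n) \<le> (b + 1) * real n powr (- 3/2)"
      using eventually_gt_at_top[of 0]
    proof eventually_elim
      case (elim n)
      have n: "(real n)\<^sup>2 = real n powr (7/2) * real n powr (- 3/2)"
        using elim by (simp flip: powr_add) 
      have "(real n)\<^sup>2 * a n = (a n * real n powr (7/2)) * real n powr (- 3/2)" unfolding n by simp
      also have "\<dots> \<le> (b + 1) * real n powr (- 3/2)" using elim by (intro mult_right_mono) auto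
      finally show ?case using a0 by simp
    qed
    show "summable (\<lambda>n. (b + 1) * real n powr (- 3/2))"
      by (intro summable_mult) (simp add: summable_real_powr_iff)
  qed
  \<comment> \<open>At x = \<rho>(1 - \<epsilon>) one has X = sqrt \<epsilon>. The error consists of
    C5 \<epsilon>^(5/2) and a remainder O(\<epsilon>^3), both o(\<epsilon>^2).\<close>
  have "((\<lambda>\<epsilon>. ((\<Sum>n. a n * (1 - \<epsilon>) ^ n) - (C0 + C2 * \<epsilon> + C4 * \<epsilon>\<^sup>2)) / \<epsilon>\<^sup>2) \<longlongrightarrow> 0) (at_right 0)"
  proof (rule Lim_null_comparison)
    show "\<forall>\<^sub>F \<epsilon> in at_right 0. norm (((\<Sum>n. a n * (1 - \<epsilon>) ^ n) - (C0 + C2 * \<epsilon> + C4 * \<epsilon>\<^sup>2)) / \<epsilon>\<^sup>2)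
       \<le> K * \<rho> ^ 3 * \<epsilon> + \<bar>C5\<bar> * sqrt \<epsilon>"
      using eventually_at_right_real[OF zero_less_one]
    proof eventually_elim
      fix \<epsilon> :: real assume "\<epsilon> \<in> {0<..<1}"
      then have \<epsilon>: "0 < \<epsilon>" "\<epsilon> < 1" by auto
      define x where "x = \<rho> * (1 - \<epsilon>)"
      have x: "0 < x" "x < \<rho>" using \<epsilon> s by (auto simp: x_def)
      have sx: "summable (\<lambda>n. fps_nth C n * x ^ n)" by (rule summable_fps) (use x cr in auto)
      have "(\<Sum>n. a n * (1 - \<epsilon>) ^ n) = eval_fps C x"
        by (simp add: eval_fps_def a_def x_def power_mult_distrib mult_ac)
      moreover have "of_real (eval_fps C x) = F (of_real x)"
        using eval_complex_fps[OF sx] FC[OF ball, of "of_real x"] x by simp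
      moreover have "1 - complex_of_real x / of_real \<rho> = of_real \<epsilon>"
        using s by (simp add: x_def field_simps)
      then have "X (of_real x) = of_real (sqrt \<epsilon>)" using \<epsilon> by (simp add: X_def csqrt_of_real_nonneg)
      ultimately have "E (of_real x) = of_real ((\<Sum>n. a n * (1 - \<epsilon>) ^ n) - (C0 + C2 * sqrt \<epsilon> ^ 2 + C4 * sqrt \<epsilon> ^ 4 + C5 * sqrt \<epsilon> ^ 5))"
        by (simp add: E_def)
      moreover have "sqrt \<epsilon> ^ 2 = \<epsilon>" "sqrt \<epsilon> ^ 4 = \<epsilon>\<^sup>2" "sqrt \<epsilon> ^ 5 = \<epsilon>\<^sup>2 * sqrt \<epsilon>"
        using \<epsilon> by (simp_all add: eval_nat_numeral)
      moreover have "norm (E (of_real x)) \<le> K * (\<rho> * \<epsilon>) ^ 3"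
      proof -
        have "norm (of_real \<rho> - complex_of_real x) = \<rho> * \<epsilon>"
          using s \<epsilon> norm_of_real[of "\<rho> - x", where ?'a = complex] by (simp add: x_def algebra_simps)
        then show ?thesis using K[of "of_real x"] x by simp
      qed
      ultimately have "\<bar>(\<Sum>n. a n * (1 - \<epsilon>) ^ n) - (C0 + C2 * \<epsilon> + C4 * \<epsilon>\<^sup>2 + C5 * (\<epsilon>\<^sup>2 * sqrt \<epsilon>))\<bar> \<le> K * (\<rho> * \<epsilon>) ^ 3"
        by (simp only: norm_of_real)
      then have "\<bar>(\<Sum>n. a n * (1 - \<epsilon>) ^ n) - (C0 + C2 * \<epsilon> + C4 * \<epsilon>\<^sup>2)\<bar> \<le> K * (\<rho> * \<epsilon>) ^ 3 + \<bar>C5 * (\<epsilon>\<^sup>2 * sqrt \<epsilon>)\<bar>"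
        by linarith
      also have "\<dots> = (K * \<rho> ^ 3 * \<epsilon> + \<bar>C5\<bar> * sqrt \<epsilon>) * \<epsilon>\<^sup>2"
        using \<epsilon> by (simp add: abs_mult eval_nat_numeral algebra_simps)
      finally show "norm (((\<Sum>n. a n * (1 - \<epsilon>) ^ n) - (C0 + C2 * \<epsilon> + C4 * \<epsilon>\<^sup>2)) / \<epsilon>\<^sup>2)
         \<le> K * \<rho> ^ 3 * \<epsilon> + \<bar>C5\<bar> * sqrt \<epsilon>"
        using \<epsilon> by (simp add: pos_divide_le_eq)
    qed
    have "((\<lambda>\<epsilon>. K * \<rho> ^ 3 * \<epsilon> + \<bar>C5\<bar> * sqrt \<epsilon>) \<longlongrightarrow> K * \<rho> ^ 3 * 0 + \<bar>C5\<bar> * sqrt 0) (at_right 0)"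
      by (intro tendsto_intros)
    then show "((\<lambda>\<epsilon>. K * \<rho> ^ 3 * \<epsilon> + \<bar>C5\<bar> * sqrt \<epsilon>) \<longlongrightarrow> 0) (at_right 0)" by simp
  qed
  from second_factorial_moment_eq[OF a0 sm this]
  show thesis using that[OF b] a_lim by (simp add: a_def)
qed

section \<open>The limit law\<close>

lemma exp_sequence_fps:
  fixes C G :: "real fps"
  assumes G: "G = fps_exp 1 oo C" and C0: "fps_nth C 0 = 0"
    and nn: "\<And>n. 0 \<le> fps_nth C n" "\<And>n. 0 \<le> fps_nth G n" and \<rho>: "0 < \<rho>"
    and lim: "(\<lambda>n. fps_nth C n * \<rho> ^ n * real n powr \<alpha>) \<longlonglongrightarrow> b" and b: "0 < b" and \<alpha>: "2 < \<alpha>"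
  shows "exp_sequence (\<lambda>n. fps_nth C n * \<rho> ^ n) (\<lambda>n. fps_nth G n * \<rho> ^ n) \<alpha> b"
proof
  show "0 \<le> fps_nth C n * \<rho> ^ n" "0 \<le> fps_nth G n * \<rho> ^ n" for n using nn \<rho> by auto
  show "fps_nth G 0 * \<rho> ^ 0 = 1" by (simp add: G)
  show "(\<lambda>n. fps_nth C n * \<rho> ^ n * real n powr \<alpha>) \<longlonglongrightarrow> b" "0 < b" "2 < \<alpha>" by fact+
  show "real n * (fps_nth G n * \<rho> ^ n)
      = (\<Sum>k\<le>n. real k * (fps_nth C k * \<rho> ^ k) * (fps_nth G (n - k) * \<rho> ^ (n - k)))" for n
  proof -
    have "fps_deriv G = G * fps_deriv C"
      unfolding G using fps_compose_deriv[OF C0, of "fps_exp 1"] by simp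
    then have "fps_X * fps_deriv G = (fps_X * fps_deriv C) * G" by (simp add: mult_ac)
    then have "fps_nth (fps_X * fps_deriv G) n = fps_nth ((fps_X * fps_deriv C) * G) n" by (rule arg_cong)
    moreover have X: "fps_nth (fps_X * fps_deriv F) k = real k * fps_nth F k" for F :: "real fps" and k
      by (cases k) auto
    ultimately have "real n * fps_nth G n = (\<Sum>k\<le>n. real k * fps_nth C k * fps_nth G (n - k))"
      by (simp only: fps_mult_nth[of "fps_X * fps_deriv C" G] X atMost_atLeast0)
    then have "real n * (fps_nth G n * \<rho> ^ n) = (\<Sum>k\<le>n. real k * fps_nth C k * fps_nth G (n - k) * \<rho> ^ n)"
      by (simp add: sum_distrib_right[symmetric] mult.assoc[symmetric])
    also have "\<dots> = (\<Sum>k\<le>n. real k * (fps_nth C k * \<rho> ^ k) * (fps_nth G (n - k) * \<rho> ^ (n - k)))"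
    proof (intro sum.cong refl)
      fix k assume "k \<in> {..n}"
      then have "\<rho> ^ n = \<rho> ^ k * \<rho> ^ (n - k)" by (simp flip: power_add)
      then show "real k * fps_nth C k * fps_nth G (n - k) * \<rho> ^ n
        = real k * (fps_nth C k * \<rho> ^ k) * (fps_nth G (n - k) * \<rho> ^ (n - k))" by simp
    qed
    finally show ?thesis .
  qed
  show "\<exists>K. \<forall>n. fps_nth G n * \<rho> ^ n \<le> K * (real n + 1) powr (- \<alpha>)"
  proof -
    define w where "w n = (real n + 1) powr (- \<alpha>)" for n
    obtain M where M: "M \<ge> 0"
      "\<And>n. (\<Sum>k\<le>n. (real k + 1) powr (-\<alpha>) * (real (n - k) + 1) powr (-\<alpha>)) \<le> M * (real n + 1) powr (-\<alpha>)"
      using conv_weight_le[of \<alpha>] \<alpha> by auto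
    have "Bseq (\<lambda>n. fps_nth C n * \<rho> ^ n * real n powr \<alpha>)"
      using lim by (intro convergent_imp_Bseq convergentI)
    then obtain K where K: "0 < K" "\<And>n. norm (fps_nth C n * \<rho> ^ n * real n powr \<alpha>) \<le> K"
      by (auto elim: BseqE)
    \<comment> \<open>The substitution \<rho>x commutes with composition, so exp(A) has the
      coefficients to be bounded, while A itself is dominated by the weight.\<close>
    define A where "A = C oo (fps_const \<rho> * fps_X)"
    have An: "fps_nth A n = fps_nth C n * \<rho> ^ n" for n by (simp add: A_def fps_compose_linear)
    have Aw: "fps_nth A n \<le> K * 2 powr \<alpha> * w n" for n
    proof (cases "n = 0")
      case True
      then show ?thesis using K by (simp add: An C0 w_def)
    next
      case False
      have "(real n + 1) powr \<alpha> \<le> (2 * real n) powr \<alpha>" using False \<alpha> by (intro powr_mono2) auto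
      then have "(real n + 1) powr \<alpha> \<le> 2 powr \<alpha> * real n powr \<alpha>" by (simp add: powr_mult)
      then have "fps_nth A n * (real n + 1) powr \<alpha> \<le> fps_nth A n * (2 powr \<alpha> * real n powr \<alpha>)"
        using nn \<rho> by (intro mult_left_mono) (auto simp: An)
      also have "\<dots> = 2 powr \<alpha> * (fps_nth C n * \<rho> ^ n * real n powr \<alpha>)" by (simp add: An)
      also have "\<dots> \<le> 2 powr \<alpha> * K" using K(2)[of n] by (intro mult_left_mono) auto
      finally show ?thesis by (simp add: w_def powr_minus field_simps)
    qed
    have "fps_exp 1 oo A = G oo (fps_const \<rho> * fps_X)"
      unfolding A_def G by (rule fps_compose_assoc) (simp_all add: C0)
    then have "fps_nth (fps_exp 1 oo A) n = fps_nth G n * \<rho> ^ n" for n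
      by (simp add: fps_compose_linear)
    moreover have "fps_nth (fps_exp 1 oo A) n \<le> exp (K * 2 powr \<alpha> * M) * w n" for n
      by (rule fps_exp_compose_nth_le[OF _ Aw]) (use M K nn \<rho> in \<open>auto simp: An w_def\<close>)
    ultimately show ?thesis unfolding w_def by metis
  qed
qed

section \<open>Law and moments of the missed vertices\<close>

lemma missed_le: "missed g \<le> card (verts g)"
  by (simp add: missed_def)

lemma weighted_binomial_ratio:
  fixes \<rho> :: real
  assumes "m \<le> n" "0 < \<rho>"
  shows "real (n choose m) * x * y / z
    = (x / fact m * \<rho> ^ m) * (y / fact (n - m) * \<rho> ^ (n - m)) / (z / fact n * \<rho> ^ n)"
proof -
  have "\<rho> ^ n = \<rho> ^ m * \<rho> ^ (n - m)" using assms by (simp flip: power_add)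
  then show ?thesis using assms by (simp add: binomial_fact mult_ac)
qed

text \<open>Graphs with 2M < n contribute exactly \<open>?H\<close>. All others have M <= n and are
  counted by the balanced splittings, so their contribution lies between 0 and \<open>?T\<close>,
  which tends to 0; the moment is squeezed.\<close>

lemma missed_limit_law:
  fixes \<G> :: "graph set" and \<rho> \<alpha> b :: real
  defines "a \<equiv> \<lambda>n. real (num_connected \<G> n) / fact n * \<rho> ^ n"
    and "gam \<equiv> \<lambda>n. real (num_graphs \<G> n) / fact n * \<rho> ^ n"
  assumes closed: "closed_class \<G>" and \<rho>: "0 < \<rho>" and es: "exp_sequence a gam \<alpha> b"
  shows "(\<lambda>n. measure_pmf.prob (random_graph \<G> n) {g. missed g = k}) \<longlonglongrightarrow> gam k / suminf gam" (is ?thesis1)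
    and "real j + 1 < \<alpha> \<Longrightarrow> (\<lambda>n. measure_pmf.expectation (random_graph \<G> n) (\<lambda>g. real (missed g) ^ j))
      \<longlonglongrightarrow> (\<Sum>k. real k ^ j * gam k) / suminf gam"
    and "\<forall>\<^sub>F n in sequentially. finite (graphs_on \<G> n) \<and> graphs_on \<G> n \<noteq> {}"
proof -
  interpret exp_sequence a gam \<alpha> b by (rule es)
  have fin: "finite (graphs_on \<G> n)" for n by (rule finite_graphs_on[OF closed])
  have ne: "graphs_on \<G> n \<noteq> {}" if "0 < gam n" for n
    using that by (auto simp: gam_def num_graphs_def)
  then show "\<forall>\<^sub>F n in sequentially. finite (graphs_on \<G> n) \<and> graphs_on \<G> n \<noteq> {}"
    using eventually_gam_pos fin by (auto elim: eventually_mono)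
  have head: "real (card {g \<in> graphs_on \<G> n. missed g = k}) / real (card (graphs_on \<G> n)) = gam k * a (n - k) / gam n"
    if "2 * k < n" for n k
    using card_missed[OF closed that] weighted_binomial_ratio[of k n \<rho>] that \<rho>
    by (simp add: a_def gam_def num_graphs_def[symmetric])
  show ?thesis1
  proof (rule Lim_transform_eventually)
    show "(\<lambda>n. gam k * (a (n - k) / gam n)) \<longlonglongrightarrow> gam k / suminf gam"
      using tendsto_mult_left[OF shifted_limit, of "gam k" k] by (simp add: Gam_def)
    show "\<forall>\<^sub>F n in sequentially. gam k * (a (n - k) / gam n) = measure_pmf.prob (random_graph \<G> n) {g. missed g = k}"
      using eventually_gam_pos eventually_gt_at_top[of "2 * k"]
    proof eventually_elim
      case (elim n)
      have "graphs_on \<G> n \<inter> {g. missed g = k} = {g \<in> graphs_on \<G> n. missed g = k}" by auto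
      then show ?case
        using measure_pmf_of_set[OF ne[OF elim(1)] fin] head[OF elim(2)] by (simp add: random_graph_def)
    qed
  qed
  assume j: "real j + 1 < \<alpha>"
  let ?H = "\<lambda>n. \<Sum>k | 2 * k < n. real k ^ j * (gam k * a (n - k) / gam n)"
  let ?T = "\<lambda>n. real n ^ j * (\<Sum>m | n \<le> 3 * m \<and> 3 * m \<le> 2 * n. gam m * gam (n - m)) / gam n"
  let ?E = "\<lambda>n. measure_pmf.expectation (random_graph \<G> n) (\<lambda>g. real (missed g) ^ j)"
  have "\<forall>\<^sub>F n in sequentially. ?H n \<le> ?E n \<and> ?E n \<le> ?H n + ?T n"
    using eventually_gam_pos eventually_gt_at_top[of 0]
  proof eventually_elim
    case (elim n)
    define S1 S2 where "S1 = {g \<in> graphs_on \<G> n. 2 * missed g < n}" and "S2 = {g \<in> graphs_on \<G> n. n \<le> 2 * missed g}"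
    have S: "graphs_on \<G> n = S1 \<union> S2" "S1 \<inter> S2 = {}" "finite S1" "finite S2"
      using fin by (auto simp: S1_def S2_def)
    define N where "N = real (card (graphs_on \<G> n))"
    have E: "?E n = (\<Sum>g\<in>S1. real (missed g) ^ j) / N + (\<Sum>g\<in>S2. real (missed g) ^ j) / N"
      unfolding random_graph_def integral_pmf_of_set[OF ne[OF elim(1)] fin] N_def
      by (subst (1) S(1)) (simp add: sum.union_disjoint S add_divide_distrib)
    have "(\<Sum>g\<in>S1. real (missed g) ^ j) = (\<Sum>k | 2 * k < n. \<Sum>g | g \<in> S1 \<and> missed g = k. real (missed g) ^ j)"
      by (rule sum.group[symmetric]) (use S in \<open>auto simp: S1_def intro: finite_subset[of _ "{..n}"]\<close>)
    also have "\<dots> = (\<Sum>k | 2 * k < n. real k ^ j * real (card {g \<in> graphs_on \<G> n. missed g = k}))"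
    proof (intro sum.cong refl)
      fix k assume "k \<in> {k. 2 * k < n}"
      then have "{g. g \<in> S1 \<and> missed g = k} = {g \<in> graphs_on \<G> n. missed g = k}" by (auto simp: S1_def)
      then show "(\<Sum>g | g \<in> S1 \<and> missed g = k. real (missed g) ^ j) = real k ^ j * real (card {g \<in> graphs_on \<G> n. missed g = k})"
        by simp
    qed
    finally have H: "(\<Sum>g\<in>S1. real (missed g) ^ j) / N = ?H n"
      by (simp add: sum_divide_distrib N_def head flip: times_divide_eq_right)
    let ?M = "{m. n \<le> 3 * m \<and> 3 * m \<le> 2 * n}"
    define s where "s m = real (n choose m) * real (num_graphs \<G> m) * real (num_graphs \<G> (n - m))" for m
    have "(\<Sum>g\<in>S2. real (missed g) ^ j) \<le> (\<Sum>g\<in>S2. real n ^ j)"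
    proof (intro sum_mono power_mono)
      fix g assume "g \<in> S2"
      then have "card (verts g) = n" by (simp add: S2_def graphs_on_def)
      then show "real (missed g) \<le> real n" using missed_le[of g] by simp
    qed simp
    also have "\<dots> = real n ^ j * real (card S2)" by simp
    also have "\<dots> \<le> real n ^ j * (\<Sum>m\<in>?M. s m)"
    proof (rule mult_left_mono)
      have "real (card S2) \<le> real (\<Sum>m\<in>?M. (n choose m) * num_graphs \<G> m * num_graphs \<G> (n - m))"
        unfolding S2_def by (intro of_nat_mono card_missed_large closed elim)
      then show "real (card S2) \<le> (\<Sum>m\<in>?M. s m)"
        by (simp add: s_def)
    qed simp
    finally have "(\<Sum>g\<in>S2. real (missed g) ^ j) / N
      \<le> real n ^ j * (\<Sum>m\<in>?M. s m) / N"
      by (intro divide_right_mono) (auto simp: N_def)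
    also have "\<dots> = real n ^ j * (\<Sum>m\<in>?M. s m / N)"
      unfolding sum_divide_distrib[symmetric] by simp
    also have "(\<Sum>m\<in>?M. s m / N)
      = (\<Sum>m\<in>?M. gam m * gam (n - m) / gam n)"
    proof (intro sum.cong refl)
      fix m assume "m \<in> ?M"
      then have "m \<le> n" by simp
      then show "s m / N = gam m * gam (n - m) / gam n"
        unfolding s_def gam_def N_def num_graphs_def[of \<G> n, symmetric] by (rule weighted_binomial_ratio[OF _ \<rho>])
    qed
    finally have T: "(\<Sum>g\<in>S2. real (missed g) ^ j) / N \<le> ?T n"
      by (simp only: sum_divide_distrib[symmetric] times_divide_eq_right)
    have "0 \<le> (\<Sum>g\<in>S2. real (missed g) ^ j) / N" by (auto simp: N_def intro!: divide_nonneg_nonneg sum_nonneg)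
    then show ?case using T unfolding E H by simp
  qed
  then have lo: "\<forall>\<^sub>F n in sequentially. ?H n \<le> ?E n" and hi: "\<forall>\<^sub>F n in sequentially. ?E n \<le> ?H n + ?T n"
    by (auto elim: eventually_mono)
  have H_lim: "?H \<longlonglongrightarrow> (\<Sum>k. real k ^ j * gam k) / suminf gam"
    using moment_head_limit[OF j] by (simp add: Gam_def)
  moreover have "(\<lambda>n. ?H n + ?T n) \<longlonglongrightarrow> (\<Sum>k. real k ^ j * gam k) / suminf gam"
    using tendsto_add[OF H_lim moment_tail_limit[OF j]] by simp
  ultimately show "?E \<longlonglongrightarrow> (\<Sum>k. real k ^ j * gam k) / suminf gam"
    by (rule tendsto_sandwich[OF lo hi])
qed

text \<open>For every centre \<mu> the terms are eventually at least a constant times k^(-1/2),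
  which is not summable.\<close>

lemma infinite_variance:
  fixes P :: "nat pmf"
  assumes lim: "(\<lambda>k. pmf P k * real k powr (5/2)) \<longlonglongrightarrow> c" and c: "0 < c"
  shows "\<not> integrable (measure_pmf P) (\<lambda>k. (real k - \<mu>)\<^sup>2)"
proof
  assume "integrable (measure_pmf P) (\<lambda>k. (real k - \<mu>)\<^sup>2)"
  then have "summable (\<lambda>k. norm (pmf P k *\<^sub>R (real k - \<mu>)\<^sup>2))"
    unfolding measure_pmf_eq_density by (subst (asm) integrable_density) (auto simp: integrable_count_space_nat_iff)
  then have sm: "summable (\<lambda>k. pmf P k * (real k - \<mu>)\<^sup>2)" by (simp add: abs_mult)
  have "(\<lambda>k. ((real k - \<mu>) / real k)\<^sup>2) \<longlonglongrightarrow> 1" by real_asymp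
  from tendsto_mult[OF lim this]
  have "(\<lambda>k. pmf P k * real k powr (5/2) * ((real k - \<mu>) / real k)\<^sup>2) \<longlonglongrightarrow> c" by simp
  then have "\<forall>\<^sub>F k in sequentially. c / 2 < pmf P k * real k powr (5/2) * ((real k - \<mu>) / real k)\<^sup>2"
    by (rule order_tendstoD(1)) (use c in simp)
  then have "\<forall>\<^sub>F k in sequentially. norm (c / 2 * real k powr (- 1/2)) \<le> pmf P k * (real k - \<mu>)\<^sup>2"
    using eventually_gt_at_top[of 0]
  proof eventually_elim
    case (elim k)
    have "real k powr (5/2) = real k powr (2 + 1/2)" by simp
    also have "\<dots> = (real k)\<^sup>2 * real k powr (1/2)" using elim unfolding powr_add by (simp add: powr_realpow)
    finally have "real k powr (5/2) = (real k)\<^sup>2 * real k powr (1/2)" .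
    then have eq: "pmf P k * real k powr (5/2) * ((real k - \<mu>) / real k)\<^sup>2 = (pmf P k * (real k - \<mu>)\<^sup>2) * real k powr (1/2)"
      using elim by (simp add: power_divide)
    have "c / 2 * real k powr (- 1/2) \<le> (pmf P k * (real k - \<mu>)\<^sup>2) * real k powr (1/2) * real k powr (- 1/2)"
      using elim(1)[unfolded eq] elim(2) by (intro mult_right_mono less_imp_le) auto
    also have "\<dots> = pmf P k * (real k - \<mu>)\<^sup>2 * (real k powr (1/2) * real k powr (- 1/2))" by simp
    also have "real k powr (1/2) * real k powr (- 1/2) = 1" using elim by (simp flip: powr_add)
    finally show ?case using c by simp
  qed
  from summable_comparison_test_ev[OF this sm] have "summable (\<lambda>k. c / 2 * real k powr (- 1/2))" .
  then have "summable (\<lambda>k. real k powr (- 1/2))" using c by (subst (asm) summable_cmult_iff) auto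
  then show False by (simp add: summable_real_powr_iff)
qed

section \<open>Initial coefficients and radii of convergence\<close>

lemma num_two_connected_1: "num_two_connected \<G> 1 = 0"
proof -
  have "{g \<in> graphs_on \<G> 1. two_connected g} = {}"
    by (auto simp: graphs_on_def two_connected_def)
  then show ?thesis by (simp only: num_two_connected_def card.empty)
qed

lemma num_connected_0: "num_connected \<G> 0 = 0"
proof -
  have "{g \<in> graphs_on \<G> 0. connected_graph g} = {}"
    by (auto simp: graphs_on_def connected_graph_def)
  then show ?thesis by (simp only: num_connected_def card.empty)
qed

text \<open>For n >= 1 a coefficient is dominated by n times itself, so differentiation cannot
  enlarge the radius either. Equality is needed to carry \<rho> over from C to x C'.\<close>

lemma fps_conv_radius_X_deriv:
  fixes F :: "real fps"
  shows "fps_conv_radius (fps_X * fps_deriv F) = fps_conv_radius F"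
proof (rule antisym)
  have "fps_conv_radius F \<le> fps_conv_radius (fps_deriv F)" by (rule fps_conv_radius_deriv)
  also have "\<dots> \<le> fps_conv_radius (fps_X * fps_deriv F)"
    using fps_conv_radius_mult[of fps_X "fps_deriv F"] by simp
  finally show "fps_conv_radius F \<le> fps_conv_radius (fps_X * fps_deriv F)" .
  have X: "fps_nth (fps_X * fps_deriv F) k = real k * fps_nth F k" for k by (cases k) auto
  show "fps_conv_radius (fps_X * fps_deriv F) \<le> fps_conv_radius F"
  proof (rule ccontr)
    assume "\<not> fps_conv_radius (fps_X * fps_deriv F) \<le> fps_conv_radius F"
    then obtain r where r: "fps_conv_radius F < ereal r" "ereal r < fps_conv_radius (fps_X * fps_deriv F)"
      using ereal_dense2 by (meson not_le)
    have "0 \<le> fps_conv_radius F" by (simp add: fps_conv_radius_def conv_radius_nonneg)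
    then have r0: "0 < r" using r(1) by (metis ereal_less(2) order_le_less_trans)
    have "summable (\<lambda>n. norm (fps_nth (fps_X * fps_deriv F) n * r ^ n))"
      by (rule norm_summable_fps) (use r r0 in simp)
    then have "summable (\<lambda>n. fps_nth F n * r ^ n)"
    proof (rule summable_comparison_test'[where N = 1])
      fix n :: nat assume "1 \<le> n"
      then have "1 * \<bar>fps_nth F n * r ^ n\<bar> \<le> real n * \<bar>fps_nth F n * r ^ n\<bar>" by (intro mult_right_mono) auto
      then show "norm (fps_nth F n * r ^ n) \<le> norm (fps_nth (fps_X * fps_deriv F) n * r ^ n)"
        unfolding X by (simp add: abs_mult)
    qed
    then have "norm r \<le> fps_conv_radius F" unfolding fps_conv_radius_def by (rule conv_radius_geI)
    then show False using r(1) r0 by simp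
  qed
qed

lemma X_times_deriv_sums:
  fixes F :: "real fps"
  assumes "(\<lambda>n. fps_nth (fps_deriv F) n * x ^ n) sums s"
  shows "(\<lambda>n. real n * fps_nth F n * x ^ n) sums (x * s)"
proof -
  have "(\<lambda>n. x * (fps_nth (fps_deriv F) n * x ^ n)) sums (x * s)" by (rule sums_mult[OF assms])
  moreover have "x * (fps_nth (fps_deriv F) n * x ^ n) = real (Suc n) * fps_nth F (Suc n) * x ^ Suc n" for n
    by simp
  ultimately have "(\<lambda>n. real (Suc n) * fps_nth F (Suc n) * x ^ Suc n) sums (x * s)" by (simp only:)
  from sums_Suc[OF this] show ?thesis by simp
qed

section \<open>The two cases and the limit law\<close>

theorem theorem9:
  fixes \<G> :: "graph set" and R \<tau> \<rho> C0 C2 C4 C5 :: real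
  assumes closed: "closed_class \<G>"
    and T_sing: "T_singular \<G>"
    and G_eq: "(G_gf \<G> :: real fps) = fps_exp 1 oo C_gf \<G>"
    and C_eq: "fps_X * fps_deriv (C_gf \<G> :: real fps) =
       fps_X * (fps_exp 1 oo (fps_deriv (B_gf \<G>) oo (fps_X * fps_deriv (C_gf \<G>))))"
    and R: "0 < R" "fps_conv_radius (B_gf \<G> :: real fps) = ereal R"
    and cases: "case_one \<G> R \<tau> \<rho> \<or> case_two \<G> R \<rho> C0 C2 C4 C5"
    and rho: "fps_conv_radius (C_gf \<G> :: real fps) = ereal \<rho>"
  shows "\<exists>(p :: real) (P :: nat pmf).
    (\<lambda>n. real (num_connected \<G> n) / real (num_graphs \<G> n)) \<longlonglongrightarrow> p \<and>
    (\<forall>k. pmf P k = p * real (num_graphs \<G> k) * (\<rho> ^ k / fact k)) \<and>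
    (\<forall>k. (\<lambda>n. measure_pmf.prob (random_graph \<G> n) {g. missed g = k}) \<longlonglongrightarrow> pmf P k) \<and>
    (\<exists>\<alpha>\<in>{5/2, 7/2}. subexp_estimate (num_graphs \<G>) \<rho> \<alpha> \<and>
       (\<exists>c>0. pmf P \<sim>[at_top] (\<lambda>k. c * real k powr (- \<alpha>)))) \<and>
    pmf P sums 1 \<and>
    (case_one \<G> R \<tau> \<rho> \<longrightarrow>
       (\<lambda>n. measure_pmf.expectation (random_graph \<G> n) (\<lambda>g. real (missed g))) \<longlonglongrightarrow> \<tau> \<and>
       \<not> integrable (measure_pmf P) (\<lambda>k. (real k - measure_pmf.expectation P real)\<^sup>2)) \<and>
    (case_two \<G> R \<rho> C0 C2 C4 C5 \<longrightarrow>
       (\<lambda>n. measure_pmf.expectation (random_graph \<G> n) (\<lambda>g. real (missed g))) \<longlonglongrightarrow> R \<and>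
       (\<lambda>n. measure_pmf.variance (random_graph \<G> n) (\<lambda>g. real (missed g))) \<longlonglongrightarrow> R + 2 * C4)"
proof -
  let ?E = "\<lambda>n. measure_pmf.expectation (random_graph \<G> n) (\<lambda>g. real (missed g))"
  let ?E2 = "\<lambda>n. measure_pmf.expectation (random_graph \<G> n) (\<lambda>g. (real (missed g))\<^sup>2)"
  let ?V = "\<lambda>n. measure_pmf.variance (random_graph \<G> n) (\<lambda>g. real (missed g))"
  define \<beta> :: "real fps" where "\<beta> = fps_deriv (B_gf \<G>)"
  define U :: "real fps" where "U = fps_X * fps_deriv (C_gf \<G>)"
  define a where "a n = real (num_connected \<G> n) / fact n * \<rho> ^ n" for n
  define gam where "gam n = real (num_graphs \<G> n) / fact n * \<rho> ^ n" for n
  have Cn: "fps_nth (C_gf \<G> :: real fps) n = real (num_connected \<G> n) / fact n" for n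
    by (simp add: C_gf_def egf_def)
  have Gn: "fps_nth (G_gf \<G> :: real fps) n = real (num_graphs \<G> n) / fact n" for n
    by (simp add: G_gf_def egf_def)
  have Bn: "fps_nth (B_gf \<G> :: real fps) n = real (num_two_connected \<G> n) / fact n" for n
    by (simp add: B_gf_def egf_def)
  have \<beta>_nn: "0 \<le> fps_nth \<beta> n" for n by (simp add: \<beta>_def Bn)
  have \<beta>0: "fps_nth \<beta> 0 = 0" using num_two_connected_1[of \<G>] by (simp add: \<beta>_def Bn)
  have \<beta>1: "0 < fps_nth \<beta> 1"
    using num_two_connected_2_pos[OF closed] by (simp add: \<beta>_def Bn numeral_2_eq_2)
  have Un: "fps_nth U n = real n * fps_nth (C_gf \<G>) n" for n by (cases n) (auto simp: U_def)
  have U_nn: "0 \<le> fps_nth U n" for n by (simp add: Un Cn)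
  have U_eq: "U = fps_X * (fps_exp 1 oo (\<beta> oo U))" unfolding U_def \<beta>_def by (rule C_eq)
  have cU: "fps_conv_radius U = ereal \<rho>" unfolding U_def fps_conv_radius_X_deriv by (rule rho)
  have U_a: "fps_nth U n * \<rho> ^ n = real n * a n" for n by (simp add: Un Cn a_def)
  have c\<beta>: "ereal R \<le> fps_conv_radius \<beta>" unfolding \<beta>_def R(2)[symmetric] by (rule fps_conv_radius_deriv)
  have one_two: "\<not> (case_one \<G> R \<tau> \<rho> \<and> case_two \<G> R \<rho> C0 C2 C4 C5)"
    by (auto simp: case_one_def case_two_def)
  have one: "0 < \<rho> \<and> (\<lambda>n. real n * a n) sums \<tau> \<and> (\<exists>b>0. (\<lambda>n. a n * real n powr (5/2)) \<longlonglongrightarrow> b)"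
    if "case_one \<G> R \<tau> \<rho>"
  proof -
    have \<tau>: "0 < \<tau>" "\<tau> < R" "\<tau> * eval_fps (fps_deriv \<beta>) \<tau> = 1" "\<rho> = \<tau> * exp (- eval_fps \<beta> \<tau>)"
      using that unfolding case_one_def \<beta>_def by auto
    have c\<tau>: "ereal \<tau> < fps_conv_radius \<beta>" using \<tau>(2) c\<beta> by (metis ereal_less_eq(3) less_ereal.simps(1) order_less_le_trans)
    have \<rho>0: "0 < \<rho>" using \<tau> by simp
    have "(\<lambda>n. fps_nth (fps_deriv \<beta>) n * \<tau> ^ n) sums eval_fps (fps_deriv \<beta>) \<tau>"
      by (rule sums_eval_fps) (use c\<tau> \<tau>(1) fps_conv_radius_deriv[of \<beta>] in \<open>auto intro: order_less_le_trans\<close>)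
    from X_times_deriv_sums[OF this] have s1: "(\<lambda>n. real n * fps_nth \<beta> n * \<tau> ^ n) sums 1" using \<tau> by simp
    have "summable (\<lambda>n. fps_nth \<beta> n * \<tau> ^ n)" by (rule summable_fps) (use c\<tau> \<tau> in simp)
    then have 1: "(\<lambda>n. real n * a n) sums \<tau>"
      using tree_function_at_singularity[OF U_eq U_nn cU \<rho>0 \<beta>0 \<beta>1 \<beta>_nn \<tau>(1) _ _ _ \<tau>(4)] s1
      by (simp add: sums_iff U_a)
    obtain b where b: "0 < b" "(\<lambda>n. fps_nth U n * \<rho> ^ n * real n powr (3/2)) \<longlonglongrightarrow> b"
      using tree_coefficients_asymptotic[OF U_eq \<beta>0 \<beta>1 \<beta>_nn \<tau>(1) c\<tau> s1 \<tau>(4)] by blast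
    have eq: "real n * a n * real n powr (3/2) = a n * real n powr (5/2)" for n
    proof (cases "n = 0")
      case False
      have "real n powr (5/2) = real n powr (1 + 3/2)" by simp
      also have "\<dots> = real n * real n powr (3/2)" using False unfolding powr_add by simp
      finally show ?thesis by simp
    qed simp
    have "(\<lambda>n. a n * real n powr (5/2)) \<longlonglongrightarrow> b" using b(2) by (simp only: U_a eq)
    then show ?thesis using \<rho>0 1 b(1) by blast
  qed
  have two: "0 < \<rho> \<and> (\<lambda>n. real n * a n) sums R \<and> (\<exists>b>0. (\<lambda>n. a n * real n powr (7/2)) \<longlonglongrightarrow> b)
      \<and> (\<Sum>n. real n * (real n - 1) * a n) = 2 * C4"
    if c2: "case_two \<G> R \<rho> C0 C2 C4 C5"
  proof -
    obtain D F where cont: "dented_continuation (C_gf \<G>) \<rho> D F"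
      and O: "(\<lambda>z. F z - (of_real C0 + of_real C2 * csqrt (1 - z / of_real \<rho>) ^ 2
          + of_real C4 * csqrt (1 - z / of_real \<rho>) ^ 4 + of_real C5 * csqrt (1 - z / of_real \<rho>) ^ 5))
        \<in> O[at (of_real \<rho>) within D](\<lambda>z. csqrt (1 - z / of_real \<rho>) ^ 6)"
      using c2 unfolding case_two_def Let_def by (elim conjE exE) (rule that)
    have C5: "C5 \<noteq> 0" and \<rho>_eq: "\<rho> = R * exp (- eval_fps \<beta> R)" and RB2: "RB2 \<G> R < 1"
      using c2 unfolding case_two_def \<beta>_def by auto
    have \<rho>0: "0 < \<rho>" using cont by (simp add: dented_continuation_def)
    \<comment> \<open>The generating functions are polymorphic in the coefficient field: the
      singular expansion concerns the complex series, nonnegativity the real one.\<close>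
    have CC: "(C_gf \<G> :: complex fps) = complex_fps (C_gf \<G>)"
      by (rule fps_ext) (simp add: C_gf_def egf_def)
    obtain b where b: "0 < b" "(\<lambda>n. a n * real n powr (7/2)) \<longlonglongrightarrow> b"
      and C4: "(\<Sum>n. real n * (real n - 1) * a n) = 2 * C4"
      using singular_expansion_coefficients[OF _ C5 cont[unfolded CC] O rho] by (auto simp: Cn a_def)
    have d_nn: "0 \<le> fps_nth (fps_deriv \<beta>) n * R ^ n" for n using \<beta>_nn R by simp
    \<comment> \<open>The quantity R B''(R) may be infinite a priori. Being below 1, it is finite,
      which gives convergence of \<beta>' and then of \<beta> at the boundary point R.\<close>
    have RB2': "ennreal R * (\<Sum>n. ennreal (fps_nth (fps_deriv \<beta>) n * R ^ n)) < 1"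
      using RB2 by (simp only: RB2_def \<beta>_def)
    then have "(\<Sum>n. ennreal (fps_nth (fps_deriv \<beta>) n * R ^ n)) \<noteq> top"
      using R by (auto simp: ennreal_mult_top)
    then have sm: "summable (\<lambda>n. fps_nth (fps_deriv \<beta>) n * R ^ n)"
      using summable_suminf_not_top[of "\<lambda>n. fps_nth (fps_deriv \<beta>) n * R ^ n"] d_nn by blast
    define s where "s = (\<Sum>n. fps_nth (fps_deriv \<beta>) n * R ^ n)"
    have s: "(\<lambda>n. real n * fps_nth \<beta> n * R ^ n) sums (R * s)"
      unfolding s_def by (rule X_times_deriv_sums[OF summable_sums[OF sm]])
    have "0 \<le> s" unfolding s_def by (rule suminf_nonneg[OF sm d_nn])
    then have "ennreal (R * s) < 1"
      using RB2' R unfolding suminf_ennreal2[of "\<lambda>n. fps_nth (fps_deriv \<beta>) n * R ^ n", OF d_nn sm] by (simp add: ennreal_mult s_def)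
    then have le1: "R * s \<le> 1" by (simp add: ennreal_less_one_iff)
    have sm0: "summable (\<lambda>n. fps_nth \<beta> n * R ^ n)"
    proof (rule summable_comparison_test'[where N = 1])
      show "summable (\<lambda>n. real n * fps_nth \<beta> n * R ^ n)" using s by (simp add: sums_iff)
      fix n :: nat assume "1 \<le> n"
      then have "1 * (fps_nth \<beta> n * R ^ n) \<le> real n * (fps_nth \<beta> n * R ^ n)"
        using \<beta>_nn R by (intro mult_right_mono) auto
      then show "norm (fps_nth \<beta> n * R ^ n) \<le> real n * fps_nth \<beta> n * R ^ n" using \<beta>_nn R by (simp add: abs_mult mult_ac)
    qed
    have "(\<lambda>n. real n * a n) sums R"
      using tree_function_at_singularity[OF U_eq U_nn cU \<rho>0 \<beta>0 \<beta>1 \<beta>_nn R(1) sm0 _ _ \<rho>_eq] s le1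
      by (simp add: sums_iff U_a)
    then show ?thesis using \<rho>0 b C4 by blast
  qed
  define \<alpha> :: real where "\<alpha> = (if case_one \<G> R \<tau> \<rho> then 5/2 else 7/2)"
  have \<rho>0: "0 < \<rho>" using cases one two by blast
  have "\<exists>b>0. (\<lambda>n. a n * real n powr \<alpha>) \<longlonglongrightarrow> b"
    using cases one two by (cases "case_one \<G> R \<tau> \<rho>") (simp_all add: \<alpha>_def)
  then obtain b where b: "0 < b" and a_lim: "(\<lambda>n. a n * real n powr \<alpha>) \<longlonglongrightarrow> b" by blast
  have "exp_sequence (\<lambda>n. fps_nth (C_gf \<G>) n * \<rho> ^ n) (\<lambda>n. fps_nth (G_gf \<G>) n * \<rho> ^ n) \<alpha> b"
    by (rule exp_sequence_fps[OF G_eq])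
      (use \<rho>0 b a_lim num_connected_0[of \<G>] in \<open>simp_all add: Cn Gn a_def \<alpha>_def\<close>)
  then have es: "exp_sequence a gam \<alpha> b" by (simp add: Cn Gn a_def[abs_def] gam_def[abs_def])
  then interpret exp_sequence a gam \<alpha> b .
  note law = missed_limit_law[OF closed \<rho>0 es[unfolded a_def[abs_def] gam_def[abs_def]], folded gam_def, folded Gam_def]
  have Gam: "0 < Gam" using Gam_ge_1 by simp
  \<comment> \<open>The limiting probability p of being connected is 1/\<open>Gam\<close>, so these
    weights are the claimed p_k.\<close>
  define P where "P = embed_pmf (\<lambda>k. gam k / Gam)"
  have gam_sums: "(\<lambda>k. gam k / Gam) sums 1"
    using sums_divide[OF summable_sums[OF summable_gam0], of Gam] Gam by (simp add: Gam_def)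
  have nn: "0 \<le> gam k / Gam" for k
    using gam_nonneg[of k] Gam by (intro divide_nonneg_nonneg) auto
  have pmf_P: "pmf P k = gam k / Gam" for k
    unfolding P_def
  proof (rule pmf_embed_pmf[OF nn])
    show "(\<integral>\<^sup>+ k. ennreal (gam k / Gam) \<partial>count_space UNIV) = 1"
      unfolding nn_integral_count_space_nat suminf_ennreal_eq[of "\<lambda>k. gam k / Gam", OF nn gam_sums]
      by (rule ennreal_1)
  qed
  have P_lim: "(\<lambda>k. pmf P k * real k powr \<alpha>) \<longlonglongrightarrow> b"
    using tendsto_divide[OF gam_limit tendsto_const[of Gam]] Gam by (simp add: pmf_P)
  have asym: "pmf P \<sim>[at_top] (\<lambda>k. b * real k powr (- \<alpha>))"
  proof (rule asymp_equivI')
    have "(\<lambda>k. pmf P k * real k powr \<alpha> / b) \<longlonglongrightarrow> b / b"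
      using b by (intro tendsto_divide P_lim tendsto_const) auto
    moreover have "pmf P k / (b * real k powr (- \<alpha>)) = pmf P k * real k powr \<alpha> / b" for k
      by (simp add: powr_minus divide_inverse)
    ultimately show "(\<lambda>k. pmf P k / (b * real k powr (- \<alpha>))) \<longlonglongrightarrow> 1" using b by simp
  qed
  have subexp: "subexp_estimate (num_graphs \<G>) \<rho> \<alpha>"
    unfolding subexp_estimate_def
  proof (intro exI[of _ "b * Gam"] conjI asymp_equivI')
    show "0 < b * Gam" by (rule bGam_pos)
    have ne: "b * Gam \<noteq> 0" using bGam_pos by linarith
    have "(\<lambda>n. gam n * real n powr \<alpha> / (b * Gam)) \<longlonglongrightarrow> 1"
      using tendsto_divide[OF gam_limit tendsto_const ne] unfolding divide_self[OF ne] .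
    moreover have "real (num_graphs \<G> n) / (b * Gam * real n powr (- \<alpha>) * (1 / \<rho>) ^ n * fact n)
        = gam n * real n powr \<alpha> / (b * Gam)" for n
      by (simp add: gam_def powr_minus power_one_over power_inverse divide_inverse)
    ultimately show "(\<lambda>n. real (num_graphs \<G> n) / (b * Gam * real n powr (- \<alpha>) * (1 / \<rho>) ^ n * fact n)) \<longlonglongrightarrow> 1"
      by (simp only:)
  qed
  have first: "?E \<longlonglongrightarrow> (\<Sum>k. real k * a k)"
    using law(2)[of 1] \<alpha>_gt Gam by (simp add: first_moment)
  have lim_connected: "(\<lambda>n. real (num_connected \<G> n) / real (num_graphs \<G> n)) \<longlonglongrightarrow> 1 / Gam"
    using connected_limit \<rho>0 by (simp add: a_def gam_def)
  have case1: "?E \<longlonglongrightarrow> \<tau> \<and>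
       \<not> integrable (measure_pmf P) (\<lambda>k. (real k - measure_pmf.expectation P real)\<^sup>2)"
    if "case_one \<G> R \<tau> \<rho>"
  proof
    show "?E \<longlonglongrightarrow> \<tau>"
      using first one[OF that] by (simp add: sums_iff)
    have "\<alpha> = 5/2" using that by (simp add: \<alpha>_def)
    from infinite_variance[OF P_lim[unfolded this] b]
    show "\<not> integrable (measure_pmf P) (\<lambda>k. (real k - measure_pmf.expectation P real)\<^sup>2)" .
  qed
  have case2: "?E \<longlonglongrightarrow> R \<and>
       ?V \<longlonglongrightarrow> R + 2 * C4"
    if c2: "case_two \<G> R \<rho> C0 C2 C4 C5"
  proof
    have S1: "(\<Sum>k. real k * a k) = R" using two[OF c2] by (simp add: sums_iff)
    show E1: "?E \<longlonglongrightarrow> R"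
      using first S1 by simp
    have \<alpha>: "\<alpha> = 7/2" using one_two c2 by (simp add: \<alpha>_def)
    \<comment> \<open>The factorial moment 2 C4 plus the mean R. By \<open>second_moment\<close>
      this is the variance of the limit law: the second moment exceeds it by R^2.\<close>
    have "(\<Sum>k. (real k)\<^sup>2 * a k) = R + 2 * C4"
    proof -
      have "summable (\<lambda>k. real k * a k)" using summable_a[of 1] \<alpha> by simp
      moreover have "summable (\<lambda>k. (real k)\<^sup>2 * a k)" using summable_a[of 2] \<alpha> by simp
      ultimately have "(\<Sum>k. (real k)\<^sup>2 * a k - real k * a k) = (\<Sum>k. (real k)\<^sup>2 * a k) - R"
        using suminf_diff[of "\<lambda>k. (real k)\<^sup>2 * a k" "\<lambda>k. real k * a k"] S1 by metis
      moreover have "(real k)\<^sup>2 * a k - real k * a k = real k * (real k - 1) * a k" for k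
        by (simp add: power2_eq_square algebra_simps)
      ultimately show ?thesis using two[OF c2] by simp
    qed
    then have E2: "?E2 \<longlonglongrightarrow> R + 2 * C4 + R\<^sup>2"
      using law(2)[of 2] second_moment \<alpha> Gam S1 by (simp add: add_divide_distrib)
    have "(\<lambda>n. ?E2 n
        - (?E n)\<^sup>2) \<longlonglongrightarrow> R + 2 * C4 + R\<^sup>2 - R\<^sup>2"
      by (intro tendsto_intros E1 E2)
    \<comment> \<open>The identity is used only for large n, where the uniform distribution lives on
      a finite nonempty set and all moments exist.\<close>
    moreover have "\<forall>\<^sub>F n in sequentially. ?E2 n
        - (?E n)\<^sup>2
        = ?V n"
      using law(3)
    proof eventually_elim
      case (elim n)
      then have "finite (set_pmf (random_graph \<G> n))" by (simp add: random_graph_def)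
      then show ?case by (subst measure_pmf.variance_eq) (auto intro: integrable_measure_pmf_finite)
    qed
    ultimately have "?V \<longlonglongrightarrow> R + 2 * C4 + R\<^sup>2 - R\<^sup>2"
      by (rule Lim_transform_eventually)
    then show "?V \<longlonglongrightarrow> R + 2 * C4" by simp
  qed
  show ?thesis
  proof (intro exI[of _ "1 / Gam"] exI[of _ P] conjI allI impI)
    show "pmf P k = 1 / Gam * real (num_graphs \<G> k) * (\<rho> ^ k / fact k)" for k
      by (simp add: pmf_P gam_def)
    show "(\<lambda>n. measure_pmf.prob (random_graph \<G> n) {g. missed g = k}) \<longlonglongrightarrow> pmf P k" for k
      unfolding pmf_P by (rule law(1))
    show "\<exists>\<alpha>\<in>{5/2, 7/2}. subexp_estimate (num_graphs \<G>) \<rho> \<alpha> \<and> (\<exists>c>0. pmf P \<sim>[at_top] (\<lambda>k. c * real k powr (- \<alpha>)))"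
      using subexp asym b by (intro bexI[of _ \<alpha>]) (auto simp: \<alpha>_def)
    show "pmf P sums 1" using gam_sums by (simp add: pmf_P[abs_def])
  qed (use lim_connected case1 case2 in blast)+
qed

end
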